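(* Let $n\ge1$ and let $\boldsymbol\alpha=(\alpha_1,\dots,\alpha_n)\in\mathbb{R}^n$ with $\alpha_k\notin\pi\mathbb{Z}$ for $k=1,\dots,n$. Then the fractional Riesz transforms satisfy $$\sum_{j=1}^n\big(R_j^{\boldsymbol\alpha}\big)^2=-I\quad\text{on } L^2(\mathbb{R}^n),$$ where $I$ is the identity operator.
   Context: For $\boldsymbol\alpha\in\mathbb{R}^n$ with all $\alpha_k\notin\pi\mathbb{Z}$, the chirp is $e_{\boldsymbol\alpha}(\boldsymbol x)=\exp\big(\tfrac{i}{2}\sum_{k=1}^n x_k^2\cot\alpha_k\big)$. For $1\le j\le n$ the $j$th fractional Riesz transform of a Schwartz function $f$ is $$R_j^{\boldsymbol\alpha}(f)(\boldsymbol x)=c_n\,e_{-\boldsymbol\alpha}(\boldsymbol x)\ \mathrm{p.v.}\int_{\mathbb{R}^n}\frac{x_j-y_j}{|\boldsymbol x-\boldsymbol y|^{n+1}}f(\boldsymbol y)e_{\boldsymbol\alpha}(\boldsymbol y)\,d\boldsymbol y,\qquad c_n=\frac{\Gamma(\frac{n+1}{2})}{\pi^{\frac{n+1}{2}}},$$ with principal value $\lim_{\varepsilon\to0^+}\int_{|\boldsymbol x-\boldsymbol y|\ge\varepsilon}$. On $L^2(\mathbb{R}^n)$, $R_j^{\boldsymbol\alpha}$ denotes the unique bounded extension. *)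

theory Defs
  imports "HOL-Analysis.Analysis"
begin

section \<open>The Hilbert space of square-integrable complex functions\<close>

definition square_integrable :: "('a::euclidean_space \<Rightarrow> complex) \<Rightarrow> bool" where
  "square_integrable f \<longleftrightarrow>
     f \<in> borel_measurable lborel \<and> integrable lborel (\<lambda>x. (cmod (f x))\<^sup>2)"

definition L2_rel :: "('a::euclidean_space \<Rightarrow> complex) \<Rightarrow> ('a \<Rightarrow> complex) \<Rightarrow> bool" where
  "L2_rel f g \<longleftrightarrow> square_integrable f \<and> square_integrable g \<and> (AE x in lborel. f x = g x)"

lemma square_integrable_zero: "square_integrable (\<lambda>_. 0)"
  by (simp add: square_integrable_def)

lemma part_equivp_L2_rel: "part_equivp L2_rel"
proof (rule part_equivpI)
  show "\<exists>f. L2_rel f f"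
    using square_integrable_zero by (auto simp: L2_rel_def)
  show "symp L2_rel"
    by (auto simp: symp_def L2_rel_def elim: eventually_mono)
  show "transp L2_rel"
    unfolding transp_def L2_rel_def by (auto elim: eventually_elim2)
qed

text \<open>
  Borel representatives suffice: every Lebesgue measurable function agrees almost everywhere
  with a Borel measurable one.
\<close>

quotient_type (overloaded) 'a L2 = "'a::euclidean_space \<Rightarrow> complex" / partial: L2_rel
  morphisms rep_L2 L2_class
  by (rule part_equivp_L2_rel)

lemma square_integrable_integrable_inner:
  assumes "square_integrable f" "square_integrable g"
  shows "integrable lborel (\<lambda>x. f x \<bullet> g x)"
proof (rule Bochner_Integration.integrable_bound)
  show "integrable lborel (\<lambda>x. (cmod (f x))\<^sup>2 + (cmod (g x))\<^sup>2)"
    using assms by (simp add: square_integrable_def)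
  show "(\<lambda>x. f x \<bullet> g x) \<in> borel_measurable lborel"
    using assms by (auto simp: square_integrable_def)
  have "\<bar>a \<bullet> b\<bar> \<le> (cmod a)\<^sup>2 + (cmod b)\<^sup>2" for a b :: complex
  proof -
    have "\<bar>a \<bullet> b\<bar> \<le> cmod a * cmod b"
      by (rule Cauchy_Schwarz_ineq2)
    also have "2 * (cmod a * cmod b) \<le> (cmod a)\<^sup>2 + (cmod b)\<^sup>2"
      using sum_squares_bound[of "cmod a" "cmod b"] by (simp add: mult.assoc)
    then have "cmod a * cmod b \<le> (cmod a)\<^sup>2 + (cmod b)\<^sup>2"
      by (smt (verit) mult_nonneg_nonneg norm_ge_zero)
    finally show ?thesis .
  qed
  then show "AE x in lborel. norm (f x \<bullet> g x) \<le> norm ((cmod (f x))\<^sup>2 + (cmod (g x))\<^sup>2)"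
    by simp
qed

lemma square_integrable_add:
  assumes "square_integrable f" "square_integrable g"
  shows "square_integrable (\<lambda>x. f x + g x)"
proof -
  have "(\<lambda>x. (cmod (f x + g x))\<^sup>2) = (\<lambda>x. (cmod (f x))\<^sup>2 + (cmod (g x))\<^sup>2 + 2 * (f x \<bullet> g x))"
    by (auto simp: power2_norm_eq_inner inner_add_left inner_add_right inner_commute)
  moreover have "(\<lambda>x. f x + g x) \<in> borel_measurable lborel"
    using assms by (auto simp: square_integrable_def)
  ultimately show ?thesis
    using assms square_integrable_integrable_inner[OF assms]
    by (simp add: square_integrable_def)
qed

lemma square_integrable_scaleR:
  "square_integrable f \<Longrightarrow> square_integrable (\<lambda>x. r *\<^sub>R f x)"
  by (auto simp: square_integrable_def power_mult_distrib)

lemma square_integrable_uminus: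
  "square_integrable f \<Longrightarrow> square_integrable (\<lambda>x. - f x)"
  using square_integrable_scaleR[of f "-1"] by simp

lemma square_integrable_diff:
  "square_integrable f \<Longrightarrow> square_integrable g \<Longrightarrow> square_integrable (\<lambda>x. f x - g x)"
  using square_integrable_add[of f "\<lambda>x. - g x"] square_integrable_uminus[of g] by simp

text \<open>
  \<^typ>\<open>'a L2\<close> is made a real inner product space by the real part of the usual Hermitian product
  (for complex numbers, \<open>z \<bullet> w = Re (z * cnj w)\<close>); this yields the usual norm
  \<open>(\<integral> |f|\<^sup>2)\<^sup>1\<^sup>/\<^sup>2\<close>.
\<close>

instantiation L2 :: (euclidean_space) real_inner
begin

lift_definition zero_L2 :: "'a L2" is "\<lambda>_. 0"
  by (simp add: L2_rel_def square_integrable_zero)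

lift_definition plus_L2 :: "'a L2 \<Rightarrow> 'a L2 \<Rightarrow> 'a L2" is "\<lambda>f g x. f x + g x"
  by (auto simp: L2_rel_def square_integrable_add elim: eventually_elim2)

lift_definition minus_L2 :: "'a L2 \<Rightarrow> 'a L2 \<Rightarrow> 'a L2" is "\<lambda>f g x. f x - g x"
  by (auto simp: L2_rel_def square_integrable_diff elim: eventually_elim2)

lift_definition uminus_L2 :: "'a L2 \<Rightarrow> 'a L2" is "\<lambda>f x. - f x"
  by (auto simp: L2_rel_def square_integrable_uminus elim: eventually_mono)

lift_definition scaleR_L2 :: "real \<Rightarrow> 'a L2 \<Rightarrow> 'a L2" is "\<lambda>r f x. r *\<^sub>R f x"
  by (auto simp: L2_rel_def square_integrable_scaleR elim: eventually_mono)

lift_definition inner_L2 :: "'a L2 \<Rightarrow> 'a L2 \<Rightarrow> real" is "\<lambda>f g. LINT x|lborel. f x \<bullet> g x"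
proof -
  fix f f' g g' :: "'a \<Rightarrow> complex"
  assume 1: "L2_rel f f'" "L2_rel g g'"
  show "(LINT x|lborel. f x \<bullet> g x) = (LINT x|lborel. f' x \<bullet> g' x)"
  proof (rule integral_cong_AE)
    show "AE x in lborel. f x \<bullet> g x = f' x \<bullet> g' x"
      using 1 by (auto simp: L2_rel_def elim: eventually_elim2)
  qed (use 1 in \<open>auto simp: L2_rel_def square_integrable_def\<close>)
qed

lift_definition norm_L2 :: "'a L2 \<Rightarrow> real" is "\<lambda>f. sqrt (LINT x|lborel. (cmod (f x))\<^sup>2)"
proof -
  fix f g :: "'a \<Rightarrow> complex"
  assume 1: "L2_rel f g"
  have "(LINT x|lborel. (cmod (f x))\<^sup>2) = (LINT x|lborel. (cmod (g x))\<^sup>2)"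
  proof (rule integral_cong_AE)
    show "AE x in lborel. (cmod (f x))\<^sup>2 = (cmod (g x))\<^sup>2"
      using 1 by (auto simp: L2_rel_def elim: eventually_mono)
  qed (use 1 in \<open>auto simp: L2_rel_def square_integrable_def\<close>)
  then show "sqrt (LINT x|lborel. (cmod (f x))\<^sup>2) = sqrt (LINT x|lborel. (cmod (g x))\<^sup>2)"
    by simp
qed

definition sgn_L2 :: "'a L2 \<Rightarrow> 'a L2" where
  "sgn_L2 u = inverse (norm u) *\<^sub>R u"

definition dist_L2 :: "'a L2 \<Rightarrow> 'a L2 \<Rightarrow> real" where
  "dist_L2 u v = norm (u - v)"

definition uniformity_L2 :: "('a L2 \<times> 'a L2) filter" where
  "uniformity_L2 = (INF e\<in>{0<..}. principal {(u, v). dist u v < e})"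

definition open_L2 :: "'a L2 set \<Rightarrow> bool" where
  "open_L2 U \<longleftrightarrow> (\<forall>u\<in>U. \<forall>\<^sub>F (u', v) in uniformity. u' = u \<longrightarrow> v \<in> U)"

instance
proof
  fix u v w :: "'a L2" and r s :: real and U :: "'a L2 set"
  show "u + v + w = u + (v + w)"
    by transfer (auto simp: L2_rel_def add.assoc intro!: square_integrable_add)
  show "u + v = v + u"
    by transfer (auto simp: L2_rel_def add.commute intro!: square_integrable_add)
  show "0 + u = u"
    by transfer (auto simp: L2_rel_def)
  show "- u + u = 0"
    by transfer (auto simp: L2_rel_def square_integrable_zero)
  show "u - v = u + - v"
    by transfer (auto simp: L2_rel_def intro!: square_integrable_diff)
  show "r *\<^sub>R (u + v) = r *\<^sub>R u + r *\<^sub>R v"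
    by transfer (auto simp: L2_rel_def scaleR_add_right
        intro!: square_integrable_add square_integrable_scaleR)
  show "(r + s) *\<^sub>R u = r *\<^sub>R u + s *\<^sub>R u"
    by transfer (auto simp: L2_rel_def scaleR_add_left
        intro!: square_integrable_add square_integrable_scaleR)
  show "r *\<^sub>R s *\<^sub>R u = (r * s) *\<^sub>R u"
    by transfer (auto simp: L2_rel_def simp del: scaleR_conv_of_real
        intro!: square_integrable_scaleR)
  show "1 *\<^sub>R u = u"
    by transfer (auto simp: L2_rel_def)
  show "sgn u = inverse (norm u) *\<^sub>R u"
    by (rule sgn_L2_def)
  show "dist u v = norm (u - v)"
    by (rule dist_L2_def)
  show "uniformity = (INF e\<in>{0<..}. principal {(u, v). dist u v < e} :: ('a L2 \<times> 'a L2) filter)"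
    by (rule uniformity_L2_def)
  show "open U = (\<forall>u\<in>U. \<forall>\<^sub>F (u', v) in uniformity. u' = u \<longrightarrow> v \<in> U)"
    by (rule open_L2_def)
  show "u \<bullet> v = v \<bullet> u"
    by transfer (simp add: inner_commute)
  show "(u + v) \<bullet> w = u \<bullet> w + v \<bullet> w"
    by transfer
      (auto simp: L2_rel_def inner_add_left square_integrable_integrable_inner)
  show "(r *\<^sub>R u) \<bullet> v = r * (u \<bullet> v)"
    by transfer simp
  show "0 \<le> u \<bullet> u"
    by transfer simp
  show "(u \<bullet> u = 0) = (u = 0)"
  proof transfer
    fix f :: "'a \<Rightarrow> complex"
    assume "L2_rel f f"
    then have f: "square_integrable f"
      by (simp add: L2_rel_def)
    have "(LINT x|lborel. f x \<bullet> f x) = 0 \<longleftrightarrow> (AE x in lborel. f x \<bullet> f x = 0)"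
      using square_integrable_integrable_inner[OF f f] by (intro integral_nonneg_eq_0_iff_AE) auto
    then show "((LINT x|lborel. f x \<bullet> f x) = 0) = L2_rel f (\<lambda>_. 0)"
      using f by (simp add: L2_rel_def square_integrable_zero)
  qed
  show "norm u = sqrt (u \<bullet> u)"
    by transfer (simp add: power2_norm_eq_inner)
qed

end


section \<open>Schwartz functions\<close>

definition partial_deriv :: "'n \<Rightarrow> (real^'n \<Rightarrow> complex) \<Rightarrow> real^'n \<Rightarrow> complex" where
  "partial_deriv k f x = frechet_derivative f (at x) (axis k 1)"

text \<open>
  Mixed partial derivatives of arbitrary order are indexed by the list of the coordinates of
  differentiation. A function is smooth iff all of them are (Frechet) differentiable, in which
  case their order is irrelevant and they are the derivatives indexed by multi-indices.
\<close>

definition schwartz :: "(real^'n \<Rightarrow> complex) \<Rightarrow> bool" where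
  "schwartz f \<longleftrightarrow>
     (\<forall>ks. foldr partial_deriv ks f differentiable_on UNIV) \<and>
     (\<forall>(b :: 'n \<Rightarrow> nat) ks.
        bounded (range (\<lambda>x. (\<Prod>k\<in>UNIV. (x $ k) ^ b k) *\<^sub>R foldr partial_deriv ks f x)))"


section \<open>Fractional Riesz transforms\<close>

definition chirp :: "real^'n \<Rightarrow> real^'n \<Rightarrow> complex" where
  "chirp \<alpha> x = exp (\<i> / 2 * of_real (\<Sum>k\<in>UNIV. (x $ k)\<^sup>2 * cot (\<alpha> $ k)))"

definition riesz_const :: "'n itself \<Rightarrow> real" where
  "riesz_const _ = Gamma ((real CARD('n) + 1) / 2) / pi powr ((real CARD('n) + 1) / 2)"

definition frac_riesz_pv :: "real^'n \<Rightarrow> 'n \<Rightarrow> (real^'n \<Rightarrow> complex) \<Rightarrow> real^'n \<Rightarrow> complex" where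
  "frac_riesz_pv \<alpha> j f x =
     of_real (riesz_const TYPE('n)) * chirp (- \<alpha>) x *
     Lim (at_right 0) (\<lambda>\<epsilon>.
       LINT y:{y. \<epsilon> \<le> norm (x - y)}|lborel.
         of_real ((x $ j - y $ j) / norm (x - y) ^ (CARD('n) + 1)) * f y * chirp \<alpha> y)"

text \<open>
  The bounded extension to all of \<open>L\<^sup>2\<close>. Since Schwartz functions are dense, a bounded
  real-linear extension is already unique (and automatically complex-linear), so that describing
  it within \<^typ>\<open>(real^'n) L2 \<Rightarrow>\<^sub>L (real^'n) L2\<close> loses nothing.
\<close>

definition frac_riesz :: "real^'n \<Rightarrow> 'n \<Rightarrow> (real^'n) L2 \<Rightarrow>\<^sub>L (real^'n) L2" where
  "frac_riesz \<alpha> j =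
     (THE T. \<forall>f. schwartz f \<longrightarrow>
        square_integrable (frac_riesz_pv \<alpha> j f) \<and>
        blinfun_apply T (L2_class f) = L2_class (frac_riesz_pv \<alpha> j f))"

end

theory Submission
  imports Defs "HOL-Probability.Probability" "HOL-Real_Asymp.Real_Asymp"
begin

text \<open>
  Since \<^term>\<open>chirp (- \<alpha>)\<close> is the complex conjugate of the unimodular function \<^term>\<open>chirp \<alpha>\<close>, the
  fractional transforms are the classical Riesz transforms \<open>R\<^sub>j\<close> conjugated by a unitary
  multiplication, and the claim amounts to \<open>\<Sum>\<^sub>j R\<^sub>j\<^sup>2 = - I\<close>. Two facts give it: the isometry
  \<open>\<Sum>\<^sub>j \<parallel>R\<^sub>j f\<parallel>\<^sup>2 = \<parallel>f\<parallel>\<^sup>2\<close> (\<open>riesz_isometry\<close>) and the antisymmetry \<open>\<langle>R\<^sub>j f, g\<rangle> = - \<langle>f, R\<^sub>j g\<rangle>\<close>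
  (\<open>riesz_antisym\<close>), which holds because the kernel is odd. Polarizing the former,
  \<open>\<Sum>\<^sub>j \<langle>R\<^sub>j\<^sup>2 f, g\<rangle> = - \<Sum>\<^sub>j \<langle>R\<^sub>j f, R\<^sub>j g\<rangle> = - \<langle>f, g\<rangle>\<close>.

  The isometry is proved without the Fourier transform. Let \<open>G\<^sub>t\<close> be the Gaussian density with
  covariance \<open>t I\<close>. The Riesz kernel is a superposition of gradients of Gaussians (\<open>subordination\<close>):
  \<open>c\<^sub>n w\<^sub>j / |w|\<^sup>n\<^sup>+\<^sup>1 = \<integral>\<^sub>0\<^sup>\<infinity> (2 \<pi> t)\<^sup>-\<^sup>1\<^sup>/\<^sup>2 (w\<^sub>j / t) G\<^sub>t(w) dt\<close>. Restricting the time \<open>t\<close> to a set \<open>S\<close> that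
  stays away from \<open>0\<close> and \<open>\<infinity>\<close> gives an operator \<open>R\<^sub>j\<^sup>S\<close> with a bounded and integrable kernel.
  The semigroup law for Gaussians (\<open>heat_grad_convolution\<close>) turns the energy into
  \<open>\<Sum>\<^sub>j \<parallel>R\<^sub>j\<^sup>S f\<parallel>\<^sup>2 = (2 \<pi>)\<^sup>-\<^sup>1 \<integral>\<^sub>S \<integral>\<^sub>S (s t)\<^sup>-\<^sup>1\<^sup>/\<^sup>2 \<phi>(s + t) ds dt\<close>, where
  \<open>\<phi>(u) = - 2 d/du \<langle>G\<^sub>u * f, f\<rangle>\<close> is nonnegative (\<open>trunc_riesz_energy\<close>, \<open>dissipation_nonneg\<close>). As
  \<open>\<integral>\<^sub>0\<^sup>u (s (u - s))\<^sup>-\<^sup>1\<^sup>/\<^sup>2 ds = \<pi>\<close> for every \<open>u\<close>, the integral over all positive \<open>s\<close> and \<open>t\<close> equals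
  \<open>\<onehalf> \<integral>\<^sub>0\<^sup>\<infinity> \<phi> = \<parallel>f\<parallel>\<^sup>2\<close> (\<open>total_energy\<close>). The energy density is nonnegative with finite integral, so
  the energy of the discarded times tends to \<open>0\<close>; hence the truncations converge in \<open>L\<^sup>2\<close>, and
  their limit is the principal value because they also converge pointwise (\<open>trunc_riesz_tendsto\<close>,
  \<open>riesz_principal_value\<close>).

  All of this takes place on bounded integrable Lipschitz functions (locale \<open>lipschitz_L1\<close>), a class
  that contains the product of a chirp and a Schwartz function. The operator
  \<^const>\<open>frac_riesz\<close> is defined by a description, so its existence and uniqueness have to be shown:
  existence needs that \<open>L\<^sup>2\<close> is complete, uniqueness that Schwartz functions are dense in it
  (\<open>schwartz_dense\<close>, \<open>frac_riesz_schwartz\<close>).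
\<close>

section \<open>Lebesgue measure under translations and reflections\<close>

lemma integrable_dominated:
  fixes f :: "'a \<Rightarrow> 'b::{banach, second_countable_topology}"
  assumes "integrable M g" "f \<in> borel_measurable M" "\<And>x. norm (f x) \<le> g x"
  shows "integrable M f"
  by (rule Bochner_Integration.integrable_bound[OF assms(1,2)])
    (use order_trans[OF assms(3) abs_ge_self] in auto)

abbreviation lborel2 :: "('a::euclidean_space \<times> 'b::euclidean_space) measure" where
  "lborel2 \<equiv> lborel \<Otimes>\<^sub>M lborel"

lemma distr_lborel_reflect:
  "distr lborel borel (\<lambda>y. x - y) = (lborel :: 'a::euclidean_space measure)"
  using lborel_affine[of "-1" x] by (simp add: density_1 one_ennreal_def[symmetric])

lemma nn_integral_lborel_shift:
  fixes f :: "'a::euclidean_space \<Rightarrow> ennreal"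
  assumes [measurable]: "f \<in> borel_measurable borel"
  shows "(\<integral>\<^sup>+y. f (y - x) \<partial>lborel) = (\<integral>\<^sup>+y. f y \<partial>lborel)"
proof -
  have "(\<integral>\<^sup>+y. f y \<partial>lborel) = (\<integral>\<^sup>+y. f y \<partial>distr lborel borel ((+) (- x)))"
    by (simp add: lborel_distr_plus)
  also have "\<dots> = (\<integral>\<^sup>+y. f (y - x) \<partial>lborel)"
    by (subst nn_integral_distr) simp_all
  finally show ?thesis ..
qed

lemma integral_lborel_reflect:
  fixes f :: "'a::euclidean_space \<Rightarrow> 'b::{banach, second_countable_topology}"
  assumes [measurable]: "f \<in> borel_measurable borel"
  shows "(LBINT y. f (x - y)) = (LBINT y. f y)"
proof -
  have "(LBINT y. f y) = (\<integral>y. f y \<partial>distr lborel borel (\<lambda>y. x - y))"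
    by (simp add: distr_lborel_reflect)
  also have "\<dots> = (LBINT y. f (x - y))"
    by (rule integral_distr) simp_all
  finally show ?thesis ..
qed

lemma integrable_lborel_reflect:
  fixes f :: "'a::euclidean_space \<Rightarrow> 'b::{banach, second_countable_topology}"
  assumes "integrable lborel f"
  shows "integrable lborel (\<lambda>y. f (x - y))"
proof -
  have [measurable]: "f \<in> borel_measurable borel"
    using assms by auto
  have "integrable (distr lborel borel (\<lambda>y. x - y)) f"
    using assms by (simp add: distr_lborel_reflect)
  then show ?thesis
    by (subst (asm) integrable_distr_eq) simp_all
qed

lemma has_bochner_integral_lborel_shift:
  fixes f :: "'a::euclidean_space \<Rightarrow> 'b::{banach, second_countable_topology}"
  assumes "has_bochner_integral lborel f I"
  shows "has_bochner_integral lborel (\<lambda>y. f (y - x)) I"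
proof -
  have [measurable]: "f \<in> borel_measurable borel"
    using assms by (auto simp: has_bochner_integral_iff)
  have "has_bochner_integral (distr lborel borel ((+) (- x))) f I"
    using assms by (simp add: lborel_distr_plus)
  then show ?thesis
    by (auto simp: has_bochner_integral_iff integrable_distr_eq integral_distr)
qed

section \<open>The heat kernel\<close>

text \<open>
  The transition density of Brownian motion: the Gaussian density with covariance \<open>t I\<close>, which
  solves \<open>2 \<partial>\<^sub>t G = \<Delta> G\<close>.
\<close>

definition heat :: "real \<Rightarrow> 'a::euclidean_space \<Rightarrow> real" where
  "heat t w = exp (- (norm w)\<^sup>2 / (2 * t)) / sqrt (2 * pi * t) ^ DIM('a)"

lemma heat_measurable [measurable (raw)]:
  assumes [measurable]: "f \<in> borel_measurable M" "g \<in> borel_measurable M"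
  shows "(\<lambda>x. heat (f x) (g x)) \<in> borel_measurable M"
  unfolding heat_def by measurable

lemma heat_nonneg: "t > 0 \<Longrightarrow> 0 \<le> heat t w"
  by (simp add: heat_def)

lemma heat_uminus [simp]: "heat t (- w) = heat t w"
  by (simp add: heat_def)

lemma heat_eq_prod_normal:
  fixes w :: "'a::euclidean_space"
  assumes "t > 0"
  shows "heat t w = (\<Prod>b\<in>Basis. normal_density 0 (sqrt t) (w \<bullet> b))"
proof -
  have "(norm w)\<^sup>2 = (\<Sum>b\<in>Basis. (w \<bullet> b)\<^sup>2)"
    by (simp add: norm_eq_sqrt_inner euclidean_inner[of w w] power2_eq_square sum_nonneg)
  then have "exp (- (norm w)\<^sup>2 / (2 * t)) = (\<Prod>b\<in>Basis. exp (- (w \<bullet> b)\<^sup>2 / (2 * t)))"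
    by (simp add: exp_sum[symmetric] sum_negf sum_divide_distrib)
  moreover have "(\<Prod>b\<in>Basis. normal_density 0 (sqrt t) (w \<bullet> b))
      = (\<Prod>b\<in>(Basis::'a set). 1 / sqrt (2 * pi * t)) * (\<Prod>b\<in>Basis. exp (- (w \<bullet> b)\<^sup>2 / (2 * t)))"
    unfolding prod.distrib[symmetric] using assms by (intro prod.cong) (simp_all add: normal_density_def)
  ultimately show ?thesis
    by (simp add: heat_def power_one_over)
qed

lemma nn_integral_heat_moment:
  fixes b :: "'a::euclidean_space"
  assumes t: "t > 0" and b: "b \<in> Basis"
  shows "(\<integral>\<^sup>+w. ennreal ((w \<bullet> b) ^ (2 * k) * heat t w) \<partial>lborel)
       = ennreal (fact (2 * k) / ((2 / t) ^ k * fact k))"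
proof -
  let ?N = "normal_density 0 (sqrt t)"
  define f where "f = (\<lambda>c x. (if c = b then x ^ (2 * k) else 1) * ?N x)"
  have "(\<integral>\<^sup>+w. ennreal ((w \<bullet> b) ^ (2 * k) * heat t w) \<partial>lborel)
      = (\<integral>\<^sup>+(w::'a). (\<Prod>c\<in>Basis. ennreal (f c (w \<bullet> c))) \<partial>lborel)"
  proof (rule nn_integral_cong)
    fix w :: 'a
    have "(\<Prod>c\<in>Basis. f c (w \<bullet> c)) = (\<Prod>c\<in>Basis. (if c = b then (w \<bullet> c) ^ (2 * k) else 1)) * heat t w"
      using t by (simp add: f_def prod.distrib heat_eq_prod_normal)
    also have "(\<Prod>c\<in>Basis. (if c = b then (w \<bullet> c) ^ (2 * k) else 1)) = (w \<bullet> b) ^ (2 * k)"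
      using b by (simp add: prod.delta)
    finally show "ennreal ((w \<bullet> b) ^ (2 * k) * heat t w) = (\<Prod>c\<in>Basis. ennreal (f c (w \<bullet> c)))"
      by (subst prod_ennreal) (auto simp: f_def)
  qed
  also have "\<dots> = (\<Prod>c\<in>Basis. (\<integral>\<^sup>+x. ennreal (f c x) \<partial>lborel))"
    by (rule nn_integral_lborel_prod) (auto simp: f_def)
  also have "\<dots> = (\<Prod>c\<in>Basis. if c = b then ennreal (fact (2 * k) / ((2 / t) ^ k * fact k)) else 1)"
  proof (rule prod.cong[OF refl])
    fix c :: 'a
    have 1: "has_bochner_integral lborel (\<lambda>x. ?N x * (x - 0) ^ (2 * j)) (fact (2 * j) / ((2 / t) ^ j * fact j))" for j
      using normal_moment_even[of "sqrt t" 0 j] t by simp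
    have 0: "0 \<le> ?N x * (x - 0) ^ (2 * j)" for j x
      by (intro mult_nonneg_nonneg zero_le_even_power') simp
    have 2: "(\<integral>\<^sup>+x. ennreal (x ^ (2 * j) * ?N x) \<partial>lborel) = ennreal (fact (2 * j) / ((2 / t) ^ j * fact j))" for j
    proof -
      have "(\<integral>\<^sup>+x. ennreal (?N x * (x - 0) ^ (2 * j)) \<partial>lborel) = ennreal (LBINT x. ?N x * (x - 0) ^ (2 * j))"
        using 1[of j] 0 by (intro nn_integral_eq_integral AE_I2) (simp_all only: has_bochner_integral_iff)
      then show ?thesis
        using 1[of j] by (simp add: has_bochner_integral_iff mult.commute)
    qed
    show "(\<integral>\<^sup>+x. ennreal (f c x) \<partial>lborel) = (if c = b then ennreal (fact (2 * k) / ((2 / t) ^ k * fact k)) else 1)"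
      using 2[of k] 2[of 0] by (simp add: f_def)
  qed
  also have "\<dots> = ennreal (fact (2 * k) / ((2 / t) ^ k * fact k))"
    using b by (simp add: prod.delta)
  finally show ?thesis .
qed

lemma heat_mass:
  assumes t: "t > 0"
  shows "has_bochner_integral lborel (heat t :: 'a::euclidean_space \<Rightarrow> real) 1"
proof (rule has_bochner_integral_nn_integral)
  obtain b :: 'a where "b \<in> Basis" using nonempty_Basis by blast
  from nn_integral_heat_moment[OF t this, of 0]
  show "(\<integral>\<^sup>+(w::'a). ennreal (heat t w) \<partial>lborel) = ennreal 1" by simp
qed (use t in \<open>auto simp: heat_nonneg\<close>)

lemma heat_second_moment:
  fixes b :: "'a::euclidean_space"
  assumes t: "t > 0" and b: "b \<in> Basis"
  shows "has_bochner_integral lborel (\<lambda>w. (w \<bullet> b)\<^sup>2 * heat t w) t"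
proof (rule has_bochner_integral_nn_integral)
  show "(\<integral>\<^sup>+(w::'a). ennreal ((w \<bullet> b)\<^sup>2 * heat t w) \<partial>lborel) = ennreal t"
    using nn_integral_heat_moment[OF t b, of 1] t by (simp add: fact_2)
qed (use t in \<open>auto simp: heat_nonneg\<close>)

lemma heat_norm_moment:
  assumes t: "t > 0"
  shows "has_bochner_integral lborel (\<lambda>w::'a::euclidean_space. (norm w)\<^sup>2 * heat t w) (real DIM('a) * t)"
proof -
  have "has_bochner_integral lborel (\<lambda>w::'a. \<Sum>b\<in>Basis. (w \<bullet> b)\<^sup>2 * heat t w) (\<Sum>b\<in>(Basis::'a set). t)"
    using heat_second_moment[OF t] by (intro has_bochner_integral_sum) auto
  moreover have "(norm w)\<^sup>2 = (\<Sum>b\<in>Basis. (w \<bullet> b)\<^sup>2)" for w :: 'a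
    by (simp add: norm_eq_sqrt_inner euclidean_inner[of w w] power2_eq_square sum_nonneg)
  ultimately show ?thesis
    by (simp add: sum_distrib_right)
qed

lemma abs_le_one_plus_square: "\<bar>x\<bar> \<le> 1 + x\<^sup>2" for x :: real
  using sum_squares_bound[of 1 "\<bar>x\<bar>"] by simp

lemma heat_abs_first_moment:
  fixes b :: "'a::euclidean_space"
  assumes t: "t > 0" and b: "b \<in> Basis"
  shows "integrable lborel (\<lambda>w. (w \<bullet> b) * heat t w)"
    and "(LBINT w. \<bar>(w \<bullet> b) * heat t w\<bar>) \<le> 1 + t"
proof -
  have 1: "has_bochner_integral lborel (\<lambda>w. heat t w + (w \<bullet> b)\<^sup>2 * heat t w) (1 + t)"
    by (intro has_bochner_integral_add heat_mass heat_second_moment assms)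
  have 2: "\<bar>(w \<bullet> b) * heat t w\<bar> \<le> heat t w + (w \<bullet> b)\<^sup>2 * heat t w" for w
    using mult_right_mono[OF abs_le_one_plus_square[of "w \<bullet> b"] heat_nonneg[OF t, of w]] t
    by (simp add: abs_mult heat_nonneg algebra_simps)
  show 3: "integrable lborel (\<lambda>w. (w \<bullet> b) * heat t w)"
    by (rule integrable_dominated[of _ "\<lambda>w. heat t w + (w \<bullet> b)\<^sup>2 * heat t w"])
      (use 1 2 in \<open>auto simp: has_bochner_integral_iff\<close>)
  have "(LBINT w. \<bar>(w \<bullet> b) * heat t w\<bar>) \<le> (LBINT w. heat t w + (w \<bullet> b)\<^sup>2 * heat t w)"
    using 1 2 3 by (intro integral_mono) (auto simp: has_bochner_integral_iff)
  also have "\<dots> = 1 + t" using 1 by (simp add: has_bochner_integral_iff)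
  finally show "(LBINT w. \<bar>(w \<bullet> b) * heat t w\<bar>) \<le> 1 + t" .
qed

lemma integral_odd_eq_0:
  fixes f :: "'a::euclidean_space \<Rightarrow> real"
  assumes [measurable]: "f \<in> borel_measurable borel" and odd: "\<And>w. f (- w) = - f w"
  shows "(LBINT w. f w) = 0"
  using integral_lborel_reflect[of f 0] odd by simp

lemma heat_first_moment:
  fixes v :: "'a::euclidean_space"
  assumes t: "t > 0"
  shows "has_bochner_integral lborel (\<lambda>w. (w \<bullet> v) * heat t w) 0"
proof -
  have b: "has_bochner_integral lborel (\<lambda>w. (w \<bullet> b) * heat t w) 0" if "b \<in> Basis" for b :: 'a
    using heat_abs_first_moment(1)[OF t that]
    by (auto simp: has_bochner_integral_iff intro!: integral_odd_eq_0)
  have "has_bochner_integral lborel (\<lambda>w. \<Sum>b\<in>Basis. (v \<bullet> b) * ((w \<bullet> b) * heat t w)) (\<Sum>b\<in>(Basis::'a set). (v \<bullet> b) * 0)"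
    by (intro has_bochner_integral_sum has_bochner_integral_mult_right b)
  moreover have "w \<bullet> v = (\<Sum>b\<in>Basis. (v \<bullet> b) * (w \<bullet> b))" for w
    by (simp add: euclidean_inner[of w v] mult.commute)
  ultimately show ?thesis
    by (simp add: sum_distrib_right mult.assoc)
qed

text \<open>
  Completing the square: the product of two Gaussians centred at \<open>y\<close> and \<open>z\<close> is a Gaussian centred at
  the barycentre of \<open>y\<close> and \<open>z\<close>, times a factor that depends on \<open>y - z\<close> only. Integrating in \<open>x\<close>
  would give the semigroup law.
\<close>

lemma heat_mult:
  fixes x y z :: "'a::euclidean_space"
  assumes s: "s > 0" and t: "t > 0"
  shows "heat s (x - y) * heat t (x - z)
    = heat (s + t) (y - z) * heat (s * t / (s + t)) (x - (t / (s + t)) *\<^sub>R y - (s / (s + t)) *\<^sub>R z)"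
proof -
  define p q where "p = t / (s + t)" and "q = s / (s + t)"
  have pq: "p + q = 1" and st: "s + t > 0" and st0: "s + t \<noteq> 0"
    using s t by (simp_all add: p_def q_def add_divide_distrib[symmetric] add.commute)
  define u v where "u = x - y" and "v = x - z"
  have q: "q = 1 - p" using pq by simp
  have yz: "y - z = v - u" and m: "x - p *\<^sub>R y - q *\<^sub>R z = p *\<^sub>R u + q *\<^sub>R v"
    unfolding u_def v_def q by (simp_all add: algebra_simps)
  have nm: "(norm (p *\<^sub>R u + q *\<^sub>R v))\<^sup>2 = p\<^sup>2 * (u \<bullet> u) + 2 * p * q * (u \<bullet> v) + q\<^sup>2 * (v \<bullet> v)"
    unfolding power2_norm_eq_inner
    by (simp add: inner_add_left inner_add_right inner_commute[of v u] power2_eq_square algebra_simps)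
  have nd: "(norm (v - u))\<^sup>2 = (u \<bullet> u) - 2 * (u \<bullet> v) + (v \<bullet> v)"
    by (simp add: power2_norm_eq_inner inner_diff_left inner_diff_right inner_commute algebra_simps)
  define c r where "c = s + t" and "r = s * t / c"
  have c: "c > 0" and cs: "c - s = t" and ct: "c - t = s" and pq': "p = t / c" "q = s / c"
    using st by (simp_all add: c_def p_def q_def)
  have e: "(norm u)\<^sup>2 / (2 * s) + (norm v)\<^sup>2 / (2 * t)
      = (norm (v - u))\<^sup>2 / (2 * c) + (norm (p *\<^sub>R u + q *\<^sub>R v))\<^sup>2 / (2 * r)"
  proof -
    have "p\<^sup>2 / (2 * r) = (c - s) / (2 * s * c)" "q\<^sup>2 / (2 * r) = (c - t) / (2 * t * c)"
      "2 * p * q / (2 * r) = 2 / (2 * c)"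
      unfolding cs ct using s t c by (simp_all add: pq' r_def power2_eq_square)
    moreover have "(c - s) / (2 * s * c) = 1 / (2 * s) - 1 / (2 * c)" "(c - t) / (2 * t * c) = 1 / (2 * t) - 1 / (2 * c)"
      using s t c by (simp_all add: diff_divide_distrib)
    moreover have "(norm (p *\<^sub>R u + q *\<^sub>R v))\<^sup>2 / (2 * r)
       = p\<^sup>2 / (2 * r) * (u \<bullet> u) + 2 * p * q / (2 * r) * (u \<bullet> v) + q\<^sup>2 / (2 * r) * (v \<bullet> v)"
      unfolding nm by (simp add: add_divide_distrib)
    ultimately show ?thesis
      unfolding nd unfolding power2_norm_eq_inner
      by (simp add: add_divide_distrib diff_divide_distrib left_diff_distrib)
  qed
  have "2 * pi * s * (2 * pi * t) = 2 * pi * c * (2 * pi * r)"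
    using c by (simp add: r_def)
  then have d: "sqrt (2 * pi * s) * sqrt (2 * pi * t) = sqrt (2 * pi * c) * sqrt (2 * pi * r)"
    by (simp only: real_sqrt_mult[symmetric])
  have "heat s u * heat t v = exp (- ((norm u)\<^sup>2 / (2 * s) + (norm v)\<^sup>2 / (2 * t)))
      / (sqrt (2 * pi * s) * sqrt (2 * pi * t)) ^ DIM('a)"
    by (simp add: heat_def exp_add[symmetric] power_mult_distrib)
  also have "\<dots> = heat c (v - u) * heat r (p *\<^sub>R u + q *\<^sub>R v)"
    unfolding e d by (simp add: heat_def exp_add[symmetric] power_mult_distrib)
  finally have "heat s (x - y) * heat t (x - z) = heat c (y - z) * heat r (x - p *\<^sub>R y - q *\<^sub>R z)"
    unfolding yz m u_def v_def .
  then show ?thesis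
    by (simp add: c_def r_def p_def q_def)
qed

text \<open>
  This is \<open>- \<Delta> G\<^sub>u\<close>, which equals \<open>- 2 \<partial>\<^sub>u G\<^sub>u\<close>; the signs here and in \<open>heat_grad\<close>, which is
  \<open>- \<partial>\<^sub>b G\<^sub>t\<close>, are chosen to make the energies below nonnegative.
\<close>

definition heat_laplacian :: "real \<Rightarrow> 'a::euclidean_space \<Rightarrow> real" where
  "heat_laplacian u w = (real DIM('a) / u - (norm w)\<^sup>2 / u\<^sup>2) * heat u w"

definition heat_grad :: "'a::euclidean_space \<Rightarrow> real \<Rightarrow> 'a \<Rightarrow> real" where
  "heat_grad b t w = (w \<bullet> b) / t * heat t w"

text \<open>
  The identity \<open>\<Sum>\<^sub>b \<partial>\<^sub>b G\<^sub>s * \<partial>\<^sub>b G\<^sub>t = \<Delta> G\<^sub>s\<^sub>+\<^sub>t\<close>, with one sign changed by the reflection of one factor.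
  Writing \<open>x = m + w\<close> with the barycentre \<open>m\<close>, the integrand becomes a quadratic polynomial in \<open>w\<close>
  times \<open>G\<^sub>r(w)\<close>, \<open>r = s t / (s + t)\<close>, so that the first three moments of a Gaussian suffice.
\<close>

lemma heat_grad_convolution:
  fixes y z :: "'a::euclidean_space"
  assumes s: "s > 0" and t: "t > 0"
  shows "has_bochner_integral lborel
    (\<lambda>x. \<Sum>b\<in>Basis. heat_grad b s (x - y) * heat_grad b t (x - z)) (heat_laplacian (s + t) (y - z))"
proof -
  define p q r where "p = t / (s + t)" and "q = s / (s + t)" and "r = s * t / (s + t)"
  have pq: "p + q = 1" and st: "s + t > 0" and r: "r > 0"
    using s t by (simp_all add: p_def q_def r_def add_divide_distrib[symmetric] add.commute)
  have q: "q = 1 - p" using pq by simp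
  define m where "m = p *\<^sub>R y + q *\<^sub>R z"
  define d where "d = y - z"
  define H where "H = (\<lambda>w. (norm w)\<^sup>2 * heat r w + ((w \<bullet> ((p - q) *\<^sub>R d)) * heat r w - (p * q * (norm d)\<^sup>2) * heat r w))"
  have "has_bochner_integral lborel H (real DIM('a) * r + (0 - p * q * (norm d)\<^sup>2 * 1))"
    unfolding H_def
    by (intro has_bochner_integral_add has_bochner_integral_diff has_bochner_integral_mult_right
        heat_norm_moment heat_mass heat_first_moment r)
  then have "has_bochner_integral lborel (\<lambda>x. heat (s + t) d / (s * t) * H (x - m))
      (heat (s + t) d / (s * t) * (real DIM('a) * r + (0 - p * q * (norm d)\<^sup>2 * 1)))"
    by (intro has_bochner_integral_mult_right has_bochner_integral_lborel_shift)
  moreover have "heat (s + t) d / (s * t) * (real DIM('a) * r + (0 - p * q * (norm d)\<^sup>2 * 1)) = heat_laplacian (s + t) (y - z)"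
    proof -
    have "r / (s * t) = 1 / (s + t)" "p * q / (s * t) = 1 / (s + t)\<^sup>2"
      using s t by (simp_all add: r_def p_def q_def power2_eq_square)
    moreover have "heat (s + t) d / (s * t) * (real DIM('a) * r + (0 - p * q * (norm d)\<^sup>2 * 1))
        = (real DIM('a) * (r / (s * t)) - (p * q / (s * t)) * (norm d)\<^sup>2) * heat (s + t) d"
      by (simp add: algebra_simps diff_divide_distrib)
    ultimately show ?thesis
      by (simp add: heat_laplacian_def d_def)
  qed
  moreover have "heat (s + t) d / (s * t) * H (x - m)
     = (\<Sum>b\<in>Basis. heat_grad b s (x - y) * heat_grad b t (x - z))" for x
  proof -
    have "(\<Sum>b\<in>Basis. heat_grad b s (x - y) * heat_grad b t (x - z))
        = ((x - y) \<bullet> (x - z)) / (s * t) * (heat s (x - y) * heat t (x - z))"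
      unfolding euclidean_inner[of "x - y" "x - z"] sum_distrib_right sum_divide_distrib
      by (rule sum.cong) (simp_all add: heat_grad_def)
    also have "heat s (x - y) * heat t (x - z) = heat (s + t) d * heat r (x - m)"
      using heat_mult[OF s t, of x y z] by (simp add: d_def r_def m_def p_def q_def diff_diff_eq)
    also have "(x - y) \<bullet> (x - z) = (norm (x - m))\<^sup>2 + (x - m) \<bullet> ((p - q) *\<^sub>R d) - p * q * (norm d)\<^sup>2"
    proof -
      have "(w - q *\<^sub>R d) \<bullet> (w + p *\<^sub>R d) = (norm w)\<^sup>2 + w \<bullet> ((p - q) *\<^sub>R d) - p * q * (norm d)\<^sup>2" for w
        unfolding power2_norm_eq_inner
        by (simp add: inner_add_left inner_add_right inner_diff_left inner_diff_right
            inner_commute[of d w] left_diff_distrib algebra_simps)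
      moreover have "x - y = (x - m) - q *\<^sub>R d" "x - z = (x - m) + p *\<^sub>R d"
        unfolding m_def d_def q by (simp_all add: algebra_simps)
      ultimately show ?thesis by metis
    qed
    finally show ?thesis
      by (simp only: H_def) (simp add: left_diff_distrib distrib_right right_diff_distrib distrib_left add_divide_distrib diff_divide_distrib mult_ac)
  qed
  ultimately show ?thesis by simp
qed

section \<open>A bilinear form of Fubini's theorem\<close>

lemma integrable_pair_mult:
  fixes f :: "'p \<Rightarrow> real" and g :: "'q \<Rightarrow> real"
  assumes "sigma_finite_measure M1" "sigma_finite_measure M2"
    and f: "integrable M1 f" and g: "integrable M2 g"
  shows "integrable (M1 \<Otimes>\<^sub>M M2) (\<lambda>(p, q). f p * g q)"
proof -
  interpret sigma_finite_measure M1 by fact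
  interpret M2: sigma_finite_measure M2 by fact
  interpret pair_sigma_finite M1 M2 ..
  have [measurable]: "f \<in> borel_measurable M1" "g \<in> borel_measurable M2"
    using f g by auto
  show ?thesis
    by (rule Fubini_integrable) (use f g in \<open>auto simp: abs_mult split_beta\<close>)
qed

lemma integrable_pair_dominated:
  fixes F :: "'p \<Rightarrow> 'q \<Rightarrow> 'b::{banach, second_countable_topology}"
  assumes sf: "sigma_finite_measure M1" "sigma_finite_measure M2"
    and AB: "integrable M1 A" "integrable M2 B"
    and F: "case_prod F \<in> borel_measurable (M1 \<Otimes>\<^sub>M M2)" "\<And>p q. norm (F p q) \<le> A p * B q"
  shows "integrable (M1 \<Otimes>\<^sub>M M2) (\<lambda>(p, q). F p q)"
  by (rule integrable_dominated[OF integrable_pair_mult[OF sf AB] F(1)]) (use F(2) in auto)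

lemmas sigma_finite_lborel2 = lborel.sigma_finite_measure_axioms lborel.sigma_finite_measure_axioms

text \<open>
  Expanding the inner product of two integrals that depend on a parameter \<open>x\<close> into a double integral,
  and integrating in \<open>x\<close> first. The lemma is used twice: with points of space as parameters, to square a
  convolution, and with times as parameters, to square a superposition of heat flows. One factor is
  controlled by its supremum and the other one by its integral over \<open>x\<close>.
\<close>

lemma fubini_inner:
  fixes u :: "'p \<Rightarrow> 'x \<Rightarrow> complex" and v :: "'q \<Rightarrow> 'x \<Rightarrow> complex"
  assumes sf: "sigma_finite_measure M1" "sigma_finite_measure M2" "sigma_finite_measure N"
    and mu [measurable]: "case_prod u \<in> borel_measurable (M1 \<Otimes>\<^sub>M N)"
    and mv [measurable]: "case_prod v \<in> borel_measurable (M2 \<Otimes>\<^sub>M N)"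
    and A: "\<And>p x. cmod (u p x) \<le> A p" "integrable M1 A"
    and A': "\<And>q x. cmod (v q x) \<le> A' q" "integrable M2 A'"
    and B: "\<And>q. integrable N (v q)" "\<And>q. (\<integral>x. cmod (v q x) \<partial>N) \<le> B q" "integrable M2 B"
  shows "integrable N (\<lambda>x. (\<integral>p. u p x \<partial>M1) \<bullet> (\<integral>q. v q x \<partial>M2))"
    and "(\<integral>x. (\<integral>p. u p x \<partial>M1) \<bullet> (\<integral>q. v q x \<partial>M2) \<partial>N)
       = (\<integral>r. (\<integral>x. u (fst r) x \<bullet> v (snd r) x \<partial>N) \<partial>(M1 \<Otimes>\<^sub>M M2))"
    and "integrable (M1 \<Otimes>\<^sub>M M2) (\<lambda>r. \<integral>x. u (fst r) x \<bullet> v (snd r) x \<partial>N)"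
proof -
  interpret M1: sigma_finite_measure M1 by fact
  interpret M2: sigma_finite_measure M2 by fact
  interpret N: sigma_finite_measure N by fact
  interpret P: pair_sigma_finite M1 M2 ..
  interpret Q: pair_sigma_finite "M1 \<Otimes>\<^sub>M M2" N ..
  have [measurable]: "A \<in> borel_measurable M1" "A' \<in> borel_measurable M2" "B \<in> borel_measurable M2"
    using A A' B by auto
  define W where "W = (\<lambda>(r, x). u (fst r) x \<bullet> v (snd r) x)"
  have W_meas [measurable]: "W \<in> borel_measurable ((M1 \<Otimes>\<^sub>M M2) \<Otimes>\<^sub>M N)"
    unfolding W_def by measurable
  have A0: "0 \<le> A p" and A0': "0 \<le> A' q" for p q
    using A(1) A'(1) norm_ge_zero order_trans by blast+
  have W_le: "norm (W ((p, q), x)) \<le> A p * cmod (v q x)" for p q x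
  proof -
    have "norm (W ((p, q), x)) \<le> cmod (u p x) * cmod (v q x)"
      unfolding W_def using Cauchy_Schwarz_ineq2[of "u p x" "v q x"] by simp
    also have "\<dots> \<le> A p * cmod (v q x)" by (intro mult_right_mono A) simp
    finally show ?thesis .
  qed
  have int_x: "integrable N (\<lambda>x. W (r, x))" if "r \<in> space (M1 \<Otimes>\<^sub>M M2)" for r
  proof (rule integrable_dominated)
    show "integrable N (\<lambda>x. A (fst r) * cmod (v (snd r) x))" using B(1) by auto
    show "(\<lambda>x. W (r, x)) \<in> borel_measurable N" using that by measurable
  qed (use W_le[of "fst r" "snd r"] in simp)
  have W_int: "integrable ((M1 \<Otimes>\<^sub>M M2) \<Otimes>\<^sub>M N) W"
  proof (rule Q.Fubini_integrable[OF W_meas])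
    show "AE r in M1 \<Otimes>\<^sub>M M2. integrable N (\<lambda>x. W (r, x))"
      using int_x by auto
    show "integrable (M1 \<Otimes>\<^sub>M M2) (\<lambda>r. \<integral>x. norm (W (r, x)) \<partial>N)"
    proof (rule Bochner_Integration.integrable_bound)
      show "integrable (M1 \<Otimes>\<^sub>M M2) (\<lambda>(p, q). A p * B q)"
        by (rule integrable_pair_mult) fact+
      show "AE r in M1 \<Otimes>\<^sub>M M2. norm (\<integral>x. norm (W (r, x)) \<partial>N) \<le> norm (case r of (p, q) \<Rightarrow> A p * B q)"
      proof (rule AE_I2)
        fix r assume r: "r \<in> space (M1 \<Otimes>\<^sub>M M2)"
        obtain p q where pq: "r = (p, q)" by (cases r)
        have "(\<integral>x. norm (W (r, x)) \<partial>N) \<le> (\<integral>x. A p * cmod (v q x) \<partial>N)"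
          using int_x[OF r] B(1)[of q] W_le by (intro integral_mono) (auto simp: pq)
        also have "\<dots> = A p * (\<integral>x. cmod (v q x) \<partial>N)" by simp
        also have "\<dots> \<le> A p * B q" by (intro mult_left_mono B A0)
        finally show "norm (\<integral>x. norm (W (r, x)) \<partial>N) \<le> norm (case r of (p, q) \<Rightarrow> A p * B q)"
          by (simp add: pq)
      qed
    qed measurable
  qed
  have fiber: "(\<integral>r. W (r, x) \<partial>(M1 \<Otimes>\<^sub>M M2)) = (\<integral>p. u p x \<partial>M1) \<bullet> (\<integral>q. v q x \<partial>M2)"
    if x: "x \<in> space N" for x
  proof -
    have [measurable]: "(\<lambda>p. u p x) \<in> borel_measurable M1" "(\<lambda>q. v q x) \<in> borel_measurable M2"
      using x by measurable
    have u: "integrable M1 (\<lambda>p. u p x)" by (rule integrable_dominated[OF A(2)]) (auto simp: A)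
    have v: "integrable M2 (\<lambda>q. v q x)" by (rule integrable_dominated[OF A'(2)]) (auto simp: A')
    have "integrable (M1 \<Otimes>\<^sub>M M2) (\<lambda>(p, q). W ((p, q), x))"
    proof (rule integrable_pair_dominated[OF sf(1,2) A(2) A'(2)])
      show "(\<lambda>(p, q). W ((p, q), x)) \<in> borel_measurable (M1 \<Otimes>\<^sub>M M2)"
        using x by measurable
      show "norm (W ((p, q), x)) \<le> A p * A' q" for p q
        by (rule order_trans[OF W_le]) (intro mult_left_mono A' A0)
    qed
    then have "integrable (M1 \<Otimes>\<^sub>M M2) (\<lambda>r. W (r, x))"
      by (simp only: case_prod_beta' prod.collapse)
    then have "(\<integral>r. W (r, x) \<partial>(M1 \<Otimes>\<^sub>M M2)) = (\<integral>p. (\<integral>q. W ((p, q), x) \<partial>M2) \<partial>M1)"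
      by (rule P.integral_fst'[symmetric])
    also have "\<dots> = (\<integral>p. u p x \<partial>M1) \<bullet> (\<integral>q. v q x \<partial>M2)"
      using u v by (simp add: W_def)
    finally show ?thesis .
  qed
  have W_int': "integrable ((M1 \<Otimes>\<^sub>M M2) \<Otimes>\<^sub>M N) (\<lambda>(r, x). W (r, x))"
    using W_int by simp
  have "integrable N (\<lambda>x. \<integral>r. W (r, x) \<partial>(M1 \<Otimes>\<^sub>M M2))"
    by (rule Q.integrable_snd[OF W_int'])
  then show "integrable N (\<lambda>x. (\<integral>p. u p x \<partial>M1) \<bullet> (\<integral>q. v q x \<partial>M2))"
    by (subst (asm) Bochner_Integration.integrable_cong[OF refl fiber]) auto
  have "(\<integral>x. (\<integral>p. u p x \<partial>M1) \<bullet> (\<integral>q. v q x \<partial>M2) \<partial>N) = (\<integral>x. (\<integral>r. W (r, x) \<partial>(M1 \<Otimes>\<^sub>M M2)) \<partial>N)"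
    by (rule Bochner_Integration.integral_cong) (simp_all add: fiber)
  also have "\<dots> = (\<integral>r. (\<integral>x. W (r, x) \<partial>N) \<partial>(M1 \<Otimes>\<^sub>M M2))"
    by (rule Q.Fubini_integral[OF W_int'])
  finally show "(\<integral>x. (\<integral>p. u p x \<partial>M1) \<bullet> (\<integral>q. v q x \<partial>M2) \<partial>N)
       = (\<integral>r. (\<integral>x. u (fst r) x \<bullet> v (snd r) x \<partial>N) \<partial>(M1 \<Otimes>\<^sub>M M2))"
    by (simp add: W_def)
  show "integrable (M1 \<Otimes>\<^sub>M M2) (\<lambda>r. \<integral>x. u (fst r) x \<bullet> v (snd r) x \<partial>N)"
    using Q.integrable_fst'[OF W_int] by (simp add: W_def)
qed

section \<open>Convolutions\<close>

definition conv :: "('a::euclidean_space \<Rightarrow> real) \<Rightarrow> ('a \<Rightarrow> complex) \<Rightarrow> 'a \<Rightarrow> complex" where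
  "conv k f x = (LBINT y. k (x - y) *\<^sub>R f y)"

lemma conv_reflect:
  fixes k :: "'a::euclidean_space \<Rightarrow> real"
  assumes [measurable]: "k \<in> borel_measurable borel" "f \<in> borel_measurable borel"
  shows "conv k f x = (LBINT w. k w *\<^sub>R f (x - w))"
  using integral_lborel_reflect[of "\<lambda>w. k w *\<^sub>R f (x - w)" x] by (simp add: conv_def)

context
  fixes k :: "'a::euclidean_space \<Rightarrow> real" and f :: "'a \<Rightarrow> complex" and C :: real
  assumes k: "integrable lborel k" and k_bound: "\<And>w. \<bar>k w\<bar> \<le> C" and f: "integrable lborel f"
begin

lemma conv_bounded_meas: "k \<in> borel_measurable borel" "f \<in> borel_measurable borel"
  using k f by auto

lemma conv_integrand_bound: "cmod (k (x - y) *\<^sub>R f y) \<le> C * cmod (f y)"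
  by (simp add: mult_right_mono k_bound)

lemma conv_integrand_integrable: "integrable lborel (\<lambda>y. k (x - y) *\<^sub>R f y)"
  supply [measurable] = conv_bounded_meas
  by (rule integrable_dominated[of _ "\<lambda>y. C * cmod (f y)"]) (use f conv_integrand_bound in auto)

lemma conv_bound: "cmod (conv k f x) \<le> C * (LBINT y. cmod (f y))"
proof -
  have "cmod (conv k f x) \<le> (LBINT y. cmod (k (x - y) *\<^sub>R f y))"
    unfolding conv_def by (rule integral_norm_bound)
  also have "\<dots> \<le> (LBINT y. C * cmod (f y))"
    by (rule integral_mono[OF integrable_norm[OF conv_integrand_integrable] _ conv_integrand_bound]) (use f in simp)
  finally show ?thesis by simp
qed

lemma conv_kernel_integral: "(LBINT x. \<bar>k (x - y)\<bar>) = (LBINT w. \<bar>k w\<bar>)" "integrable lborel (\<lambda>x. k (x - y))"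
  using has_bochner_integral_lborel_shift[of "\<lambda>w. \<bar>k w\<bar>" _ y] has_bochner_integral_lborel_shift[of k _ y] k
  by (auto simp: has_bochner_integral_iff)

lemma conv_product_integrable:
  "integrable lborel2 (\<lambda>(y, x). k (x - y) *\<^sub>R f y)"
  supply [measurable] = conv_bounded_meas
proof (rule lborel_pair.Fubini_integrable)
  show "integrable lborel (\<lambda>y. \<integral>x. norm (case (y, x) of (y, x) \<Rightarrow> k (x - y) *\<^sub>R f y) \<partial>lborel)"
    using f by (simp add: conv_kernel_integral)
  show "AE y in lborel. integrable lborel (\<lambda>x. case (y, x) of (y, x) \<Rightarrow> k (x - y) *\<^sub>R f y)"
    using conv_kernel_integral(2) by (auto intro!: AE_I2)
qed measurable

lemma conv_integrable: "integrable lborel (conv k f)"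
  using lborel_pair.integrable_snd[OF conv_product_integrable] by (simp add: conv_def[abs_def])

lemma conv_L1_bound: "(LBINT x. cmod (conv k f x)) \<le> (LBINT w. \<bar>k w\<bar>) * (LBINT y. cmod (f y))"
proof -
  have *: "integrable lborel2 (\<lambda>(y, x). norm (k (x - y) *\<^sub>R f y))"
    using integrable_norm[OF conv_product_integrable] by (simp only: case_prod_beta' norm_scaleR)
  have "(LBINT x. cmod (conv k f x)) \<le> (LBINT x. (LBINT y. norm (k (x - y) *\<^sub>R f y)))"
    unfolding conv_def
    by (intro integral_mono integral_norm_bound lborel_pair.integrable_snd[OF *])
      (use conv_integrable in \<open>simp add: conv_def[abs_def]\<close>)
  also have "\<dots> = (LBINT y. (LBINT x. norm (k (x - y) *\<^sub>R f y)))"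
    by (rule lborel_pair.Fubini_integral[OF *])
  also have "\<dots> = (LBINT w. \<bar>k w\<bar>) * (LBINT y. cmod (f y))"
    by (simp add: conv_kernel_integral)
  finally show ?thesis .
qed

end

text \<open>
  The energy of a convolution depends on the kernels only through their correlation
  \<open>\<integral> k(x - y) l(x - z) dx\<close>, which for Gaussian gradients is known explicitly.
\<close>

lemma conv_inner:
  fixes k l :: "'a::euclidean_space \<Rightarrow> real"
  assumes k: "integrable lborel k" "\<And>w. \<bar>k w\<bar> \<le> C" and l: "integrable lborel l" "\<And>w. \<bar>l w\<bar> \<le> D"
    and f: "integrable lborel f"
  shows "integrable lborel (\<lambda>x. conv k f x \<bullet> conv l f x)" (is ?A)
    and "(LBINT x. conv k f x \<bullet> conv l f x)
      = (\<integral>r. (f (fst r) \<bullet> f (snd r)) * (LBINT x. k (x - fst r) * l (x - snd r)) \<partial>lborel2)" (is ?B)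
    and "integrable lborel2
      (\<lambda>r. (f (fst r) \<bullet> f (snd r)) * (LBINT x. k (x - fst r) * l (x - snd r)))" (is ?C)
proof -
  have [measurable]: "f \<in> borel_measurable borel" "k \<in> borel_measurable borel" "l \<in> borel_measurable borel"
    using f k l by auto
  let ?u = "\<lambda>y x. k (x - y) *\<^sub>R f y" and ?v = "\<lambda>z x. l (x - z) *\<^sub>R f z"
  have B: "(LBINT x. cmod (?v z x)) \<le> (LBINT w. \<bar>l w\<bar>) * cmod (f z)" for z
    using conv_kernel_integral[OF l f, of z] by simp
  have Bi: "integrable lborel (?v z)" for z
    using conv_kernel_integral[OF l f, of z] by simp
  note F = fubini_inner[where u="?u" and v="?v" and N=lborel, OF lborel.sigma_finite_measure_axioms
    lborel.sigma_finite_measure_axioms lborel.sigma_finite_measure_axioms _ _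
    conv_integrand_bound[OF k f] _ conv_integrand_bound[OF l f] _ Bi B]
  have eq: "(LBINT x. ?u (fst r) x \<bullet> ?v (snd r) x)
      = (f (fst r) \<bullet> f (snd r)) * (LBINT x. k (x - fst r) * l (x - snd r))" for r
    by (simp add: integral_mult_right_zero[symmetric] mult_ac del: integral_mult_right_zero)
  show ?A using F(1) f by (simp add: conv_def split_beta)
  show ?B using F(2) f unfolding eq by (simp add: conv_def split_beta)
  show ?C using F(3) f unfolding eq by (simp add: conv_def split_beta)
qed

section \<open>Bounds on the heat kernel away from time zero\<close>

text \<open>
  The value of the heat kernel at the origin, which is its maximum.
\<close>

definition heat_peak :: "'a::euclidean_space itself \<Rightarrow> real \<Rightarrow> real" where
  "heat_peak _ a = 1 / sqrt (2 * pi * a) ^ DIM('a)"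

lemma heat_peak_pos: "a > 0 \<Longrightarrow> heat_peak TYPE('a::euclidean_space) a > 0"
  by (simp add: heat_peak_def)

lemma heat_peak_antimono: "0 < a \<Longrightarrow> a \<le> t \<Longrightarrow> heat_peak TYPE('a::euclidean_space) t \<le> heat_peak TYPE('a) a"
  unfolding heat_peak_def by (intro divide_left_mono power_mono mult_pos_pos zero_less_power) auto

lemma heat_eq_peak: "heat t (w::'a::euclidean_space) = exp (- (norm w)\<^sup>2 / (2 * t)) * heat_peak TYPE('a) t"
  by (simp add: heat_def heat_peak_def)

lemma heat_le_peak:
  fixes w :: "'a::euclidean_space"
  assumes "0 < a" "a \<le> t"
  shows "heat t w \<le> heat_peak TYPE('a) a"
proof -
  have "heat t w \<le> 1 * heat_peak TYPE('a) t"
    unfolding heat_eq_peak using assms heat_peak_pos[of t, where 'a='a] by (intro mult_right_mono) auto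
  with heat_peak_antimono[OF assms, where 'a='a] show ?thesis by simp
qed

lemma heat_square_bound:
  fixes w :: "'a::euclidean_space"
  assumes "0 < a" "a \<le> t"
  shows "(norm w)\<^sup>2 * heat t w \<le> 2 * t * heat_peak TYPE('a) a"
proof -
  have t: "t > 0" using assms by simp
  define v where "v = (norm w)\<^sup>2 / (2 * t)"
  \<comment> \<open>The factor \<open>|w|\<^sup>2\<close> costs only \<open>2 t\<close>, because \<open>v e\<^sup>-\<^sup>v \<le> 1\<close>.\<close>
  have "v * exp (- v) \<le> 1"
    using order_trans[OF _ exp_ge_add_one_self[of v], of v] by (simp add: exp_minus field_simps)
  moreover have "(norm w)\<^sup>2 * heat t w = 2 * t * (v * exp (- v)) * heat_peak TYPE('a) t"
    using t by (simp add: heat_eq_peak v_def)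
  ultimately have "(norm w)\<^sup>2 * heat t w \<le> 2 * t * 1 * heat_peak TYPE('a) t"
    using t heat_peak_pos[OF t, where 'a='a] by (simp only:) (intro mult_right_mono mult_left_mono, auto)
  also have "\<dots> \<le> 2 * t * heat_peak TYPE('a) a"
    using heat_peak_antimono[OF assms, where 'a='a] t by simp
  finally show ?thesis .
qed

definition grad_peak :: "'a::euclidean_space itself \<Rightarrow> real \<Rightarrow> real" where
  "grad_peak _ a = (1 / a + 2) * heat_peak TYPE('a) a"

lemma heat_grad_measurable [measurable (raw)]:
  assumes [measurable]: "f \<in> borel_measurable M" "g \<in> borel_measurable M"
  shows "(\<lambda>x. heat_grad b (f x) (g x)) \<in> borel_measurable M"
  unfolding heat_grad_def by measurable

lemma heat_laplacian_measurable [measurable (raw)]: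
  assumes [measurable]: "f \<in> borel_measurable M" "g \<in> borel_measurable M"
  shows "(\<lambda>x. heat_laplacian (f x) (g x)) \<in> borel_measurable M"
  unfolding heat_laplacian_def by measurable

lemma heat_grad_bound:
  fixes b w :: "'a::euclidean_space"
  assumes b: "b \<in> Basis" and a: "0 < a" "a \<le> t"
  shows "\<bar>heat_grad b t w\<bar> \<le> grad_peak TYPE('a) a"
proof -
  have t: "t > 0" using a by simp
  have "\<bar>w \<bullet> b\<bar> \<le> norm w" using b by (rule Basis_le_norm)
  also have "\<dots> \<le> 1 + (norm w)\<^sup>2" using abs_le_one_plus_square[of "norm w"] by simp
  finally have "\<bar>heat_grad b t w\<bar> \<le> (1 + (norm w)\<^sup>2) / t * heat t w"
    unfolding heat_grad_def abs_mult abs_divide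
    using t heat_nonneg[OF t, of w] by (simp add: divide_right_mono mult_right_mono)
  also have "\<dots> = (heat t w + (norm w)\<^sup>2 * heat t w) / t" by (simp add: distrib_right)
  also have "\<dots> \<le> (heat_peak TYPE('a) a + 2 * t * heat_peak TYPE('a) a) / t"
    using t by (intro divide_right_mono add_mono heat_le_peak heat_square_bound a) auto
  also have "\<dots> = (1 / t + 2) * heat_peak TYPE('a) a"
    using t by (simp add: field_simps)
  also have "\<dots> \<le> grad_peak TYPE('a) a"
    unfolding grad_peak_def using a heat_peak_pos[of a, where 'a='a]
    by (intro mult_right_mono add_right_mono divide_left_mono) auto
  finally show ?thesis .
qed

lemma heat_grad_L1:
  fixes b :: "'a::euclidean_space"
  assumes b: "b \<in> Basis" and t: "t > 0"
  shows "integrable lborel (heat_grad b t)" "(LBINT w. \<bar>heat_grad b t w\<bar>) \<le> (1 + t) / t"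
proof -
  have eq: "heat_grad b t = (\<lambda>w. ((w \<bullet> b) * heat t w) / t)"
    by (auto simp: heat_grad_def)
  show "integrable lborel (heat_grad b t)"
    unfolding eq using heat_abs_first_moment(1)[OF t b] by simp
  have "(LBINT w. \<bar>heat_grad b t w\<bar>) = (LBINT w. \<bar>(w \<bullet> b) * heat t w\<bar>) / t"
    unfolding eq using t by (simp add: abs_divide)
  then show "(LBINT w. \<bar>heat_grad b t w\<bar>) \<le> (1 + t) / t"
    using heat_abs_first_moment(2)[OF t b] t by (simp add: divide_right_mono)
qed

lemma heat_laplacian_bound:
  fixes w :: "'a::euclidean_space"
  assumes a: "0 < a" "a \<le> t"
  shows "\<bar>heat_laplacian t w\<bar> \<le> (real DIM('a) + 2) / a * heat_peak TYPE('a) a"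
proof -
  have t: "t > 0" using a by simp
  note hp = heat_peak_pos[OF a(1), where 'a='a]
  have "\<bar>heat_laplacian t w\<bar> \<le> real DIM('a) / t * heat t w + ((norm w)\<^sup>2 * heat t w) / t\<^sup>2"
    unfolding heat_laplacian_def left_diff_distrib
    using t heat_nonneg[OF t, of w] by (intro order_trans[OF abs_triangle_ineq4]) (simp add: abs_mult)
  also have "\<dots> \<le> real DIM('a) / t * heat_peak TYPE('a) a + 2 * t * heat_peak TYPE('a) a / t\<^sup>2"
    using t by (intro divide_right_mono add_mono mult_left_mono heat_le_peak heat_square_bound a) auto
  also have "\<dots> = (real DIM('a) + 2) / t * heat_peak TYPE('a) a"
    using t by (simp add: field_simps power2_eq_square)
  also have "\<dots> \<le> (real DIM('a) + 2) / a * heat_peak TYPE('a) a"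
    using a t hp by (intro mult_right_mono divide_left_mono) auto
  finally show ?thesis .
qed

lemma heat_DERIV:
  fixes w :: "'a::euclidean_space"
  assumes u: "u > 0"
  shows "((\<lambda>u. heat u w) has_real_derivative - heat_laplacian u w / 2) (at u)"
proof -
  \<comment> \<open>For positive times the kernel is a single exponential, which is easier to differentiate.\<close>
  let ?g = "\<lambda>u. exp (- (norm w)\<^sup>2 / (2 * u) - real DIM('a) / 2 * ln (2 * pi * u))"
  have eq: "heat v w = ?g v" if "v > 0" for v
  proof -
    have "exp (real DIM('a) / 2 * ln (2 * pi * v)) = sqrt (2 * pi * v) ^ DIM('a)"
      using that by (simp add: powr_realpow[symmetric] powr_half_sqrt[symmetric] powr_powr)
        (simp add: powr_def)
    then show ?thesis
      by (simp add: heat_def exp_diff)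
  qed
  have "(?g has_real_derivative ?g u * ((norm w)\<^sup>2 / (2 * u\<^sup>2) - real DIM('a) / 2 * (1 / u))) (at u)"
    using u by (auto intro!: derivative_eq_intros simp: field_simps power2_eq_square)
  moreover have "?g u * ((norm w)\<^sup>2 / (2 * u\<^sup>2) - real DIM('a) / 2 * (1 / u)) = - heat_laplacian u w / 2"
    unfolding heat_laplacian_def eq[OF u] using u by (simp add: field_simps power2_eq_square)
  ultimately have "(?g has_real_derivative - heat_laplacian u w / 2) (at u)" by simp
  then show ?thesis
    by (rule has_field_derivative_transform_within_open[where S="{0<..}"]) (use u eq in auto)
qed

section \<open>The energy of the truncated transforms\<close>

text \<open>
  The density of times in the representation of the Riesz kernel by Gaussian gradients.
\<close>

definition time_weight :: "real \<Rightarrow> real" where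
  "time_weight t = 1 / sqrt (2 * pi * t)"

lemma time_weight_measurable [measurable]: "time_weight \<in> borel_measurable borel"
  unfolding time_weight_def[abs_def] by measurable

lemma time_weight_indicator_nonneg:
  assumes "S \<subseteq> {a..c}" "0 < a"
  shows "0 \<le> indicator S t * time_weight t"
  using assms by (auto simp: indicator_def time_weight_def)

lemma time_weight_integrable:
  fixes h :: "real \<Rightarrow> real"
  assumes S: "S \<in> sets borel" and S_sub: "S \<subseteq> {a..c}" and a: "0 < a" and h: "continuous_on {a..c} h"
  shows "integrable lborel (\<lambda>t. indicator S t * time_weight t * h t)"
proof -
  have "continuous_on {a..c} (\<lambda>t. time_weight t * h t)"
    unfolding time_weight_def using h a by (intro continuous_intros) auto
  then have "integrable lborel (\<lambda>t. indicator {a..c} t *\<^sub>R (time_weight t * h t))"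
    by (rule borel_integrable_compact[OF compact_Icc])
  then have "integrable lborel (\<lambda>t. indicator S t *\<^sub>R (indicator {a..c} t *\<^sub>R (time_weight t * h t)))"
    by (rule integrable_mult_indicator[rotated]) (use S in simp)
  moreover have "(\<lambda>t. indicator S t *\<^sub>R (indicator {a..c} t *\<^sub>R (time_weight t * h t))) = (\<lambda>t. indicator S t * time_weight t * h t)"
    using S_sub by (auto simp: indicator_def fun_eq_iff)
  ultimately show ?thesis by metis
qed

text \<open>
  The truncation is in the time of the Gaussians and not in the distance \<open>|x - y|\<close>, because it is the
  semigroup law in time that makes the energy computable.
\<close>

definition trunc_riesz :: "'a::euclidean_space \<Rightarrow> real set \<Rightarrow> ('a \<Rightarrow> complex) \<Rightarrow> 'a \<Rightarrow> complex" where
  "trunc_riesz b S f x = (LBINT t. (indicator S t * time_weight t) *\<^sub>R conv (heat_grad b t) f x)"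

text \<open>
  The quadratic form \<open>\<langle>G\<^sub>u * f, f\<rangle>\<close>, and below it \<open>- 2\<close> times its derivative in \<open>u\<close>; both are written
  as double integrals, which converge absolutely for integrable \<open>f\<close>.
\<close>

definition heat_energy :: "('a::euclidean_space \<Rightarrow> complex) \<Rightarrow> real \<Rightarrow> real" where
  "heat_energy f u = (\<integral>r. (f (fst r) \<bullet> f (snd r)) * heat u (fst r - snd r) \<partial>lborel2)"

definition dissipation :: "('a::euclidean_space \<Rightarrow> complex) \<Rightarrow> real \<Rightarrow> real" where
  "dissipation f u = (\<integral>r. (f (fst r) \<bullet> f (snd r)) * heat_laplacian u (fst r - snd r) \<partial>lborel2)"

lemma L1_tensor_integrable:
  fixes f :: "'a::euclidean_space \<Rightarrow> complex"
  assumes f: "integrable lborel f"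
  shows "integrable lborel2 (\<lambda>r. cmod (f (fst r)) * cmod (f (snd r)))"
  using integrable_pair_mult[OF lborel.sigma_finite_measure_axioms lborel.sigma_finite_measure_axioms
      integrable_norm[OF f] integrable_norm[OF f]]
  by (simp only: case_prod_beta')

lemma inner_mult_bound:
  fixes c :: real and z w :: complex
  assumes "\<bar>c\<bar> \<le> C"
  shows "\<bar>(z \<bullet> w) * c\<bar> \<le> C * (cmod z * cmod w)"
proof -
  have "\<bar>z \<bullet> w\<bar> * \<bar>c\<bar> \<le> (cmod z * cmod w) * C"
    using Cauchy_Schwarz_ineq2[of z w] assms by (intro mult_mono) auto
  then show ?thesis by (simp add: abs_mult mult_ac)
qed

context
  fixes f :: "'a::euclidean_space \<Rightarrow> complex"
  assumes f: "integrable lborel f"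
begin

lemma energy_meas: "f \<in> borel_measurable borel"
  using f by auto

lemma conv_grad_measurable:
  "(\<lambda>p. conv (heat_grad b (fst p)) f (snd p)) \<in> borel_measurable lborel2"
  supply [measurable] = energy_meas
  unfolding conv_def by measurable

lemma dissipation_measurable: "dissipation f \<in> borel_measurable borel"
  supply [measurable] = energy_meas
  unfolding dissipation_def[abs_def] by measurable

lemma conv_grad_inner:
  fixes b :: 'a
  assumes b: "b \<in> Basis" and s: "s > 0" and t: "t > 0"
  shows "integrable lborel (\<lambda>x. conv (heat_grad b s) f x \<bullet> conv (heat_grad b t) f x)"
    and "(LBINT x. conv (heat_grad b s) f x \<bullet> conv (heat_grad b t) f x)
      = (\<integral>r. (f (fst r) \<bullet> f (snd r)) * (LBINT x. heat_grad b s (x - fst r) * heat_grad b t (x - snd r)) \<partial>lborel2)"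
    and "integrable lborel2
      (\<lambda>r. (f (fst r) \<bullet> f (snd r)) * (LBINT x. heat_grad b s (x - fst r) * heat_grad b t (x - snd r)))"
  using conv_inner[OF heat_grad_L1(1)[OF b s] heat_grad_bound[OF b s order_refl]
      heat_grad_L1(1)[OF b t] heat_grad_bound[OF b t order_refl] f] by blast+

text \<open>
  The correlation of the heat flows at the times \<open>s\<close> and \<open>t\<close> depends on \<open>s + t\<close> only. For \<open>s = t\<close> the
  left-hand side is a sum of squared norms, which yields the sign of the dissipation.
\<close>

lemma sum_conv_grad_inner:
  assumes s: "s > 0" and t: "t > 0"
  shows "(\<Sum>b\<in>Basis. \<integral>x. conv (heat_grad b s) f x \<bullet> conv (heat_grad b t) f x \<partial>lborel) = dissipation f (s + t)"
proof -
  have i: "integrable lborel (\<lambda>x. heat_grad b s (x - y) * heat_grad b t (x - z))" if b: "b \<in> Basis" for b y z :: 'a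
  proof (rule integrable_dominated)
    show "integrable lborel (\<lambda>x. grad_peak TYPE('a) s * \<bar>heat_grad b t (x - z)\<bar>)"
      using conv_kernel_integral(2)[OF heat_grad_L1(1)[OF b t] heat_grad_bound[OF b t order_refl] f, of z] by simp
    show "norm (heat_grad b s (x - y) * heat_grad b t (x - z)) \<le> grad_peak TYPE('a) s * \<bar>heat_grad b t (x - z)\<bar>" for x
      using heat_grad_bound[OF b s order_refl] by (simp add: abs_mult mult_right_mono)
  qed measurable
  have "(\<Sum>b\<in>Basis. \<integral>x. conv (heat_grad b s) f x \<bullet> conv (heat_grad b t) f x \<partial>lborel)
     = (\<integral>r. (\<Sum>b\<in>Basis. (f (fst r) \<bullet> f (snd r)) * (LBINT x. heat_grad b s (x - fst r) * heat_grad b t (x - snd r))) \<partial>lborel2)"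
    by (subst Bochner_Integration.integral_sum) (auto intro: sum.cong simp: conv_grad_inner[OF _ s t])
  also have "\<dots> = dissipation f (s + t)"
    unfolding dissipation_def
  proof (rule Bochner_Integration.integral_cong[OF refl])
    fix r :: "'a \<times> 'a"
    have "(\<Sum>b\<in>Basis. \<integral>x. heat_grad b s (x - fst r) * heat_grad b t (x - snd r) \<partial>lborel) = heat_laplacian (s + t) (fst r - snd r)"
    proof (subst Bochner_Integration.integral_sum[symmetric])
      show "(LBINT x. (\<Sum>b\<in>Basis. heat_grad b s (x - fst r) * heat_grad b t (x - snd r))) = heat_laplacian (s + t) (fst r - snd r)"
        by (rule has_bochner_integral_integral_eq[OF heat_grad_convolution[OF s t]])
    qed (rule i)
    then show "(\<Sum>b\<in>Basis. (f (fst r) \<bullet> f (snd r)) * (LBINT x. heat_grad b s (x - fst r) * heat_grad b t (x - snd r)))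
        = (f (fst r) \<bullet> f (snd r)) * heat_laplacian (s + t) (fst r - snd r)"
      by (simp only: sum_distrib_left[symmetric])
  qed
  finally show ?thesis .
qed

lemma dissipation_nonneg:
  assumes "u > 0"
  shows "0 \<le> dissipation f u"
proof -
  have "dissipation f u = (\<Sum>b\<in>Basis. \<integral>x. conv (heat_grad b (u / 2)) f x \<bullet> conv (heat_grad b (u / 2)) f x \<partial>lborel)"
    using sum_conv_grad_inner[of "u / 2" "u / 2"] assms by simp
  also have "\<dots> \<ge> 0"
    by (intro sum_nonneg Bochner_Integration.integral_nonneg) simp
  finally show ?thesis .
qed

lemma conv_grad_bound:
  assumes "b \<in> Basis" "0 < a" "a \<le> t"
  shows "cmod (conv (heat_grad b t) f x) \<le> grad_peak TYPE('a) a * (LBINT y. cmod (f y))"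
  using assms by (intro conv_bound heat_grad_L1 heat_grad_bound f) auto

lemma conv_grad_L1:
  assumes b: "b \<in> Basis" and t: "0 < t"
  shows "integrable lborel (conv (heat_grad b t) f)"
    "(LBINT x. cmod (conv (heat_grad b t) f x)) \<le> (1 + t) / t * (LBINT y. cmod (f y))"
proof -
  note k = heat_grad_L1(1)[OF b t] heat_grad_bound[OF b t order_refl] f
  show "integrable lborel (conv (heat_grad b t) f)"
    by (rule conv_integrable[OF k])
  have "(LBINT x. cmod (conv (heat_grad b t) f x)) \<le> (LBINT w. \<bar>heat_grad b t w\<bar>) * (LBINT y. cmod (f y))"
    by (rule conv_L1_bound[OF k])
  also have "\<dots> \<le> (1 + t) / t * (LBINT y. cmod (f y))"
    by (intro mult_right_mono heat_grad_L1 b t Bochner_Integration.integral_nonneg) auto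
  finally show "(LBINT x. cmod (conv (heat_grad b t) f x)) \<le> (1 + t) / t * (LBINT y. cmod (f y))" .
qed

context
  fixes S :: "real set" and a c :: real
  assumes S [measurable]: "S \<in> sets borel" and S_sub: "S \<subseteq> {a..c}" and a: "0 < a"
begin

text \<open>
  Squaring the superposition over \<open>t \<in> S\<close> and inserting the correlation of the heat flows. The set \<open>S\<close>
  may be any Borel set of times bounded away from \<open>0\<close> and \<open>\<infinity>\<close>; differences of two windows are needed
  for the Cauchy property.
\<close>

lemma trunc_riesz_energy:
  shows "b \<in> Basis \<Longrightarrow> square_integrable (trunc_riesz b S f)"
    and "integrable lborel2 (\<lambda>r. (indicator S (fst r) * time_weight (fst r)) * (indicator S (snd r) * time_weight (snd r)) * dissipation f (fst r + snd r))"
    and "(\<Sum>b\<in>Basis. \<integral>x. (cmod (trunc_riesz b S f x))\<^sup>2 \<partial>lborel)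
       = (\<integral>r. (indicator S (fst r) * time_weight (fst r)) * (indicator S (snd r) * time_weight (snd r)) * dissipation f (fst r + snd r) \<partial>lborel2)"
proof -
  note [measurable] = energy_meas
  note S_weight_nonneg = time_weight_indicator_nonneg[OF S_sub a]
  note S_weight_integrable = time_weight_integrable[OF S S_sub a]
  let ?w = "\<lambda>t. indicator S t * time_weight t"
  let ?I = "\<integral>y. cmod (f y) \<partial>lborel"
  define u where "u = (\<lambda>b t x. ?w t *\<^sub>R conv (heat_grad b t) f x)"
  have I0: "0 \<le> ?I" by simp
  have u_meas: "case_prod (u b) \<in> borel_measurable lborel2" for b
    unfolding u_def case_prod_beta' using conv_grad_measurable[of b] by measurable
  have u_bound: "cmod (u b t x) \<le> ?w t * (grad_peak TYPE('a) a * ?I)" if "b \<in> Basis" for b t x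
    using conv_grad_bound[OF that a, of t x] S_sub S_weight_nonneg[of t]
    by (cases "t \<in> S") (auto simp: u_def intro!: mult_left_mono)
  have u_int: "integrable lborel (u b t)" if "b \<in> Basis" for b t
    using conv_grad_L1(1)[OF that, of t] S_sub a by (cases "t \<in> S") (auto simp: u_def)
  have u_L1: "(LBINT x. cmod (u b t x)) \<le> ?w t * ((1 + t) / t * ?I)" if "b \<in> Basis" for b t
  proof (cases "t \<in> S")
    case True
    then have "t > 0" using S_sub a by auto
    then show ?thesis
      using mult_left_mono[OF conv_grad_L1(2)[OF that \<open>t > 0\<close>] S_weight_nonneg[of t]]
      unfolding u_def norm_scaleR abs_of_nonneg[OF S_weight_nonneg] by simp
  qed (simp add: u_def)
  have i1: "integrable lborel (\<lambda>t. ?w t * (grad_peak TYPE('a) a * ?I))"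
    by (rule S_weight_integrable) simp
  have i2: "integrable lborel (\<lambda>t. ?w t * ((1 + t) / t * ?I))"
    by (rule S_weight_integrable) (use a in \<open>auto intro!: continuous_intros\<close>)
  note sf = lborel.sigma_finite_measure_axioms
  note F = fubini_inner[where u="u b" and v="u b" and N=lborel for b, OF sf sf sf u_meas u_meas u_bound i1 u_bound i1 u_int u_L1 i2]
  have U: "trunc_riesz b S f x = (LBINT t. u b t x)" for b x
    by (simp add: trunc_riesz_def u_def)
  have U_meas: "trunc_riesz b S f \<in> borel_measurable lborel" for b
    unfolding trunc_riesz_def[abs_def] conv_def by measurable
  show "square_integrable (trunc_riesz b S f)" if b: "b \<in> Basis"
    unfolding square_integrable_def using U_meas[of b] F(1)[OF b b b b]
    by (simp add: U[symmetric] power2_norm_eq_inner)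
  have dis: "(\<Sum>b\<in>Basis. \<integral>x. u b s x \<bullet> u b t x \<partial>lborel) = ?w s * ?w t * dissipation f (s + t)" for s t
  proof (cases "s \<in> S \<and> t \<in> S")
    case True
    then have "s > 0" "t > 0" using S_sub a by auto
    from sum_conv_grad_inner[OF this] show ?thesis
      unfolding u_def by (simp add: mult.assoc flip: sum_distrib_left)
  next
    case False
    then show ?thesis by (auto simp: u_def)
  qed
  have "integrable lborel2 (\<lambda>r. \<Sum>b\<in>(Basis::'a set). \<integral>x. u b (fst r) x \<bullet> u b (snd r) x \<partial>lborel)"
    by (intro Bochner_Integration.integrable_sum F(3))
  then show "integrable lborel2 (\<lambda>r. ?w (fst r) * ?w (snd r) * dissipation f (fst r + snd r))"
    by (simp add: dis)
  have "(\<Sum>b\<in>Basis. \<integral>x. (cmod (trunc_riesz b S f x))\<^sup>2 \<partial>lborel)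
      = (\<Sum>b\<in>(Basis::'a set). \<integral>r. (LBINT x. u b (fst r) x \<bullet> u b (snd r) x) \<partial>lborel2)"
    by (intro sum.cong refl) (use F(2) in \<open>simp add: U power2_norm_eq_inner\<close>)
  also have "\<dots> = (\<integral>r. (\<Sum>b\<in>(Basis::'a set). \<integral>x. u b (fst r) x \<bullet> u b (snd r) x \<partial>lborel) \<partial>lborel2)"
    by (intro Bochner_Integration.integral_sum[symmetric] F(3))
  finally show "(\<Sum>b\<in>Basis. \<integral>x. (cmod (trunc_riesz b S f x))\<^sup>2 \<partial>lborel)
       = (\<integral>r. ?w (fst r) * ?w (snd r) * dissipation f (fst r + snd r) \<partial>lborel2)"
    by (simp add: dis)
qed

end

end

section \<open>The total energy\<close>

lemma nn_integral_beta_half: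
  "(\<integral>\<^sup>+v. ennreal (indicator {0<..<1} v * (1 / (sqrt v * sqrt (1 - v)))) \<partial>lborel) = ennreal pi"
proof -
  have "((\<lambda>t. t powr (1/2 - 1) * (1 - t) powr (1/2 - 1)) has_integral pi) {0..1}"
    using has_integral_Beta_real[of "1/2" "1/2"] by (simp add: Beta_def Gamma_one_half_real)
  then have "((\<lambda>t. t powr (1/2 - 1) * (1 - t) powr (1/2 - 1)) has_integral pi) {0<..<1}"
    by (simp add: has_integral_Icc_iff_Ioo)
  then have "((\<lambda>t. 1 / (sqrt t * sqrt (1 - t))) has_integral pi) {0<..<1::real}"
    by (rule has_integral_eq[rotated]) (auto simp: powr_minus_divide powr_half_sqrt)
  from nn_integral_has_integral_lebesgue[OF _ this] show ?thesis
    by (simp add: mult.commute)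
qed

text \<open>
  The substitution \<open>s = u v\<close> removes \<open>u\<close>, and what remains is the integral for \<open>B(\<onehalf>, \<onehalf>) = \<pi>\<close>. It is
  here that the normalization of the time weight is used: the outcome \<open>\<onehalf>\<close> cancels the factor \<open>2\<close> in the
  definition of the dissipation.
\<close>

lemma time_weight_convolution:
  assumes u: "u > 0"
  shows "(\<integral>\<^sup>+s. ennreal (indicator {0<..<u} s * (time_weight s * time_weight (u - s))) \<partial>lborel) = ennreal (1 / 2)"
proof -
  have "(\<integral>\<^sup>+s. ennreal (indicator {0<..<u} s * (time_weight s * time_weight (u - s))) \<partial>lborel)
      = ennreal \<bar>u\<bar> * (\<integral>\<^sup>+v. ennreal (indicator {0<..<u} (0 + u * v) * (time_weight (0 + u * v) * time_weight (u - (0 + u * v)))) \<partial>lborel)"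
    by (rule nn_integral_real_affine) (use u in auto)
  also have "(\<integral>\<^sup>+v. ennreal (indicator {0<..<u} (0 + u * v) * (time_weight (0 + u * v) * time_weight (u - (0 + u * v)))) \<partial>lborel)
      = (\<integral>\<^sup>+v. ennreal (1 / (2 * pi * u)) * ennreal (indicator {0<..<1} v * (1 / (sqrt v * sqrt (1 - v)))) \<partial>lborel)"
  proof (rule nn_integral_cong)
    fix v :: real
    have "indicator {0<..<u} (0 + u * v) * (time_weight (0 + u * v) * time_weight (u - (0 + u * v)))
       = 1 / (2 * pi * u) * (indicator {0<..<1} v * (1 / (sqrt v * sqrt (1 - v))))"
    proof (cases "0 < v \<and> v < 1")
      case True
      have "u - u * v = u * (1 - v)" by (simp add: algebra_simps)
      moreover have "sqrt (2 * pi * (u * v)) * sqrt (2 * pi * (u * (1 - v))) = 2 * pi * u * (sqrt v * sqrt (1 - v))"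
      proof -
        have "2 * pi * (u * v) * (2 * pi * (u * (1 - v))) = (2 * pi * u)\<^sup>2 * (v * (1 - v))"
          by (simp add: power2_eq_square)
        then have "sqrt (2 * pi * (u * v)) * sqrt (2 * pi * (u * (1 - v))) = sqrt ((2 * pi * u)\<^sup>2 * (v * (1 - v)))"
          by (simp only: real_sqrt_mult[symmetric])
        also have "\<dots> = sqrt ((2 * pi * u)\<^sup>2) * (sqrt v * sqrt (1 - v))"
          by (simp only: real_sqrt_mult)
        also have "sqrt ((2 * pi * u)\<^sup>2) = 2 * pi * u"
          using u by (subst real_sqrt_abs) simp
        finally show ?thesis .
      qed
      ultimately show ?thesis
        using True u by (simp add: time_weight_def)
    next
      case False
      then show ?thesis using u by (auto simp: indicator_def zero_less_mult_iff)
    qed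
    then show "ennreal (indicator {0<..<u} (0 + u * v) * (time_weight (0 + u * v) * time_weight (u - (0 + u * v))))
       = ennreal (1 / (2 * pi * u)) * ennreal (indicator {0<..<1} v * (1 / (sqrt v * sqrt (1 - v))))"
      using u by (simp add: ennreal_mult'[symmetric])
  qed
  also have "ennreal \<bar>u\<bar> * \<dots> = ennreal (1 / 2)"
  proof -
    have "ennreal u * (ennreal (1 / (2 * pi * u)) * ennreal pi) = ennreal (u * (1 / (2 * pi * u) * pi))"
    proof -
      have "ennreal (1 / (2 * pi * u)) * ennreal pi = ennreal (1 / (2 * pi * u) * pi)"
        using u by (intro ennreal_mult'[symmetric]) simp
      moreover have "ennreal u * ennreal (1 / (2 * pi * u) * pi) = ennreal (u * (1 / (2 * pi * u) * pi))"
        using u by (intro ennreal_mult'[symmetric]) simp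
      ultimately show ?thesis by simp
    qed
    also have "u * (1 / (2 * pi * u) * pi) = 1 / 2" using u by simp
    finally show ?thesis
      using u by (subst nn_integral_cmult) (simp_all only: nn_integral_beta_half abs_of_pos, measurable)
  qed
  finally show ?thesis .
qed

text \<open>
  The substitution \<open>u = s + t\<close> in the double integral, followed by Tonelli's theorem.
\<close>

lemma nn_integral_time_weight_sum:
  fixes \<phi> :: "real \<Rightarrow> ennreal"
  assumes [measurable]: "\<phi> \<in> borel_measurable borel"
  shows "(\<integral>\<^sup>+r. ennreal ((indicator {0<..} (fst r) * time_weight (fst r)) * (indicator {0<..} (snd r) * time_weight (snd r)))
       * \<phi> (fst r + snd r) \<partial>lborel2)
     = ennreal (1 / 2) * (\<integral>\<^sup>+u. indicator {0<..} u * \<phi> u \<partial>lborel)"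
proof -
  let ?k = "\<lambda>s t. ennreal ((indicator {0<..} s * time_weight s) * (indicator {0<..} t * time_weight t))"
  have "(\<integral>\<^sup>+r. ?k (fst r) (snd r) * \<phi> (fst r + snd r) \<partial>lborel2)
      = (\<integral>\<^sup>+s. (\<integral>\<^sup>+t. ?k s t * \<phi> (s + t) \<partial>lborel) \<partial>lborel)"
    by (subst lborel.nn_integral_fst[symmetric]) auto
  also have "\<dots> = (\<integral>\<^sup>+s. (\<integral>\<^sup>+u. ?k s (u - s) * \<phi> (s + (u - s)) \<partial>lborel) \<partial>lborel)"
    by (rule nn_integral_cong, rule nn_integral_lborel_shift[symmetric]) measurable
  also have "\<dots> = (\<integral>\<^sup>+u. (\<integral>\<^sup>+s. ?k s (u - s) * \<phi> (s + (u - s)) \<partial>lborel) \<partial>lborel)"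
    by (rule lborel_pair.Fubini') measurable
  also have "\<dots> = (\<integral>\<^sup>+u. ennreal (1 / 2) * (indicator {0<..} u * \<phi> u) \<partial>lborel)"
  proof (rule nn_integral_cong)
    fix u :: real
    have "(\<integral>\<^sup>+s. ?k s (u - s) * \<phi> (s + (u - s)) \<partial>lborel)
        = (\<integral>\<^sup>+s. ennreal (indicator {0<..<u} s * (time_weight s * time_weight (u - s))) * \<phi> u \<partial>lborel)"
      by (rule nn_integral_cong) (auto simp: indicator_def)
    also have "\<dots> = (\<integral>\<^sup>+s. ennreal (indicator {0<..<u} s * (time_weight s * time_weight (u - s))) \<partial>lborel) * \<phi> u"
      by (rule nn_integral_multc) measurable
    also have "\<dots> = ennreal (1 / 2) * (indicator {0<..} u * \<phi> u)"
    proof (cases "u > 0")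
      case True
      then show ?thesis by (simp add: time_weight_convolution)
    next
      case False
      then have "indicator {0<..<u} s = (0::real)" for s by (auto simp: indicator_def)
      with False show ?thesis by simp
    qed
    finally show "(\<integral>\<^sup>+s. ?k s (u - s) * \<phi> (s + (u - s)) \<partial>lborel) = ennreal (1 / 2) * (indicator {0<..} u * \<phi> u)" .
  qed
  also have "\<dots> = ennreal (1 / 2) * (\<integral>\<^sup>+u. indicator {0<..} u * \<phi> u \<partial>lborel)"
    by (rule nn_integral_cmult) measurable
  finally show ?thesis .
qed

text \<open>
  An exhaustion of the positive times by compact intervals.
\<close>

definition window :: "nat \<Rightarrow> real set" where
  "window k = {1 / real (Suc k)..real (Suc k)}"

lemma window_props: "window k \<in> sets borel" "window k \<subseteq> {1 / real (Suc k)..real (Suc k)}" "0 < 1 / real (Suc k)"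
  "window k \<subseteq> {0<..}"
proof -
  show "window k \<subseteq> {0<..}"
  proof
    fix t assume "t \<in> window k"
    then have "1 / real (Suc k) \<le> t" by (simp add: window_def)
    moreover have "0 < 1 / real (Suc k)" by simp
    ultimately show "t \<in> {0<..}" by (metis greaterThan_iff less_le_trans)
  qed
qed (simp_all add: window_def)

lemma window_mono: "j \<le> k \<Longrightarrow> window j \<subseteq> window k"
  unfolding window_def by (auto intro: order_trans[rotated] simp: frac_le)

lemma eventually_in_window:
  assumes "t > 0"
  shows "\<forall>\<^sub>F k in sequentially. t \<in> window k"
proof -
  obtain k1 where k1: "1 / real (Suc k1) < t" using assms nat_approx_posE by metis
  obtain k2 :: nat where k2: "t < real k2" using reals_Archimedean2 by blast
  show ?thesis
    using eventually_ge_at_top[of "max k1 k2"]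
  proof eventually_elim
    case (elim k)
    then have "1 / real (Suc k) \<le> 1 / real (Suc k1)"
      by (intro frac_le) auto
    then show ?case
      using k1 k2 elim by (simp add: window_def)
  qed
qed

lemma eventually_indicator_window:
  "\<forall>\<^sub>F k in sequentially. indicator (window k) t = (indicator {0<..} t :: real)"
proof (cases "t > 0")
  case True
  then show ?thesis using eventually_in_window[OF True] by (auto elim: eventually_mono)
next
  case False
  then have "t \<notin> window k" for k using window_props(4)[of k] by auto
  with False show ?thesis by simp
qed

text \<open>
  The class of functions on which the principal values are computed. The Lipschitz bound gives the
  convergence of the principal value at the singularity and the continuity of \<open>\<langle>G\<^sub>u * f, f\<rangle>\<close> at \<open>u = 0\<close>;
  integrability controls the kernel at infinity.
\<close>

locale lipschitz_L1 =
  fixes f :: "'a::euclidean_space \<Rightarrow> complex" and L M :: real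
  assumes int: "integrable lborel f"
    and bound: "\<And>x. cmod (f x) \<le> M"
    and lip: "\<And>x y. cmod (f x - f y) \<le> L * norm (x - y)"
begin

lemma meas [measurable]: "f \<in> borel_measurable borel"
  using int by auto

lemma L_nonneg: "0 \<le> L"
proof -
  obtain b :: 'a where b: "b \<in> Basis" using nonempty_Basis by blast
  have "0 \<le> L * norm (b - 0)" using lip[of b 0] norm_ge_zero order_trans by blast
  with b show ?thesis by simp
qed

lemma sq_int: "square_integrable f"
  unfolding square_integrable_def
proof
  show "integrable lborel (\<lambda>x. (cmod (f x))\<^sup>2)"
  proof (rule integrable_dominated)
    show "integrable lborel (\<lambda>x. M * cmod (f x))" using int by simp
    show "norm ((cmod (f x))\<^sup>2) \<le> M * cmod (f x)" for x
      using bound[of x] by (simp add: power2_eq_square mult_right_mono)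
  qed measurable
qed simp

lemma dissipation_meas [measurable]: "dissipation f \<in> borel_measurable borel"
  by (rule dissipation_measurable[OF int])

lemma heat_energy_integrable:
  assumes t: "t > 0"
  shows "integrable lborel2 (\<lambda>r. (f (fst r) \<bullet> f (snd r)) * heat t (fst r - snd r))"
proof (rule integrable_dominated)
  show "integrable lborel2 (\<lambda>r. heat_peak TYPE('a) t * (cmod (f (fst r)) * cmod (f (snd r))))"
    using L1_tensor_integrable[OF int] by simp
  have "\<bar>heat t w\<bar> \<le> heat_peak TYPE('a) t" for w :: 'a
    using heat_le_peak[OF t order_refl, of w] heat_nonneg[OF t, of w] by simp
  then show "norm ((f (fst r) \<bullet> f (snd r)) * heat t (fst r - snd r))
      \<le> heat_peak TYPE('a) t * (cmod (f (fst r)) * cmod (f (snd r)))" for r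
    unfolding real_norm_def by (rule inner_mult_bound)
qed measurable

text \<open>
  The fundamental theorem of calculus under the double integral.
\<close>

lemma heat_energy_diff:
  assumes a: "0 < a" "a \<le> c"
  shows "(\<integral>\<^sup>+u. ennreal (indicator {a..c} u * dissipation f u) \<partial>lborel) = ennreal (2 * (heat_energy f a - heat_energy f c))"
proof -
  let ?C = "(real DIM('a) + 2) / a * heat_peak TYPE('a) a"
  let ?P = "lborel2 :: ('a \<times> 'a) measure"
  have sP: "sigma_finite_measure ?P"
    unfolding lborel_prod by (rule lborel.sigma_finite_measure_axioms)
  interpret P: sigma_finite_measure ?P by (rule sP)
  interpret Q: pair_sigma_finite "lborel :: real measure" ?P ..
  let ?W = "\<lambda>u r. indicator {a..c} u * ((f (fst r) \<bullet> f (snd r)) * heat_laplacian u (fst r - snd r))"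
  have 1: "integrable ?P (\<lambda>r. cmod (f (fst r)) * cmod (f (snd r)))"
    by (rule L1_tensor_integrable[OF int])
  have ind: "integrable lborel (\<lambda>u. indicator {a..c} u * ?C)"
    by (intro integrable_mult_left integrable_real_indicator) (auto simp: emeasure_lborel_Icc_eq)
  have Wint: "integrable (lborel \<Otimes>\<^sub>M ?P) (\<lambda>(u, r). ?W u r)"
  proof (rule integrable_pair_dominated[OF lborel.sigma_finite_measure_axioms sP ind 1])
    fix u and r :: "'a \<times> 'a"
    show "norm (?W u r) \<le> (indicator {a..c} u * ?C) * (cmod (f (fst r)) * cmod (f (snd r)))"
    proof (cases "u \<in> {a..c}")
      case True
      then have "\<bar>heat_laplacian u (fst r - snd r)\<bar> \<le> ?C"
        by (intro heat_laplacian_bound a) simp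
      from inner_mult_bound[OF this, of "f (fst r)" "f (snd r)"] True show ?thesis
        by (simp only: indicator_simps mult_1 real_norm_def)
    qed simp
  qed measurable
  have "(LBINT u. indicator {a..c} u * dissipation f u) = (LBINT u. (\<integral>r. ?W u r \<partial>?P))"
    by (simp add: dissipation_def)
  also have "\<dots> = (\<integral>r. (LBINT u. ?W u r) \<partial>?P)"
    by (rule Q.Fubini_integral[symmetric, OF Wint])
  also have "\<dots> = (\<integral>r. 2 * ((f (fst r) \<bullet> f (snd r)) * heat a (fst r - snd r) - (f (fst r) \<bullet> f (snd r)) * heat c (fst r - snd r)) \<partial>?P)"
  proof (rule Bochner_Integration.integral_cong[OF refl])
    fix r :: "'a \<times> 'a"
    let ?w = "fst r - snd r"
    have 1: "(LBINT u. heat_laplacian u ?w * indicator {a..c} u) = - 2 * heat c ?w - - 2 * heat a ?w"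
    proof (rule integral_FTC_Icc_real[OF a(2)])
      fix u assume "a \<le> u" "u \<le> c"
      then have u: "u > 0" using a by simp
      show "((\<lambda>u. - 2 * heat u ?w) has_real_derivative heat_laplacian u ?w) (at u)"
        using DERIV_cmult[OF heat_DERIV[OF u], of "-2" ?w] by simp
      show "isCont (\<lambda>u. heat_laplacian u ?w) u"
        unfolding heat_laplacian_def heat_def using u by (intro continuous_intros) auto
    qed
    have 2: "(LBINT u. ?W u r) = (f (fst r) \<bullet> f (snd r)) * (LBINT u. heat_laplacian u ?w * indicator {a..c} u)"
      by (simp only: integral_mult_right_zero[symmetric]) (simp add: mult_ac)
    show "(LBINT u. ?W u r) = 2 * ((f (fst r) \<bullet> f (snd r)) * heat a ?w - (f (fst r) \<bullet> f (snd r)) * heat c ?w)"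
      unfolding 2 1 by (simp add: right_diff_distrib)
  qed
  also have "\<dots> = 2 * (heat_energy f a - heat_energy f c)"
  proof -
    show ?thesis
      using a heat_energy_integrable by (simp add: heat_energy_def)
  qed
  finally have eq: "(LBINT u. indicator {a..c} u * dissipation f u) = 2 * (heat_energy f a - heat_energy f c)" .
  have "integrable lborel (\<lambda>u. \<integral>r. ?W u r \<partial>?P)"
    using Q.integrable_fst'[OF Wint] by simp
  then have "integrable lborel (\<lambda>u. indicator {a..c} u * dissipation f u)"
    by (simp add: dissipation_def)
  then show ?thesis
    unfolding eq[symmetric]
    using dissipation_nonneg[OF int] a by (intro nn_integral_eq_integral) (auto intro!: AE_I2 simp: indicator_def)
qed

lemma norm_heat_moment:
  assumes t: "t > 0"
  shows "integrable lborel (\<lambda>w::'a. norm w * heat t w)"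
    and "(LBINT (w::'a). norm w * heat t w) \<le> sqrt t * (1 + real DIM('a))"
proof -
  let ?g = "\<lambda>w::'a. sqrt t * heat t w + (norm w)\<^sup>2 * heat t w / sqrt t"
  have 1: "has_bochner_integral lborel ?g (sqrt t * 1 + (real DIM('a) * t) / sqrt t)"
    by (intro has_bochner_integral_add has_bochner_integral_mult_right has_bochner_integral_divide_zero heat_mass heat_norm_moment t)
  \<comment> \<open>\<open>a \<le> 1 + a\<^sup>2\<close> for \<open>a = |w| / \<surd>t\<close>, the scale on which \<open>G\<^sub>t\<close> lives\<close>
  have 2: "norm w * heat t w \<le> ?g w" for w :: 'a
  proof -
    have "norm w / sqrt t \<le> 1 + (norm w / sqrt t)\<^sup>2"
      by (rule order_trans[OF abs_ge_self abs_le_one_plus_square])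
    then have "sqrt t * (norm w / sqrt t) \<le> sqrt t * (1 + (norm w / sqrt t)\<^sup>2)"
      using t by (intro mult_left_mono) auto
    moreover have "c * (n / c) = n" "c * (1 + (n / c)\<^sup>2) = c + n\<^sup>2 / c" if "c > 0" for c n :: real
      using that by (simp_all add: field_simps power2_eq_square)
    ultimately have "norm w \<le> sqrt t + (norm w)\<^sup>2 / sqrt t"
      using t by simp
    then have "norm w * heat t w \<le> (sqrt t + (norm w)\<^sup>2 / sqrt t) * heat t w"
      using heat_nonneg[OF t] by (rule mult_right_mono)
    then show ?thesis by (simp add: distrib_right)
  qed
  show 3: "integrable lborel (\<lambda>w::'a. norm w * heat t w)"
    by (rule integrable_dominated[of _ ?g])
      (use 1 2 in \<open>auto simp: has_bochner_integral_iff abs_mult abs_of_nonneg[OF heat_nonneg[OF t]]\<close>)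
  have "(LBINT (w::'a). norm w * heat t w) \<le> (LBINT w. ?g w)"
    using 1 2 3 by (intro integral_mono) (auto simp: has_bochner_integral_iff)
  also have "\<dots> = sqrt t * (1 + real DIM('a))"
  proof -
    have "real DIM('a) * t / sqrt t = real DIM('a) * sqrt t"
      using t by (simp only: times_divide_eq_right[symmetric]) (simp add: real_div_sqrt)
    then show ?thesis
      using has_bochner_integral_integral_eq[OF 1] by (simp add: algebra_simps)
  qed
  finally show "(LBINT (w::'a). norm w * heat t w) \<le> sqrt t * (1 + real DIM('a))" .
qed

definition mass2 :: real where
  "mass2 = (LBINT x. (cmod (f x))\<^sup>2)"


text \<open>
  Since \<open>G\<^sub>t\<close> has total mass \<open>1\<close>, the difference is the double integral of
  \<open>f(x) \<bullet> (f(y) - f(x)) G\<^sub>t(x - y)\<close>, and the Lipschitz bound reduces it to the first moment of \<open>G\<^sub>t\<close>, which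
  is of order \<open>\<surd>t\<close>.
\<close>

lemma heat_energy_near_mass2:
  assumes t: "t > 0"
  shows "\<bar>heat_energy f t - mass2\<bar> \<le> L * (sqrt t * (1 + real DIM('a))) * (LBINT x. cmod (f x))"
proof -
  let ?K = "sqrt t * (1 + real DIM('a))"
  define g where "g = (\<lambda>x. \<integral>y. (f x \<bullet> f y) * heat t (x - y) \<partial>lborel)"
  have gi: "integrable lborel g"
    using lborel_pair.integrable_fst'[OF heat_energy_integrable[OF t]] by (simp add: g_def)
  have ge: "heat_energy f t = (LBINT x. g x)"
    using lborel_pair.integral_fst'[OF heat_energy_integrable[OF t]] by (simp add: g_def heat_energy_def)
  have m: "mass2 = (LBINT x. f x \<bullet> f x)" "integrable lborel (\<lambda>x. f x \<bullet> f x)"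
    using square_integrable_integrable_inner[OF sq_int sq_int] by (simp_all add: mass2_def power2_norm_eq_inner)
  have pt: "\<bar>g x - f x \<bullet> f x\<bar> \<le> cmod (f x) * (L * ?K)" for x
  proof -
    have hm: "integrable lborel (\<lambda>y. heat t (x - y))" "(LBINT y. heat t (x - y)) = 1"
      using heat_mass[OF t, where 'a='a] integrable_lborel_reflect[of "heat t" x] integral_lborel_reflect[of "heat t" x]
      by (auto simp: has_bochner_integral_iff)
    have nm: "integrable lborel (\<lambda>y. norm (x - y) * heat t (x - y))" "(LBINT y. norm (x - y) * heat t (x - y)) \<le> ?K"
      using norm_heat_moment[OF t] integrable_lborel_reflect[of "\<lambda>w. norm w * heat t w" x]
        integral_lborel_reflect[of "\<lambda>w. norm w * heat t w" x] by auto
    have i1: "integrable lborel (\<lambda>y. (f x \<bullet> f y) * heat t (x - y))"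
    proof (rule integrable_dominated)
      show "integrable lborel (\<lambda>y. (cmod (f x) * M) * heat t (x - y))" using hm by simp
      have "\<bar>f x \<bullet> f y\<bar> \<le> cmod (f x) * M" for y
        using Cauchy_Schwarz_ineq2[of "f x" "f y"] mult_left_mono[OF bound[of y], of "cmod (f x)"] by simp
      then show "norm ((f x \<bullet> f y) * heat t (x - y)) \<le> (cmod (f x) * M) * heat t (x - y)" for y
        using heat_nonneg[OF t, of "x - y"] by (simp add: abs_mult mult_right_mono)
    qed measurable
    have "g x - f x \<bullet> f x = (LBINT y. (f x \<bullet> f y) * heat t (x - y) - (f x \<bullet> f x) * heat t (x - y))"
      using i1 hm by (simp add: g_def)
    also have "\<bar>\<dots>\<bar> \<le> (LBINT y. (cmod (f x) * L) * (norm (x - y) * heat t (x - y)))"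
    proof (rule integral_abs_bound_integral)
      show "integrable lborel (\<lambda>y. (f x \<bullet> f y) * heat t (x - y) - (f x \<bullet> f x) * heat t (x - y))"
        using i1 hm by simp
      show "integrable lborel (\<lambda>y. (cmod (f x) * L) * (norm (x - y) * heat t (x - y)))"
        using nm by simp
      fix y
      have "\<bar>(f x \<bullet> f y) * heat t (x - y) - (f x \<bullet> f x) * heat t (x - y)\<bar> = \<bar>f x \<bullet> (f y - f x)\<bar> * heat t (x - y)"
        using heat_nonneg[OF t, of "x - y"] by (simp add: inner_diff_right left_diff_distrib[symmetric] abs_mult)
      also have "\<dots> \<le> (cmod (f x) * (L * norm (x - y))) * heat t (x - y)"
        using Cauchy_Schwarz_ineq2[of "f x" "f y - f x"] mult_left_mono[OF lip[of y x], of "cmod (f x)"] heat_nonneg[OF t, of "x - y"]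
        by (intro mult_right_mono) (auto simp: norm_minus_commute)
      finally show "\<bar>(f x \<bullet> f y) * heat t (x - y) - (f x \<bullet> f x) * heat t (x - y)\<bar>
          \<le> (cmod (f x) * L) * (norm (x - y) * heat t (x - y))"
        by (simp add: mult_ac)
    qed
    also have "\<dots> \<le> (cmod (f x) * L) * ?K"
      using nm L_nonneg by (subst integral_mult_right_zero) (intro mult_left_mono, auto)
    finally show ?thesis by (simp add: mult_ac)
  qed
  have "\<bar>heat_energy f t - mass2\<bar> = \<bar>\<integral>x. g x - f x \<bullet> f x \<partial>lborel\<bar>"
    using gi m by (simp add: ge)
  also have "\<dots> \<le> (LBINT x. cmod (f x) * (L * ?K))"
    by (rule integral_abs_bound_integral) (use gi m int pt in auto)
  finally show ?thesis by (simp add: mult_ac)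
qed

lemma heat_energy_bound:
  assumes t: "t \<ge> 1"
  shows "\<bar>heat_energy f t\<bar> \<le> 1 / sqrt t * (\<integral>r. cmod (f (fst r)) * cmod (f (snd r)) \<partial>lborel2)"
proof -
  have t0: "t > 0" using t by simp
  \<comment> \<open>For \<open>t \<ge> 1\<close> the base \<open>\<surd>(2 \<pi> t)\<close> is at least \<open>1\<close>, so that its \<open>n\<close>th power dominates its first.\<close>
  have "1 \<le> sqrt (2 * pi)" using pi_gt3 by simp
  then have "1 * sqrt t \<le> sqrt (2 * pi) * sqrt t"
    using t by (intro mult_right_mono) auto
  then have st: "sqrt t \<le> sqrt (2 * pi * t)" by (simp add: real_sqrt_mult)
  also have "\<dots> \<le> sqrt (2 * pi * t) ^ DIM('a)"
    using st t DIM_positive[where 'a='a] order_trans[OF _ st, of 1] by (intro self_le_power) auto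
  finally have pk: "heat_peak TYPE('a) t \<le> 1 / sqrt t"
    unfolding heat_peak_def using t by (intro divide_left_mono) auto
  have "\<bar>heat_energy f t\<bar> \<le> (\<integral>r. 1 / sqrt t * (cmod (f (fst r)) * cmod (f (snd r))) \<partial>lborel2)"
    unfolding heat_energy_def
  proof (rule integral_abs_bound_integral)
    show "integrable lborel2 (\<lambda>r. 1 / sqrt t * (cmod (f (fst r)) * cmod (f (snd r))))"
      by (rule integrable_mult_right) (rule L1_tensor_integrable[OF int])
    fix r
    show "\<bar>(f (fst r) \<bullet> f (snd r)) * heat t (fst r - snd r)\<bar> \<le> 1 / sqrt t * (cmod (f (fst r)) * cmod (f (snd r)))"
      using order_trans[OF heat_le_peak[OF t0 order_refl] pk] heat_nonneg[OF t0, of "fst r - snd r"]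
      by (intro inner_mult_bound) simp
  qed (rule heat_energy_integrable[OF t0])
  also have "\<dots> = 1 / sqrt t * (\<integral>r. cmod (f (fst r)) * cmod (f (snd r)) \<partial>lborel2)"
    by (rule integral_mult_right_zero)
  finally show ?thesis .
qed

lemma total_dissipation:
  "(\<integral>\<^sup>+u. indicator {0<..} u * ennreal (dissipation f u) \<partial>lborel) = ennreal (2 * mass2)"
proof (rule LIMSEQ_unique)
  let ?a = "\<lambda>k::nat. 1 / real (Suc k)" and ?c = "\<lambda>k::nat. real (Suc k)"
  have ac: "0 < ?a k" "?a k \<le> ?c k" for k
    by (auto simp: divide_le_eq intro: order_trans[of 1 "1 + real k"])
  let ?F = "\<lambda>k u. ennreal (indicator (window k) u * dissipation f u)"
  show "(\<lambda>k. \<integral>\<^sup>+u. ?F k u \<partial>lborel) \<longlonglongrightarrow> (\<integral>\<^sup>+u. indicator {0<..} u * ennreal (dissipation f u) \<partial>lborel)"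
  proof (rule nn_integral_LIMSEQ)
    show "incseq ?F"
    proof (intro incseq_SucI le_funI)
      fix k u
      show "?F k u \<le> ?F (Suc k) u"
        using window_mono[of k "Suc k"] dissipation_nonneg[OF int, of u] window_props(4)[of "Suc k"]
        by (auto simp: indicator_def)
    qed
    fix u :: real
    show "(\<lambda>k. ?F k u) \<longlonglongrightarrow> indicator {0<..} u * ennreal (dissipation f u)"
    proof (rule tendsto_eventually)
      show "\<forall>\<^sub>F k in sequentially. ?F k u = indicator {0<..} u * ennreal (dissipation f u)"
        using eventually_indicator_window[of u] by eventually_elim (simp add: indicator_def)
    qed
    show "?F k \<in> borel_measurable lborel" for k
      using window_props(1)[of k] by measurable
  qed
  have "(\<lambda>k. heat_energy f (?a k)) \<longlonglongrightarrow> mass2"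
  proof (rule LIM_zero_cancel, rule Lim_null_comparison)
    show "\<forall>\<^sub>F k in sequentially. norm (heat_energy f (?a k) - mass2) \<le> L * (sqrt (?a k) * (1 + real DIM('a))) * (LBINT x. cmod (f x))"
      using heat_energy_near_mass2[OF ac(1)] by simp
    have "(\<lambda>k. L * (sqrt (?a k) * (1 + real DIM('a))) * (LBINT x. cmod (f x))) \<longlonglongrightarrow> L * (sqrt 0 * (1 + real DIM('a))) * (LBINT x. cmod (f x))"
      by (intro tendsto_intros LIMSEQ_Suc[OF lim_1_over_n])
    then show "(\<lambda>k. L * (sqrt (?a k) * (1 + real DIM('a))) * (LBINT x. cmod (f x))) \<longlonglongrightarrow> 0" by simp
  qed
  moreover have "(\<lambda>k. heat_energy f (?c k)) \<longlonglongrightarrow> 0"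
  proof (rule Lim_null_comparison)
    let ?I = "\<integral>r. cmod (f (fst r)) * cmod (f (snd r)) \<partial>lborel2"
    show "\<forall>\<^sub>F k in sequentially. norm (heat_energy f (?c k)) \<le> 1 / sqrt (?c k) * ?I"
      using heat_energy_bound by simp
    have "(\<lambda>k. sqrt (?a k) * ?I) \<longlonglongrightarrow> sqrt 0 * ?I"
      by (intro tendsto_intros LIMSEQ_Suc[OF lim_1_over_n])
    then show "(\<lambda>k. 1 / sqrt (?c k) * ?I) \<longlonglongrightarrow> 0" by (simp add: real_sqrt_divide)
  qed
  ultimately have "(\<lambda>k. ennreal (2 * (heat_energy f (?a k) - heat_energy f (?c k)))) \<longlonglongrightarrow> ennreal (2 * (mass2 - 0))"
    by (intro tendsto_ennrealI tendsto_intros)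
  then show "(\<lambda>k. \<integral>\<^sup>+u. ?F k u \<partial>lborel) \<longlonglongrightarrow> ennreal (2 * mass2)"
    using heat_energy_diff[OF ac] by (simp add: window_def)
qed

text \<open>
  The integrand of the energy on the set of all pairs of positive times; at other pairs it vanishes,
  so that it can be integrated over the plane.
\<close>

definition energy_density :: "real \<times> real \<Rightarrow> ennreal" where
  "energy_density r = ennreal ((indicator {0<..} (fst r) * time_weight (fst r)) * (indicator {0<..} (snd r) * time_weight (snd r)))
     * ennreal (dissipation f (fst r + snd r))"

lemma energy_density_measurable [measurable]: "energy_density \<in> borel_measurable lborel2"
  unfolding energy_density_def[abs_def] by measurable

lemma total_energy: "(\<integral>\<^sup>+r. energy_density r \<partial>lborel2) = ennreal mass2"
  unfolding energy_density_def
proof (subst nn_integral_time_weight_sum)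
  have "ennreal (1 / 2) * ennreal (2 * mass2) = ennreal (1 / 2 * (2 * mass2))"
    by (rule ennreal_mult'[symmetric]) simp
  then show "ennreal (1 / 2) * (\<integral>\<^sup>+u. indicator {0<..} u * ennreal (dissipation f u) \<partial>lborel) = ennreal mass2"
    unfolding total_dissipation by simp
qed measurable

lemma trunc_riesz_energy_density:
  assumes S: "S \<in> sets borel" "S \<subseteq> {a..c}" "0 < a"
  shows "ennreal (\<Sum>b\<in>Basis. \<integral>x. (cmod (trunc_riesz b S f x))\<^sup>2 \<partial>lborel)
     = (\<integral>\<^sup>+r. indicator (S \<times> S) r * energy_density r \<partial>lborel2)"
proof -
  let ?g = "\<lambda>r. (indicator S (fst r) * time_weight (fst r)) * (indicator S (snd r) * time_weight (snd r)) * dissipation f (fst r + snd r)"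
  have pos: "t > 0" if "t \<in> S" for t using S that by auto
  have "ennreal (\<integral>r. ?g r \<partial>lborel2) = (\<integral>\<^sup>+r. ennreal (?g r) \<partial>lborel2)"
  proof (rule nn_integral_eq_integral[symmetric])
    show "AE r in lborel2. 0 \<le> ?g r"
      using pos dissipation_nonneg[OF int]
      by (intro AE_I2) (auto simp: indicator_def time_weight_def less_imp_le add_pos_pos intro!: divide_nonneg_nonneg)
  qed (rule trunc_riesz_energy[OF int S])
  also have "\<dots> = (\<integral>\<^sup>+r. indicator (S \<times> S) r * energy_density r \<partial>lborel2)"
  proof (rule nn_integral_cong)
    fix r :: "real \<times> real"
    show "ennreal (?g r) = indicator (S \<times> S) r * energy_density r"
      using pos by (cases r) (auto simp: energy_density_def indicator_def time_weight_def ennreal_mult'[symmetric])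
  qed
  finally show ?thesis
    by (simp add: trunc_riesz_energy(3)[OF int S])
qed

end

section \<open>The Riesz kernel as a superposition of heat kernels\<close>

text \<open>
  The constant \<open>c\<^sub>n\<close> of the Riesz kernel.
\<close>

definition riesz_normalization :: "nat \<Rightarrow> real" where
  "riesz_normalization n = Gamma ((real n + 1) / 2) / pi powr ((real n + 1) / 2)"

lemma riesz_normalization_pos: "riesz_normalization n > 0"
  by (simp add: riesz_normalization_def Gamma_real_pos)

definition riesz_profile :: "'a::euclidean_space \<Rightarrow> real" where
  "riesz_profile w = riesz_normalization DIM('a) / norm w ^ (DIM('a) + 1)"

lemma riesz_profile_nonneg: "0 \<le> riesz_profile w"
  using riesz_normalization_pos[where n="DIM('a)"] by (simp add: riesz_profile_def)

lemma riesz_profile_measurable [measurable]: "riesz_profile \<in> borel_measurable borel"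
  unfolding riesz_profile_def[abs_def] by measurable

text \<open>
  The radial part of the gradient of a Gaussian, weighted by the density of times.
\<close>

definition subordinator :: "real \<Rightarrow> 'a::euclidean_space \<Rightarrow> real" where
  "subordinator t w = time_weight t / t * heat t w"

lemma subordinator_measurable [measurable (raw)]:
  assumes [measurable]: "f \<in> borel_measurable M" "g \<in> borel_measurable M"
  shows "(\<lambda>x. subordinator (f x) (g x)) \<in> borel_measurable M"
  unfolding subordinator_def by measurable

lemma subordinator_nonneg: "t > 0 \<Longrightarrow> 0 \<le> subordinator t w"
  by (simp add: subordinator_def time_weight_def heat_nonneg)

text \<open>
  With \<open>\<rho> = |w|\<^sup>2 / 2\<close> the integrand is a constant times \<open>t\<^sup>-\<^sup>p\<^sup>-\<^sup>1 e\<^sup>-\<^sup>\<rho>\<^sup>/\<^sup>t\<close>, \<open>p = (n + 1) / 2\<close>, and the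
  substitution \<open>t = \<rho> / v\<close> turns it into the integrand of \<open>\<Gamma>(p)\<close>.
\<close>

lemma subordination:
  fixes w :: "'a::euclidean_space"
  assumes w: "w \<noteq> 0"
  shows "has_bochner_integral lborel (\<lambda>t. indicator {0<..} t * subordinator t w) (riesz_profile w)"
proof (rule has_bochner_integral_nn_integral)
  define p where "p = (real DIM('a) + 1) / 2"
  define \<rho> where "\<rho> = (norm w)\<^sup>2 / 2"
  have p: "p > 0" and \<rho>: "\<rho> > 0" using w by (simp_all add: p_def \<rho>_def)
  have sub: "subordinator t w = (2 * pi) powr (- p) * t powr (- p - 1) * exp (- \<rho> / t)" if t: "t > 0" for t
  proof -
    have "sqrt (2 * pi * t) * sqrt (2 * pi * t) ^ DIM('a) = sqrt (2 * pi * t) powr (real (Suc DIM('a)))"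
      using t by (simp add: powr_realpow[symmetric] powr_add)
    also have "\<dots> = (2 * pi * t) powr p"
      using t by (simp add: powr_half_sqrt[symmetric] powr_powr p_def add.commute)
    also have "\<dots> = (2 * pi) powr p * t powr p"
      using t by (simp add: powr_mult)
    finally have *: "sqrt (2 * pi * t) * sqrt (2 * pi * t) ^ DIM('a) = (2 * pi) powr p * t powr p" .
    have "subordinator t w = exp (- \<rho> / t) / (t * (sqrt (2 * pi * t) * sqrt (2 * pi * t) ^ DIM('a)))"
      by (simp add: subordinator_def time_weight_def heat_def \<rho>_def)
    also have "\<dots> = (2 * pi) powr (- p) * t powr (- p - 1) * exp (- \<rho> / t)"
      unfolding * using t by (simp add: powr_minus powr_diff field_simps)
    finally show ?thesis .
  qed
  have gam: "((\<lambda>v. v powr (p - 1) * exp (- v)) has_integral Gamma p) {0<..}"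
  proof -
    have "((\<lambda>v. v powr (p - 1) / exp v) has_integral Gamma p) {0..}"
      by (rule Gamma_integral_real[OF p])
    then have "((\<lambda>v. v powr (p - 1) / exp v) has_integral Gamma p) {0<..}"
      by (rule has_integral_spike_set_eq[THEN iffD1, rotated 2])
        (auto intro: negligible_subset[of "{0}"])
    then show ?thesis by (simp add: exp_minus divide_inverse)
  qed
  define c where "c = (2 * pi * \<rho>) powr (- p)"
  have gam': "((\<lambda>v. c * (v powr (p - 1) * exp (- v))) has_integral c * Gamma p) {0<..}"
    by (rule has_integral_mult_right[OF gam])
  have eq: "\<bar>- \<rho> / v\<^sup>2\<bar> * subordinator (\<rho> / v) w = c * (v powr (p - 1) * exp (- v))" if v: "v > 0" for v
  proof -
    have "subordinator (\<rho> / v) w = (2 * pi) powr (- p) * (\<rho> / v) powr (- p - 1) * exp (- v)"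
      using sub[of "\<rho> / v"] \<rho> v by simp
    moreover have "\<rho> / v\<^sup>2 * (\<rho> / v) powr (- p - 1) = \<rho> powr (- p) * v powr (p - 1)"
    proof -
      have "\<rho> / v\<^sup>2 * (\<rho> / v) powr (- p - 1) = \<rho> powr 1 / v powr 2 * (\<rho> powr (- p - 1) / v powr (- p - 1))"
        using \<rho> v by (simp add: powr_divide)
      also have "\<dots> = (\<rho> powr 1 * \<rho> powr (- p - 1)) / (v powr 2 * v powr (- p - 1))"
        by simp
      also have "\<dots> = \<rho> powr (- p) / v powr (1 - p)"
        by (simp only: powr_add[symmetric]) simp
      also have "\<dots> = \<rho> powr (- p) * v powr (p - 1)"
        using v powr_minus_divide[of v "1 - p"] by simp
      finally show ?thesis .
    qed
    ultimately show ?thesis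
      using \<rho> v by (simp add: c_def powr_mult mult_ac)
  qed
  have lhs: "(\<lambda>v. \<bar>- \<rho> / v\<^sup>2\<bar> * subordinator (\<rho> / v) w) absolutely_integrable_on {0<..} \<and>
      integral {0<..} (\<lambda>v. \<bar>- \<rho> / v\<^sup>2\<bar> * subordinator (\<rho> / v) w) = c * Gamma p"
  proof -
    have hi: "((\<lambda>v. \<bar>- \<rho> / v\<^sup>2\<bar> * subordinator (\<rho> / v) w) has_integral c * Gamma p) {0<..}"
      using gam' by (rule has_integral_eq[rotated]) (use eq in auto)
    moreover have "(\<lambda>v. \<bar>- \<rho> / v\<^sup>2\<bar> * subordinator (\<rho> / v) w) absolutely_integrable_on {0<..}"
      by (rule nonnegative_absolutely_integrable_1)
        (use hi \<rho> in \<open>auto simp: has_integral_iff intro!: divide_nonneg_nonneg mult_nonneg_nonneg subordinator_nonneg\<close>)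
    ultimately show ?thesis by (auto simp: has_integral_iff)
  qed
  have "(\<lambda>v. \<rho> / v) ` {0<..} = {0<..}"
  proof safe
    fix x :: real assume "x > 0"
    then show "x \<in> (\<lambda>v. \<rho> / v) ` {0<..}"
      using \<rho> by (intro image_eqI[of _ _ "\<rho> / x"]) auto
  qed (use \<rho> in auto)
  moreover have lebS: "{0<..} \<in> sets (lebesgue :: real measure)"
    by simp
  moreover have "((\<lambda>v. \<rho> / v) has_field_derivative - \<rho> / v\<^sup>2) (at v within {0<..})" if "v \<in> {0<..}" for v
    using that by (auto intro!: derivative_eq_intros simp: power2_eq_square)
  moreover have "inj_on (\<lambda>v. \<rho> / v) {0<..}"
    using \<rho> by (auto simp: inj_on_def)
  ultimately have "(\<lambda>t. subordinator t w) absolutely_integrable_on {0<..} \<and> integral {0<..} (\<lambda>t. subordinator t w) = c * Gamma p"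
    using lhs has_absolute_integral_change_of_variables_1'[of "{0<..}" "\<lambda>v. \<rho> / v" "\<lambda>v. - \<rho> / v\<^sup>2" "\<lambda>t. subordinator t w" "c * Gamma p"]
    by (simp only: lebS)
  then have "((\<lambda>t. subordinator t w) has_integral c * Gamma p) {0<..}"
    using absolutely_integrable_on_def has_integral_iff by blast
  moreover have "c * Gamma p = riesz_profile w"
  proof -
    have "(2 * pi * \<rho>) powr (- p) = 1 / (pi powr p * (norm w) ^ (DIM('a) + 1))"
    proof -
      have "(2 * pi * \<rho>) powr p = pi powr p * ((norm w)\<^sup>2) powr p"
        by (simp add: \<rho>_def powr_mult)
      also have "((norm w)\<^sup>2) powr p = (norm w) powr (2 * p)"
        using w by (simp add: powr_powr[symmetric])
      also have "\<dots> = norm w ^ (DIM('a) + 1)"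
      proof -
        have "2 * p = real (DIM('a) + 1)" by (simp add: p_def)
        then show ?thesis using w powr_realpow[of "norm w" "DIM('a) + 1"] by simp
      qed
      finally show ?thesis by (simp add: powr_minus_divide)
    qed
    then show ?thesis
      by (simp add: c_def riesz_profile_def riesz_normalization_def p_def)
  qed
  ultimately have "((\<lambda>t. subordinator t w) has_integral riesz_profile w) {0<..}" by simp
  from nn_integral_has_integral_lebesgue[OF _ this] subordinator_nonneg[of _ w]
  show "(\<integral>\<^sup>+t. ennreal (indicator {0<..} t * subordinator t w) \<partial>lborel) = ennreal (riesz_profile w)"
    by simp
qed (auto simp: riesz_profile_nonneg subordinator_nonneg indicator_def)

definition trunc_profile :: "real set \<Rightarrow> 'a::euclidean_space \<Rightarrow> real" where
  "trunc_profile S w = (LBINT t. indicator S t * subordinator t w)"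

lemma trunc_profile_measurable [measurable]:
  assumes [measurable]: "S \<in> sets borel"
  shows "trunc_profile S \<in> borel_measurable borel"
  unfolding trunc_profile_def[abs_def] by measurable

lemma trunc_profile_uminus [simp]: "trunc_profile S (- w) = trunc_profile S w"
  by (simp add: trunc_profile_def subordinator_def)

lemma trunc_profile_nonneg: "S \<subseteq> {0<..} \<Longrightarrow> 0 \<le> trunc_profile S w"
  unfolding trunc_profile_def using subordinator_nonneg
  by (intro Bochner_Integration.integral_nonneg) (auto simp: indicator_def)

lemma trunc_profile_le:
  assumes S [measurable]: "S \<in> sets borel" and sub: "S \<subseteq> {0<..}" and w: "w \<noteq> 0"
  shows "trunc_profile S w \<le> riesz_profile w"
proof -
  note sb = subordination[OF w, unfolded has_bochner_integral_iff]
  have "trunc_profile S w \<le> (LBINT t. indicator {0<..} t * subordinator t w)"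
    unfolding trunc_profile_def
  proof (rule integral_mono)
    show "integrable lborel (\<lambda>t. indicator S t * subordinator t w)"
      by (rule Bochner_Integration.integrable_bound[OF conjunct1[OF sb]]) (use sub in \<open>auto simp: indicator_def\<close>)
    show "integrable lborel (\<lambda>t. indicator {0<..} t * subordinator t w)" using sb by simp
    show "indicator S t * subordinator t w \<le> indicator {0<..} t * subordinator t w" for t
      using sub subordinator_nonneg[of t w] by (auto simp: indicator_def)
  qed
  then show ?thesis using sb by simp
qed

lemma trunc_profile_window:
  fixes w :: "'a::euclidean_space"
  assumes w: "w \<noteq> 0"
  shows "(\<lambda>k. trunc_profile (window k) w) \<longlonglongrightarrow> riesz_profile w"
proof -
  note sb = subordination[OF w, unfolded has_bochner_integral_iff]
  have "(\<lambda>k. \<integral>t. indicator (window k) t * subordinator t w \<partial>lborel) \<longlonglongrightarrow> (LBINT t. indicator {0<..} t * subordinator t w)"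
  proof (rule integral_dominated_convergence)
    show "integrable lborel (\<lambda>t. indicator {0<..} t * subordinator t w)" using sb by simp
    show "AE t in lborel. norm (indicator (window k) t * subordinator t w) \<le> indicator {0<..} t * subordinator t w" for k
      using window_props(4)[of k] subordinator_nonneg[of _ w] by (intro AE_I2) (auto simp: indicator_def)
    show "AE t in lborel. (\<lambda>k. indicator (window k) t * subordinator t w) \<longlonglongrightarrow> indicator {0<..} t * subordinator t w"
    proof (rule AE_I2, rule tendsto_eventually)
      fix t :: real
      show "\<forall>\<^sub>F k in sequentially. indicator (window k) t * subordinator t w = indicator {0<..} t * subordinator t w"
        using eventually_indicator_window[of t] by eventually_elim simp
    qed
  qed (use window_props(1) in measurable)
  then show ?thesis using sb by (simp add: trunc_profile_def)
qed

lemma nn_integral_time_weight_small: "(\<integral>\<^sup>+t. ennreal (indicator {0<..1} t * time_weight t) \<partial>lborel) < \<infinity>"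
proof -
  \<comment> \<open>The integrand of the beta integral majorizes \<open>t\<^sup>-\<^sup>1\<^sup>/\<^sup>2\<close> on the unit interval.\<close>
  have "(\<integral>\<^sup>+t. ennreal (indicator {0<..1} t * time_weight t) \<partial>lborel) \<le> (\<integral>\<^sup>+v. ennreal (indicator {0<..<1} v * (1 / (sqrt v * sqrt (1 - v)))) \<partial>lborel)"
  proof (rule nn_integral_mono_AE)
    show "AE t in lborel. ennreal (indicator {0<..1} t * time_weight t) \<le> ennreal (indicator {0<..<1} t * (1 / (sqrt t * sqrt (1 - t))))"
      using AE_lborel_singleton[of "1::real"]
    proof eventually_elim
      case (elim t)
      show ?case
      proof (cases "0 < t \<and> t < 1")
        case True
        have "1 \<le> sqrt (2 * pi)" using pi_gt3 by simp
        moreover have "sqrt (1 - t) \<le> 1" using True by simp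
        ultimately have "sqrt t * sqrt (1 - t) \<le> sqrt t * sqrt (2 * pi)"
          using True by (intro mult_left_mono) auto
        then have "1 / sqrt (2 * pi * t) \<le> 1 / (sqrt t * sqrt (1 - t))"
          using True by (intro divide_left_mono) (auto simp: real_sqrt_mult mult_ac)
        then show ?thesis using True by (simp add: time_weight_def)
      next
        case False
        with elim have "t \<notin> {0<..1}" by auto
        then show ?thesis by simp
      qed
    qed
  qed
  also have "\<dots> < \<infinity>" by (simp only: nn_integral_beta_half) simp
  finally show ?thesis .
qed

lemma nn_integral_time_weight_large: "(\<integral>\<^sup>+t. ennreal (indicator {1..} t * (time_weight t / t)) \<partial>lborel) < \<infinity>"
proof -
  have "(\<integral>\<^sup>+t. ennreal (indicator {1..} t * (time_weight t / t)) \<partial>lborel) \<le> (\<integral>\<^sup>+t. ennreal (t powr (- 3 / 2)) * indicator {1..} t \<partial>lborel)"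
  proof (rule nn_integral_mono)
    fix t :: real
    show "ennreal (indicator {1..} t * (time_weight t / t)) \<le> ennreal (t powr (- 3 / 2)) * indicator {1..} t"
    proof (cases "t \<ge> 1")
      case True
      have "1 \<le> sqrt (2 * pi)" using pi_gt3 by simp
      then have "1 * (sqrt t * t) \<le> sqrt (2 * pi) * (sqrt t * t)" using True by (intro mult_right_mono) auto
      then have "time_weight t / t \<le> 1 / (sqrt t * t)"
        using True by (simp add: time_weight_def real_sqrt_mult) (intro divide_left_mono, auto simp: mult_ac)
      also have "\<dots> = t powr (- 3 / 2)"
      proof -
        have "sqrt t * t = t powr (1 / 2) * t powr 1" using True by (simp add: powr_half_sqrt)
        also have "\<dots> = t powr (3 / 2)" by (simp only: powr_add[symmetric]) simp
        finally show ?thesis using powr_minus_divide[of t "3 / 2"] by simp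
      qed
      finally show ?thesis using True by (simp add: ennreal_leI)
    qed simp
  qed
  also have "\<dots> = ennreal (0 - (- 2 * 1 powr (- 1 / 2)))"
  proof (rule nn_integral_FTC_atLeast[where F="\<lambda>t. - 2 * t powr (- 1 / 2)"])
    show "((\<lambda>t::real. - 2 * t powr (- 1 / 2)) \<longlongrightarrow> 0) at_top"
      by real_asymp
    fix x :: real assume "1 \<le> x"
    then show "((\<lambda>t. - 2 * t powr (- 1 / 2)) has_real_derivative x powr (- 3 / 2)) (at x)"
      by (auto intro!: derivative_eq_intros)
  qed auto
  also have "\<dots> < \<infinity>" by simp
  finally show ?thesis .
qed

lemma unit_ball_measurable [measurable]: "ball (0::'a::euclidean_space) 1 \<in> sets borel"
  by (rule borel_open) simp

text \<open>
  The function is a multiple of \<open>|w|\<^sup>1\<^sup>-\<^sup>n\<close>. Instead of polar coordinates, the proof uses the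
  representation by Gaussians and Tonelli's theorem: for \<open>t \<le> 1\<close> the second moment of \<open>G\<^sub>t\<close> over the
  whole space, \<open>n t\<close>, compensates the factor \<open>1 / t\<close>; for \<open>t \<ge> 1\<close> the weight is integrable and the
  Gaussians are uniformly bounded on the ball.
\<close>

lemma riesz_profile_locally_integrable:
  "integrable lborel (\<lambda>w::'a::euclidean_space. indicator (ball 0 1) w * ((norm w)\<^sup>2 * riesz_profile w))"
proof (rule integrableI_bounded)
  have "(\<integral>\<^sup>+w. ennreal (norm (indicator (ball 0 1) w * ((norm w)\<^sup>2 * riesz_profile w))) \<partial>(lborel :: 'a measure))
     = (\<integral>\<^sup>+w. (\<integral>\<^sup>+t. ennreal (indicator (ball 0 1) (w::'a) * (norm w)\<^sup>2 * (indicator {0<..} t * subordinator t w)) \<partial>lborel) \<partial>lborel)"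
  proof (rule nn_integral_cong_AE)
    show "AE w in lborel. ennreal (norm (indicator (ball 0 1) (w::'a) * ((norm w)\<^sup>2 * riesz_profile w)))
       = (\<integral>\<^sup>+t. ennreal (indicator (ball 0 1) w * (norm w)\<^sup>2 * (indicator {0<..} t * subordinator t w)) \<partial>lborel)"
      using AE_lborel_singleton[of "0::'a"]
    proof eventually_elim
      case (elim w)
      have "(\<integral>\<^sup>+t. ennreal (indicator {0<..} t * subordinator t w) \<partial>lborel) = ennreal (riesz_profile w)"
        using subordination[OF elim] subordinator_nonneg[of _ w]
        by (subst nn_integral_eq_integral) (auto simp: has_bochner_integral_iff indicator_def intro!: AE_I2)
      then show ?case
        using riesz_profile_nonneg[of w]
        by (simp add: ennreal_mult' abs_mult nn_integral_cmult mult.assoc)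
    qed
  qed
  also have "\<dots> = (\<integral>\<^sup>+t. (\<integral>\<^sup>+w. ennreal (indicator (ball 0 1) (w::'a) * (norm w)\<^sup>2 * (indicator {0<..} t * subordinator t w)) \<partial>lborel) \<partial>lborel)"
    by (rule lborel_pair.Fubini') measurable
  also have "\<dots> \<le> (\<integral>\<^sup>+t. ennreal (real DIM('a)) * ennreal (indicator {0<..1} t * time_weight t)
       + ennreal (heat_peak TYPE('a) 1 * measure lborel (ball (0::'a) 1)) * ennreal (indicator {1..} t * (time_weight t / t)) \<partial>lborel)"
  proof (rule nn_integral_mono)
    fix t :: real
    let ?A = "ennreal (real DIM('a)) * ennreal (indicator {0<..1} t * time_weight t)"
    let ?B = "ennreal (heat_peak TYPE('a) 1 * measure lborel (ball (0::'a) 1)) * ennreal (indicator {1..} t * (time_weight t / t))"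
    let ?I = "(\<integral>\<^sup>+w. ennreal (indicator (ball 0 1) (w::'a) * (norm w)\<^sup>2 * (indicator {0<..} t * subordinator t w)) \<partial>lborel)"
    consider "t \<le> 0" | "0 < t" "t \<le> 1" | "1 < t" by linarith
    then show "?I \<le> ?A + ?B"
    proof cases
      case 1 then show ?thesis by simp
    next
      case 2
      have "?I \<le> (\<integral>\<^sup>+w. ennreal (time_weight t / t * ((norm (w::'a))\<^sup>2 * heat t w)) \<partial>lborel)"
        using 2 heat_nonneg[of t]
        by (intro nn_integral_mono ennreal_leI) (auto simp: indicator_def subordinator_def time_weight_def intro!: divide_nonneg_nonneg mult_nonneg_nonneg)
      also have "\<dots> = ennreal (time_weight t / t * (real DIM('a) * t))"
        using has_bochner_integral_mult_right[OF heat_norm_moment[OF 2(1), where 'a='a], of "time_weight t / t"] heat_nonneg[OF 2(1)] 2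
        by (subst nn_integral_eq_integral) (auto simp: has_bochner_integral_iff time_weight_def intro!: AE_I2 divide_nonneg_nonneg mult_nonneg_nonneg)
      also have "\<dots> = ?A"
        using 2 by (simp add: ennreal_mult'[symmetric] mult.commute[of "real DIM('a)"] ennreal_mult'' time_weight_def)
      finally show ?thesis by (rule order_trans) simp
    next
      case 3
      have "?I \<le> (\<integral>\<^sup>+w. ennreal (time_weight t / t * heat_peak TYPE('a) 1) * indicator (ball (0::'a) 1) w \<partial>lborel)"
      proof (rule nn_integral_mono)
        fix w :: 'a
        show "ennreal (indicator (ball 0 1) w * (norm w)\<^sup>2 * (indicator {0<..} t * subordinator t w)) \<le> ennreal (time_weight t / t * heat_peak TYPE('a) 1) * indicator (ball 0 1) w"
        proof (cases "norm w < 1")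
          case True
          have "(norm w)\<^sup>2 \<le> 1" using True by (simp add: power_le_one)
          then have "(norm w)\<^sup>2 * subordinator t w \<le> 1 * (time_weight t / t * heat_peak TYPE('a) 1)"
            unfolding subordinator_def using 3 heat_le_peak[of 1 t w] heat_nonneg[of t w]
            by (intro mult_mono mult_left_mono) (auto simp: time_weight_def)
          then show ?thesis using True 3 by (simp add: ennreal_leI)
        qed simp
      qed
      also have "\<dots> = ennreal (time_weight t / t * heat_peak TYPE('a) 1) * emeasure lborel (ball (0::'a) 1)"
        by (simp add: nn_integral_cmult)
      also have "\<dots> = ?B"
      proof -
        have "emeasure lborel (ball (0::'a) 1) = ennreal (measure lborel (ball (0::'a) 1))"
          using emeasure_lborel_ball_finite[of "0::'a" 1] by (intro emeasure_eq_ennreal_measure) simp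
        then show ?thesis
          using 3 heat_peak_pos[of 1, where 'a='a]
          by (simp add: ennreal_mult'[symmetric] ennreal_mult''[symmetric] time_weight_def mult_ac)
      qed
      finally show ?thesis by (rule order_trans) simp
    qed
  qed
  also have "\<dots> < \<infinity>"
    using nn_integral_time_weight_small nn_integral_time_weight_large
    by (subst nn_integral_add) (auto simp: nn_integral_cmult ennreal_mult_less_top)
  finally show "(\<integral>\<^sup>+w. ennreal (norm (indicator (ball 0 1) w * ((norm w)\<^sup>2 * riesz_profile w))) \<partial>(lborel :: 'a measure)) < \<infinity>" .
qed measurable

section \<open>Truncated kernels and pointwise convergence\<close>

definition trunc_kernel :: "'a::euclidean_space \<Rightarrow> real set \<Rightarrow> 'a \<Rightarrow> real" where
  "trunc_kernel b S w = (w \<bullet> b) * trunc_profile S w"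

lemma trunc_kernel_uminus [simp]: "trunc_kernel b S (- w) = - trunc_kernel b S w"
  by (simp add: trunc_kernel_def)

lemma trunc_kernel_eq: "trunc_kernel b S w = (LBINT t. (indicator S t * time_weight t) * heat_grad b t w)"
  unfolding trunc_kernel_def trunc_profile_def integral_mult_right_zero[symmetric]
  by (intro Bochner_Integration.integral_cong) (simp_all add: subordinator_def heat_grad_def mult_ac)

context
  fixes S :: "real set" and a c :: real and b :: "'a::euclidean_space"
  assumes S: "S \<in> sets borel" and S_sub: "S \<subseteq> {a..c}" and a: "0 < a" and b: "b \<in> Basis"
begin

lemma weighted_grad_bound:
  "\<bar>(indicator S t * time_weight t) * heat_grad b t w\<bar> \<le> (indicator S t * time_weight t) * grad_peak TYPE('a) a"
proof (cases "t \<in> S")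
  case True
  then have "a \<le> t" using S_sub by auto
  with a True heat_grad_bound[OF b a this, of w] show ?thesis
    by (simp add: abs_mult time_weight_def mult_left_mono divide_right_mono)
qed simp

lemma trunc_weight_integrable: "integrable lborel (\<lambda>t. (indicator S t * time_weight t) * C)"
  by (rule time_weight_integrable[OF S S_sub a]) simp

lemma weighted_grad_time_integrable: "integrable lborel (\<lambda>t. indicator S t * time_weight t * heat_grad b t w)"
  supply [measurable] = S
  by (rule integrable_dominated[OF trunc_weight_integrable]) (measurable, unfold real_norm_def, rule weighted_grad_bound)

lemma trunc_kernel_bound:
  "\<bar>trunc_kernel b S w\<bar> \<le> (LBINT t. (indicator S t * time_weight t) * grad_peak TYPE('a) a)"
  unfolding trunc_kernel_eq
  by (rule integral_abs_bound_integral[OF weighted_grad_time_integrable trunc_weight_integrable weighted_grad_bound])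

lemma weighted_grad_integrable:
  "integrable lborel2 (\<lambda>(t, w). (indicator S t * time_weight t) * heat_grad b t w)"
  supply [measurable] = S
proof (rule lborel_pair.Fubini_integrable)
  let ?w = "\<lambda>t. indicator S t * time_weight t"
  have pos: "t > 0" if "t \<in> S" for t using that S_sub a by auto
  have "integrable lborel (\<lambda>w. ?w t * heat_grad b t w)" for t
    using heat_grad_L1(1)[OF b, of t] pos[of t] by (cases "t \<in> S") auto
  then show "AE t in lborel. integrable lborel (\<lambda>w. case (t, w) of (t, w) \<Rightarrow> ?w t * heat_grad b t w)"
    by simp
  have "integrable lborel (\<lambda>t. LBINT w. norm (?w t * heat_grad b t w))"
  proof (rule integrable_dominated)
    show "integrable lborel (\<lambda>t. ?w t * ((1 + t) / t))"
      by (rule time_weight_integrable[OF S S_sub a]) (use a in \<open>auto intro!: continuous_intros\<close>)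
    show "norm (LBINT w. norm (?w t * heat_grad b t w)) \<le> ?w t * ((1 + t) / t)" for t
    proof (cases "t \<in> S")
      case True
      have "time_weight t * (LBINT w. \<bar>heat_grad b t w\<bar>) \<le> time_weight t * ((1 + t) / t)"
        using pos[OF True] by (intro mult_left_mono heat_grad_L1(2)[OF b]) (auto simp: time_weight_def)
      with True pos[OF True] show ?thesis
        by (simp add: abs_mult time_weight_def)
    qed simp
  qed measurable
  then show "integrable lborel (\<lambda>t. LBINT w. norm (case (t, w) of (t, w) \<Rightarrow> ?w t * heat_grad b t w))"
    by simp
qed measurable

lemma trunc_kernel_integrable: "integrable lborel (trunc_kernel b S)"
  using lborel_pair.integrable_snd[OF weighted_grad_integrable] by (simp add: trunc_kernel_eq[abs_def])

lemma trunc_riesz_eq_conv: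
  assumes f: "integrable lborel f"
  shows "trunc_riesz b S f x = conv (trunc_kernel b S) f x"
proof -
  have [measurable]: "f \<in> borel_measurable borel" "S \<in> sets borel" using f S by auto
  let ?w = "\<lambda>t. indicator S t * time_weight t"
  have "integrable lborel2 (\<lambda>(t, y). (?w t * heat_grad b t (x - y)) *\<^sub>R f y)"
  proof (rule integrable_pair_dominated[OF sigma_finite_lborel2 trunc_weight_integrable integrable_norm[OF f]])
    show "norm ((?w t * heat_grad b t (x - y)) *\<^sub>R f y) \<le> (?w t * grad_peak TYPE('a) a) * cmod (f y)" for t y
      unfolding norm_scaleR by (intro mult_right_mono weighted_grad_bound) simp
  qed measurable
  from lborel_pair.Fubini_integral[OF this]
  have "(LBINT y. (LBINT t. (?w t * heat_grad b t (x - y)) *\<^sub>R f y)) = (LBINT t. (LBINT y. (?w t * heat_grad b t (x - y)) *\<^sub>R f y))"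
    by simp
  moreover have "(LBINT t. (?w t * heat_grad b t (x - y)) *\<^sub>R f y) = trunc_kernel b S (x - y) *\<^sub>R f y" for y
    unfolding trunc_kernel_eq
    by (rule integral_scaleR_left)
      (rule weighted_grad_time_integrable)
  moreover have "(LBINT y. (?w t * heat_grad b t (x - y)) *\<^sub>R f y) = ?w t *\<^sub>R conv (heat_grad b t) f x" for t
    by (simp only: conv_def integral_scaleR_right[symmetric] scaleR_scaleR)
  ultimately show ?thesis
    by (simp add: trunc_riesz_def conv_def)
qed

end

text \<open>
  Fubini's theorem, exchanging the roles of \<open>x\<close> and \<open>y\<close>.
\<close>

lemma conv_odd_antisym:
  fixes k :: "'a::euclidean_space \<Rightarrow> real"
  assumes k: "integrable lborel k" "\<And>w. \<bar>k w\<bar> \<le> C" and odd: "\<And>w. k (- w) = - k w"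
    and f: "integrable lborel f" and g: "integrable lborel g"
  shows "(LBINT x. conv k f x \<bullet> g x) = - (LBINT x. f x \<bullet> conv k g x)"
proof -
  have [measurable]: "f \<in> borel_measurable borel" "g \<in> borel_measurable borel" "k \<in> borel_measurable borel"
    using f g k by auto
  have int: "integrable lborel2 (\<lambda>(y, x). k (x - y) * (f y \<bullet> g x))"
  proof (rule integrable_pair_dominated[OF sigma_finite_lborel2])
    show "integrable lborel (\<lambda>y. C * cmod (f y))" "integrable lborel (\<lambda>x. cmod (g x))"
      using f g by auto
    show "norm (k (x - y) * (f y \<bullet> g x)) \<le> C * cmod (f y) * cmod (g x)" for x y
      using inner_mult_bound[OF k(2)[of "x - y"], of "f y" "g x"] by (simp add: mult_ac)
  qed measurable
  have "(LBINT x. conv k f x \<bullet> g x) = (LBINT x. (LBINT y. k (x - y) * (f y \<bullet> g x)))"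
    using conv_integrand_integrable[OF k f] by (simp add: conv_def integral_inner_left[symmetric] del: integral_inner_left)
  also have "\<dots> = (LBINT y. (LBINT x. k (x - y) * (f y \<bullet> g x)))"
    by (rule lborel_pair.Fubini_integral[OF int])
  also have "\<dots> = (LBINT y. - (f y \<bullet> conv k g y))"
  proof (rule Bochner_Integration.integral_cong[OF refl])
    fix y
    have "f y \<bullet> conv k g y = (LBINT x. f y \<bullet> (k (y - x) *\<^sub>R g x))"
      unfolding conv_def by (rule integral_inner_right[symmetric]) (rule conv_integrand_integrable[OF k g])
    also have "\<dots> = (LBINT x. - (k (x - y) * (f y \<bullet> g x)))"
      using odd[of "x - y" for x] by (intro Bochner_Integration.integral_cong) simp_all
    finally show "(LBINT x. k (x - y) * (f y \<bullet> g x)) = - (f y \<bullet> conv k g y)"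
      by simp
  qed
  finally show ?thesis by simp
qed

text \<open>
  Because the kernels are odd, subtracting the constant \<open>f x\<close> on the unit ball does not change the
  integrals against truncated kernels, whereas it makes the integral against the Riesz kernel itself
  absolutely convergent for Lipschitz \<open>f\<close>. With this subtraction the principal value becomes an
  ordinary integral, and both ways of truncating, in time and in space, are handled by dominated
  convergence.
\<close>

abbreviation recentred :: "('a::euclidean_space \<Rightarrow> complex) \<Rightarrow> 'a \<Rightarrow> 'a \<Rightarrow> complex" where
  "recentred f x w \<equiv> f (x - w) - indicator (ball 0 1) w *\<^sub>R f x"

definition riesz :: "'a::euclidean_space \<Rightarrow> ('a \<Rightarrow> complex) \<Rightarrow> 'a \<Rightarrow> complex" where
  "riesz b f x = (LBINT w. ((w \<bullet> b) * riesz_profile w) *\<^sub>R recentred f x w)"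

context lipschitz_L1
begin

definition riesz_dominator :: "'a \<Rightarrow> 'a \<Rightarrow> real" where
  "riesz_dominator x w = L * (indicator (ball 0 1) w * ((norm w)\<^sup>2 * riesz_profile w))
     + riesz_normalization DIM('a) * cmod (f (x - w))"

lemma riesz_dominator_bound:
  fixes b w x :: 'a and p :: real
  assumes b: "b \<in> Basis" and p: "0 \<le> p" "w \<noteq> 0 \<Longrightarrow> p \<le> riesz_profile w"
  shows "cmod (((w \<bullet> b) * p) *\<^sub>R recentred f x w) \<le> riesz_dominator x w"
proof (cases "w = 0")
  case True
  then show ?thesis
    using riesz_normalization_pos[of "DIM('a)"] by (simp add: riesz_dominator_def)
next
  case False
  have n: "0 < riesz_normalization DIM('a)" by (rule riesz_normalization_pos)
  have "\<bar>w \<bullet> b\<bar> \<le> norm w" using b by (rule Basis_le_norm)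
  then have k: "\<bar>(w \<bullet> b) * p\<bar> \<le> norm w * riesz_profile w"
    unfolding abs_mult using p False by (intro mult_mono) auto
  show ?thesis
  proof (cases "norm w < 1")
    case True
    have "cmod (f (x - w) - f x) \<le> L * norm w" using lip[of "x - w" x] by simp
    then have "\<bar>(w \<bullet> b) * p\<bar> * cmod (f (x - w) - f x) \<le> (norm w * riesz_profile w) * (L * norm w)"
      using k by (intro mult_mono) (auto intro: mult_nonneg_nonneg riesz_profile_nonneg)
    then show ?thesis
      using True n by (simp add: riesz_dominator_def power2_eq_square mult_ac add_increasing2)
  next
    case out: False
    have "norm w * riesz_profile w = riesz_normalization DIM('a) / norm w ^ DIM('a)"
      using False by (simp add: riesz_profile_def)
    also have "\<dots> \<le> riesz_normalization DIM('a)"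
      using out n one_le_power[of "norm w" "DIM('a)"] by (simp add: divide_le_eq)
    finally have "\<bar>(w \<bullet> b) * p\<bar> * cmod (f (x - w)) \<le> riesz_normalization DIM('a) * cmod (f (x - w))"
      using k by (intro mult_right_mono) auto
    then show ?thesis
      using out by (simp add: riesz_dominator_def)
  qed
qed

lemma riesz_dominator_integrable: "integrable lborel (riesz_dominator x)"
  unfolding riesz_dominator_def[abs_def]
  using riesz_profile_locally_integrable[where 'a='a] integrable_norm[OF integrable_lborel_reflect[OF int, of x]] by simp

lemma riesz_dominator_integral: "(LBINT w. riesz_dominator x w) = (LBINT w. riesz_dominator 0 w)"
proof -
  have "(LBINT w. cmod (f (x - w))) = (LBINT y. cmod (f y))" for x
    by (rule integral_lborel_reflect[of "\<lambda>y. cmod (f y)"]) simp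
  note this[of x] this[of 0]
  then show ?thesis
    unfolding riesz_dominator_def
    using riesz_profile_locally_integrable[where 'a='a]
      integrable_norm[OF integrable_lborel_reflect[OF int, of x]] integrable_norm[OF integrable_lborel_reflect[OF int, of 0]]
    by (simp add: Bochner_Integration.integral_add)
qed

lemma odd_kernel_subtract:
  fixes k :: "'a \<Rightarrow> real"
  assumes k: "k \<in> borel_measurable borel" "\<And>w. k (- w) = - k w"
    and i1: "integrable lborel (\<lambda>w. indicator (ball 0 1) w * k w)"
    and i2: "integrable lborel (\<lambda>w. k w *\<^sub>R f (x - w))"
  shows "(LBINT w. k w *\<^sub>R f (x - w)) = (LBINT w. k w *\<^sub>R recentred f x w)"
proof -
  have [measurable]: "k \<in> borel_measurable borel" by fact
  have z: "(LBINT w. indicator (ball 0 1) w * k w) = 0"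
    by (rule integral_odd_eq_0) (use k(2) in \<open>auto simp: indicator_def\<close>)
  have "(LBINT w. k w *\<^sub>R recentred f x w)
      = (LBINT w. k w *\<^sub>R f (x - w) - (indicator (ball 0 1) w * k w) *\<^sub>R f x)"
    by (intro Bochner_Integration.integral_cong) (simp_all add: scaleR_diff_right mult.commute)
  also have "\<dots> = (LBINT w. k w *\<^sub>R f (x - w)) - (LBINT w. indicator (ball 0 1) w * k w) *\<^sub>R f x"
    using i1 i2 by (subst Bochner_Integration.integral_diff) auto
  finally show ?thesis using z by simp
qed

lemma trunc_riesz_eq:
  assumes S: "S \<in> sets borel" "S \<subseteq> {a..c}" "0 < a" and b: "b \<in> Basis"
  shows "trunc_riesz b S f x = (LBINT w. trunc_kernel b S w *\<^sub>R recentred f x w)"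
proof -
  note k = trunc_kernel_integrable[OF S b] trunc_kernel_bound[OF S b]
  have [measurable]: "trunc_kernel b S \<in> borel_measurable borel" using k(1) by auto
  have "trunc_riesz b S f x = (LBINT w. trunc_kernel b S w *\<^sub>R f (x - w))"
    by (simp add: trunc_riesz_eq_conv[OF S b int] conv_reflect)
  also have "\<dots> = (LBINT w. trunc_kernel b S w *\<^sub>R recentred f x w)"
  proof (rule odd_kernel_subtract)
    show "integrable lborel (\<lambda>w. indicator (ball 0 1) w * trunc_kernel b S w)"
      using integrable_real_mult_indicator[OF _ k(1), of "ball 0 1"] by (simp add: mult.commute)
    show "integrable lborel (\<lambda>w. trunc_kernel b S w *\<^sub>R f (x - w))"
      using integrable_lborel_reflect[OF conv_integrand_integrable[OF k int], of x x] by simp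
  qed simp_all
  finally show ?thesis .
qed

lemma trunc_riesz_bound:
  assumes S: "S \<in> sets borel" "S \<subseteq> {a..c}" "0 < a" and b: "b \<in> Basis"
  shows "cmod (trunc_riesz b S f x) \<le> (LBINT w. riesz_dominator 0 w)"
proof -
  have [measurable]: "trunc_kernel b S \<in> borel_measurable borel"
    using trunc_kernel_integrable[OF S b] by auto
  have pos: "S \<subseteq> {0<..}" using S by auto
  have le: "cmod (trunc_kernel b S w *\<^sub>R recentred f x w) \<le> riesz_dominator x w" for w
    unfolding trunc_kernel_def
    by (rule riesz_dominator_bound[OF b trunc_profile_nonneg[OF pos] trunc_profile_le[OF S(1) pos]])
  have "cmod (trunc_riesz b S f x) \<le> (LBINT w. riesz_dominator x w)"
    unfolding trunc_riesz_eq[OF S b]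
  proof (rule order_trans[OF integral_norm_bound integral_mono[OF _ riesz_dominator_integrable le]])
    show "integrable lborel (\<lambda>w. cmod (trunc_kernel b S w *\<^sub>R recentred f x w))"
      by (rule integrable_dominated[OF riesz_dominator_integrable]) (use le in auto)
  qed
  then show ?thesis by (simp only: riesz_dominator_integral[of x])
qed

lemma trunc_riesz_tendsto:
  assumes b: "b \<in> Basis"
  shows "(\<lambda>k. trunc_riesz b (window k) f x) \<longlonglongrightarrow> riesz b f x"
  unfolding trunc_riesz_eq[OF window_props(1-3) b] riesz_def
proof (rule integral_dominated_convergence[OF _ _ riesz_dominator_integrable])
  show "AE w in lborel. (\<lambda>k. trunc_kernel b (window k) w *\<^sub>R recentred f x w)
      \<longlonglongrightarrow> ((w \<bullet> b) * riesz_profile w) *\<^sub>R recentred f x w"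
    using AE_lborel_singleton[of 0]
    by eventually_elim (auto simp: trunc_kernel_def intro!: tendsto_intros trunc_profile_window)
  show "AE w in lborel. cmod (trunc_kernel b (window k) w *\<^sub>R recentred f x w) \<le> riesz_dominator x w" for k
    unfolding trunc_kernel_def
    by (intro AE_I2 riesz_dominator_bound[OF b trunc_profile_nonneg trunc_profile_le] window_props)
  show "(\<lambda>w. trunc_kernel b (window k) w *\<^sub>R recentred f x w) \<in> borel_measurable lborel" for k
  proof -
    have [measurable]: "trunc_kernel b (window k) \<in> borel_measurable borel"
      using trunc_kernel_integrable[OF window_props(1-3) b, of k] by auto
    show ?thesis by measurable
  qed
  show "(\<lambda>w. ((w \<bullet> b) * riesz_profile w) *\<^sub>R recentred f x w) \<in> borel_measurable lborel"
    by measurable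
qed

lemma riesz_measurable:
  assumes b: "b \<in> Basis"
  shows "riesz b f \<in> borel_measurable borel"
proof (rule borel_measurable_LIMSEQ_metric)
  show "trunc_riesz b (window k) f \<in> borel_measurable borel" for k
    using trunc_riesz_energy(1)[OF int window_props(1-3) b, of k] by (simp add: square_integrable_def)
  show "(\<lambda>k. trunc_riesz b (window k) f x) \<longlonglongrightarrow> riesz b f x" for x
    by (rule trunc_riesz_tendsto[OF b])
qed

lemma riesz_principal_value:
  assumes b: "b \<in> Basis"
  shows "((\<lambda>\<epsilon>. riesz_normalization DIM('a) *\<^sub>R (LBINT y. (indicator {y. \<epsilon> \<le> norm (x - y)} y * (((x - y) \<bullet> b) / norm (x - y) ^ (DIM('a) + 1))) *\<^sub>R f y))
    \<longlongrightarrow> riesz b f x) (at_right 0)"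
proof -
  let ?k = "\<lambda>w. (w \<bullet> b) * riesz_profile w"
  have eq: "riesz_normalization DIM('a) *\<^sub>R (LBINT y. (indicator {y. \<epsilon> \<le> norm (x - y)} y * (((x - y) \<bullet> b) / norm (x - y) ^ (DIM('a) + 1))) *\<^sub>R f y)
     = (LBINT w. (indicator {w. \<epsilon> \<le> norm w} w * ?k w) *\<^sub>R recentred f x w)" if \<epsilon>: "0 < \<epsilon>" for \<epsilon>
  proof -
    let ?K = "\<lambda>w. indicator {w. \<epsilon> \<le> norm w} w * ?k w"
    let ?B = "riesz_normalization DIM('a) / \<epsilon> ^ DIM('a)"
    have Kb: "\<bar>?K w\<bar> \<le> ?B" for w :: 'a
    proof (cases "\<epsilon> \<le> norm w")
      case True
      then have w: "norm w > 0" using \<epsilon> by linarith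
      have "\<bar>?K w\<bar> \<le> norm w * riesz_profile w"
        using True Basis_le_norm[OF b, of w] riesz_profile_nonneg[of w] by (simp add: abs_mult mult_right_mono)
      also have "\<dots> = riesz_normalization DIM('a) / norm w ^ DIM('a)"
        using w by (simp add: riesz_profile_def)
      also have "\<dots> \<le> riesz_normalization DIM('a) / \<epsilon> ^ DIM('a)"
        using True \<epsilon> w riesz_normalization_pos[of "DIM('a)"] by (intro divide_left_mono power_mono mult_pos_pos zero_less_power) auto
      finally show ?thesis .
    qed (use \<epsilon> riesz_normalization_pos[of "DIM('a)"] in simp)
    have "riesz_normalization DIM('a) *\<^sub>R (LBINT y. (indicator {y. \<epsilon> \<le> norm (x - y)} y * (((x - y) \<bullet> b) / norm (x - y) ^ (DIM('a) + 1))) *\<^sub>R f y)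
       = (LBINT y. ?K (x - y) *\<^sub>R f y)"
      unfolding integral_scaleR_right[symmetric]
      by (intro Bochner_Integration.integral_cong) (simp_all add: riesz_profile_def indicator_def)
    also have "\<dots> = (LBINT w. ?K w *\<^sub>R f (x - w))"
      using integral_lborel_reflect[of "\<lambda>w. ?K w *\<^sub>R f (x - w)" x] by simp
    also have "\<dots> = (LBINT w. ?K w *\<^sub>R recentred f x w)"
    proof (rule odd_kernel_subtract)
      show "integrable lborel (\<lambda>w. indicator (ball 0 1) w * ?K w)"
      proof (rule integrable_dominated)
        show "integrable lborel (\<lambda>w::'a. indicator (ball 0 1) w * ?B)"
          using emeasure_lborel_ball_finite[of "0::'a" 1] by (intro integrable_mult_left integrable_real_indicator) auto
        show "norm (indicator (ball 0 1) w * ?K w) \<le> indicator (ball 0 1) w * ?B" for w :: 'a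
          using Kb[of w] by (cases "norm w < 1") simp_all
      qed measurable
      show "integrable lborel (\<lambda>w. ?K w *\<^sub>R f (x - w))"
      proof (rule integrable_dominated)
        show "integrable lborel (\<lambda>w. ?B * cmod (f (x - w)))"
          using integrable_norm[OF integrable_lborel_reflect[OF int, of x]] by simp
        show "norm (?K w *\<^sub>R f (x - w)) \<le> ?B * cmod (f (x - w))" for w
          unfolding norm_scaleR by (intro mult_right_mono Kb) simp
      qed measurable
    qed (auto simp: riesz_profile_def indicator_def)
    finally show ?thesis .
  qed
  have "((\<lambda>\<epsilon>. \<integral>w. (indicator {w. \<epsilon> \<le> norm w} w * ?k w) *\<^sub>R recentred f x w \<partial>lborel) \<longlongrightarrow> riesz b f x) (at_right 0)"
    unfolding tendsto_at_iff_sequentially comp_def riesz_def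
  proof (intro allI impI)
    fix X :: "nat \<Rightarrow> real"
    assume X: "\<forall>i. X i \<in> {0<..} - {0}" "X \<longlonglongrightarrow> 0"
    show "(\<lambda>i. \<integral>w. (indicator {w. X i \<le> norm w} w * ?k w) *\<^sub>R recentred f x w \<partial>lborel)
      \<longlonglongrightarrow> (LBINT w. ?k w *\<^sub>R recentred f x w)"
    proof (rule integral_dominated_convergence[OF _ _ riesz_dominator_integrable])
      show "AE w in lborel. (\<lambda>i. (indicator {w. X i \<le> norm w} w * ?k w) *\<^sub>R recentred f x w)
          \<longlonglongrightarrow> ?k w *\<^sub>R recentred f x w"
        using AE_lborel_singleton[of 0]
      proof eventually_elim
        case (elim w)
        then have "\<forall>\<^sub>F i in sequentially. X i < norm w"
          using X(2) by (intro order_tendstoD) auto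
        then have "\<forall>\<^sub>F i in sequentially. (indicator {w. X i \<le> norm w} w * ?k w) *\<^sub>R recentred f x w
            = ?k w *\<^sub>R recentred f x w"
          by eventually_elim simp
        then show ?case by (rule tendsto_eventually)
      qed
      fix i
      have "(indicator {w. X i \<le> norm w} w * ?k w) = (w \<bullet> b) * (indicator {w. X i \<le> norm w} w * riesz_profile w)" for w
        by simp
      then show "AE w in lborel. cmod ((indicator {w. X i \<le> norm w} w * ?k w) *\<^sub>R recentred f x w) \<le> riesz_dominator x w"
        using riesz_profile_nonneg by (intro AE_I2) (simp only:, rule riesz_dominator_bound[OF b], auto simp: indicator_def)
    qed measurable
  qed
  moreover have "\<forall>\<^sub>F \<epsilon> in at_right 0. (LBINT w. (indicator {w. \<epsilon> \<le> norm w} w * ?k w) *\<^sub>R recentred f x w)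
      = riesz_normalization DIM('a) *\<^sub>R (LBINT y. (indicator {y. \<epsilon> \<le> norm (x - y)} y * (((x - y) \<bullet> b) / norm (x - y) ^ (DIM('a) + 1))) *\<^sub>R f y)"
    using eventually_at_right_less by eventually_elim (rule eq[symmetric])
  ultimately show ?thesis
    by (rule Lim_transform_eventually)
qed

text \<open>
  The truncated transforms are antisymmetric and bounded uniformly in the truncation, so that dominated
  convergence against an integrable function applies.
\<close>

lemma riesz_antisym:
  fixes g :: "'a \<Rightarrow> complex"
  assumes b: "b \<in> Basis" and g: "lipschitz_L1 g L' M'"
  shows "(LBINT x. riesz b f x \<bullet> g x) = - (LBINT x. f x \<bullet> riesz b g x)"
proof -
  interpret g: lipschitz_L1 g L' M' by fact
  have cv: "(\<lambda>k. \<integral>x. trunc_riesz b (window k) f x \<bullet> g x \<partial>lborel) \<longlonglongrightarrow> (LBINT x. riesz b f x \<bullet> g x)"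
    if f: "lipschitz_L1 f L M" and g: "integrable lborel g" for f g :: "'a \<Rightarrow> complex" and L M
  proof (rule integral_dominated_convergence)
    interpret f: lipschitz_L1 f L M by fact
    have [measurable]: "g \<in> borel_measurable borel" "riesz b f \<in> borel_measurable borel" "trunc_riesz b (window k) f \<in> borel_measurable borel" for k
      using g f.riesz_measurable[OF b] trunc_riesz_energy(1)[OF f.int window_props(1-3) b, of k] by (simp_all add: square_integrable_def)
    show "integrable lborel (\<lambda>x. (LBINT w. f.riesz_dominator 0 w) * cmod (g x))" using g by simp
    show "AE x in lborel. norm (trunc_riesz b (window k) f x \<bullet> g x) \<le> (LBINT w. f.riesz_dominator 0 w) * cmod (g x)" for k
    proof (intro AE_I2)
      fix x
      have "\<bar>trunc_riesz b (window k) f x \<bullet> g x\<bar> \<le> cmod (trunc_riesz b (window k) f x) * cmod (g x)"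
        by (rule Cauchy_Schwarz_ineq2)
      also have "\<dots> \<le> (LBINT w. f.riesz_dominator 0 w) * cmod (g x)"
        by (intro mult_right_mono f.trunc_riesz_bound[OF window_props(1-3) b]) simp
      finally show "norm (trunc_riesz b (window k) f x \<bullet> g x) \<le> (LBINT w. f.riesz_dominator 0 w) * cmod (g x)" by simp
    qed
    show "AE x in lborel. (\<lambda>k. trunc_riesz b (window k) f x \<bullet> g x) \<longlonglongrightarrow> riesz b f x \<bullet> g x"
      by (intro AE_I2 tendsto_intros f.trunc_riesz_tendsto b)
    show "(\<lambda>x. trunc_riesz b (window k) f x \<bullet> g x) \<in> borel_measurable lborel" for k by measurable
    show "(\<lambda>x. riesz b f x \<bullet> g x) \<in> borel_measurable lborel" by measurable
  qed
  have eq: "(LBINT x. trunc_riesz b (window k) f x \<bullet> g x) = - (LBINT x. trunc_riesz b (window k) g x \<bullet> f x)" for k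
    unfolding trunc_riesz_eq_conv[OF window_props(1-3) b int] trunc_riesz_eq_conv[OF window_props(1-3) b g.int]
    using conv_odd_antisym[OF trunc_kernel_integrable[OF window_props(1-3) b] trunc_kernel_bound[OF window_props(1-3) b] trunc_kernel_uminus int g.int]
    by (simp add: inner_commute)
  have "(\<lambda>k. - (LBINT x. trunc_riesz b (window k) g x \<bullet> f x)) \<longlonglongrightarrow> - (LBINT x. riesz b g x \<bullet> f x)"
    by (intro tendsto_minus cv[OF g int])
  moreover have "(\<lambda>k. - (LBINT x. trunc_riesz b (window k) g x \<bullet> f x)) \<longlonglongrightarrow> (LBINT x. riesz b f x \<bullet> g x)"
    using cv[OF lipschitz_L1_axioms g.int] by (simp only: eq)
  ultimately have "(LBINT x. riesz b f x \<bullet> g x) = - (LBINT x. riesz b g x \<bullet> f x)"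
    by (rule LIMSEQ_unique[rotated])
  then show ?thesis by (simp add: inner_commute)
qed

end

section \<open>Completeness of the space of square-integrable functions\<close>

lemma L2_rel_refl: "square_integrable f \<Longrightarrow> L2_rel f f"
  by (simp add: L2_rel_def)

lemma L2_class_cases:
  obtains f where "square_integrable f" "u = L2_class f"
proof -
  have "L2_rel (rep_L2 u) (rep_L2 u)" "L2_class (rep_L2 u) = u"
    using Quotient3_rep_reflp[OF Quotient3_L2] Quotient3_abs_rep[OF Quotient3_L2] by metis+
  then show ?thesis using that by (metis L2_rel_def)
qed

lemma norm_L2_class: "square_integrable f \<Longrightarrow> norm (L2_class f) = sqrt (LINT x|lborel. (cmod (f x))\<^sup>2)"
  by (simp add: norm_L2.abs_eq L2_rel_refl)

lemma inner_L2_class: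
  "square_integrable f \<Longrightarrow> square_integrable g \<Longrightarrow> L2_class f \<bullet> L2_class g = (LINT x|lborel. f x \<bullet> g x)"
  by (simp add: inner_L2.abs_eq L2_rel_refl)

lemma plus_L2_class:
  "square_integrable f \<Longrightarrow> square_integrable g \<Longrightarrow> L2_class f + L2_class g = L2_class (\<lambda>x. f x + g x)"
  by (simp add: plus_L2.abs_eq L2_rel_refl)

lemma minus_L2_class:
  "square_integrable f \<Longrightarrow> square_integrable g \<Longrightarrow> L2_class f - L2_class g = L2_class (\<lambda>x. f x - g x)"
  by (simp add: minus_L2.abs_eq L2_rel_refl)

lemma scaleR_L2_class:
  "square_integrable f \<Longrightarrow> r *\<^sub>R L2_class f = L2_class (\<lambda>x. r *\<^sub>R f x)"
  by (simp add: scaleR_L2.abs_eq L2_rel_refl)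

lemma norm_L2_class_power2:
  "square_integrable f \<Longrightarrow> (norm (L2_class f))\<^sup>2 = (LINT x|lborel. (cmod (f x))\<^sup>2)"
  by (simp add: norm_L2_class)

lemma norm_diff_L2_class_power2:
  "square_integrable f \<Longrightarrow> square_integrable g \<Longrightarrow>
    (norm (L2_class f - L2_class g))\<^sup>2 = (LINT x|lborel. (cmod (f x - g x))\<^sup>2)"
  by (simp add: minus_L2_class norm_L2_class_power2 square_integrable_diff)

text \<open>
  Fatou's lemma in the form in which it identifies limits in \<open>L\<^sup>2\<close> that are known pointwise.
\<close>

lemma square_integrable_fatou:
  fixes u :: "nat \<Rightarrow> 'a::euclidean_space \<Rightarrow> complex"
  assumes u: "\<And>k. square_integrable (u k)" and C: "\<And>k. (LINT x|lborel. (cmod (u k x))\<^sup>2) \<le> C"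
    and v [measurable]: "v \<in> borel_measurable lborel" and lim: "AE x in lborel. (\<lambda>k. u k x) \<longlonglongrightarrow> v x"
  shows "square_integrable v" "(LINT x|lborel. (cmod (v x))\<^sup>2) \<le> C"
proof -
  have [measurable]: "u k \<in> borel_measurable lborel" for k
    using u by (simp add: square_integrable_def)
  have C0: "0 \<le> C" using order_trans[OF Bochner_Integration.integral_nonneg C] by simp
  have k: "(\<integral>\<^sup>+x. ennreal ((cmod (u k x))\<^sup>2) \<partial>lborel) \<le> ennreal C" for k
    using u[of k] C[of k] by (subst nn_integral_eq_integral) (auto simp: square_integrable_def ennreal_leI)
  have "(\<integral>\<^sup>+x. ennreal ((cmod (v x))\<^sup>2) \<partial>lborel) = (\<integral>\<^sup>+x. liminf (\<lambda>k. ennreal ((cmod (u k x))\<^sup>2)) \<partial>lborel)"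
  proof (rule nn_integral_cong_AE)
    show "AE x in lborel. ennreal ((cmod (v x))\<^sup>2) = liminf (\<lambda>k. ennreal ((cmod (u k x))\<^sup>2))"
      using lim
    proof eventually_elim
      case (elim x)
      then have "(\<lambda>k. ennreal ((cmod (u k x))\<^sup>2)) \<longlonglongrightarrow> ennreal ((cmod (v x))\<^sup>2)"
        by (intro tendsto_intros tendsto_ennrealI)
      from lim_imp_Liminf[OF _ this] show ?case by simp
    qed
  qed
  also have "\<dots> \<le> liminf (\<lambda>k. \<integral>\<^sup>+x. ennreal ((cmod (u k x))\<^sup>2) \<partial>lborel)"
    by (rule nn_integral_liminf) measurable
  also have "\<dots> \<le> ennreal C"
    using k by (intro Liminf_le) (auto intro: always_eventually)
  finally have le: "(\<integral>\<^sup>+x. ennreal ((cmod (v x))\<^sup>2) \<partial>lborel) \<le> ennreal C" .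
  then have i: "integrable lborel (\<lambda>x. (cmod (v x))\<^sup>2)"
    by (intro integrableI_bounded) (auto simp: le_less_trans)
  then show "square_integrable v" by (simp add: square_integrable_def)
  from le i show "(LINT x|lborel. (cmod (v x))\<^sup>2) \<le> C"
    using C0 by (subst (asm) nn_integral_eq_integral) auto
qed

lemma L2_dominated_convergence:
  fixes u :: "nat \<Rightarrow> 'a::euclidean_space \<Rightarrow> complex"
  assumes u: "\<And>k. square_integrable (u k)" and v: "square_integrable v"
    and g: "integrable lborel (\<lambda>x. (g x)\<^sup>2)"
    and ug: "\<And>k x. cmod (u k x) \<le> g x"
    and lim: "\<And>x. (\<lambda>k. u k x) \<longlonglongrightarrow> v x"
  shows "(\<lambda>k. L2_class (u k)) \<longlonglongrightarrow> L2_class v"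
proof -
  have [measurable]: "u k \<in> borel_measurable lborel" "v \<in> borel_measurable lborel" for k
    using u v by (auto simp: square_integrable_def)
  have vg: "cmod (v x) \<le> g x" for x
    by (rule LIMSEQ_le_const2[OF tendsto_norm[OF lim]]) (use ug in auto)
  have "(\<lambda>k. LINT x|lborel. (cmod (u k x - v x))\<^sup>2) \<longlonglongrightarrow> integral\<^sup>L (lborel :: 'a measure) (\<lambda>_. 0::real)"
  proof (rule integral_dominated_convergence)
    show "integrable lborel (\<lambda>x::'a. 4 * (g x)\<^sup>2)" using g by simp
    show "AE x in lborel. (\<lambda>k. (cmod (u k x - v x))\<^sup>2) \<longlonglongrightarrow> 0"
    proof (intro AE_I2)
      fix x
      have "(\<lambda>k. (cmod (u k x - v x))\<^sup>2) \<longlonglongrightarrow> (cmod (v x - v x))\<^sup>2"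
        by (intro tendsto_intros lim)
      then show "(\<lambda>k. (cmod (u k x - v x))\<^sup>2) \<longlonglongrightarrow> 0" by simp
    qed
    show "AE x in lborel. norm ((cmod (u k x - v x))\<^sup>2) \<le> 4 * (g x)\<^sup>2" for k
    proof (intro AE_I2)
      fix x
      have "cmod (u k x - v x) \<le> 2 * g x"
        using norm_triangle_ineq4[of "u k x" "v x"] ug[of k x] vg[of x] by simp
      then have "(cmod (u k x - v x))\<^sup>2 \<le> (2 * g x)\<^sup>2" by (intro power_mono) auto
      then show "norm ((cmod (u k x - v x))\<^sup>2) \<le> 4 * (g x)\<^sup>2" by (simp add: power_mult_distrib)
    qed
  qed measurable
  then have "(\<lambda>k. sqrt ((norm (L2_class (u k) - L2_class v))\<^sup>2)) \<longlonglongrightarrow> sqrt 0"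
    by (intro tendsto_real_sqrt) (simp add: norm_diff_L2_class_power2 u v)
  then show ?thesis
    using LIM_zero_cancel tendsto_norm_zero_cancel by fastforce
qed

text \<open>
  The Riesz--Fischer theorem. Along a subsequence with \<open>\<parallel>u\<^sub>k\<^sub>+\<^sub>1 - u\<^sub>k\<parallel> \<le> 2\<^sup>-\<^sup>k\<close> the series
  \<open>\<Sum>\<^sub>k 2\<^sup>k |u\<^sub>k\<^sub>+\<^sub>1(x) - u\<^sub>k(x)|\<^sup>2\<close> converges for almost every \<open>x\<close>, since its integral is finite. In view of
  \<open>a \<le> 2\<^sup>-\<^sup>k + 2\<^sup>k a\<^sup>2\<close> the subsequence then converges almost everywhere, and Fatou's lemma shows that the
  limit is the limit in \<open>L\<^sup>2\<close>.
\<close>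

instance L2 :: (euclidean_space) complete_space
proof
  fix X :: "nat \<Rightarrow> 'a L2"
  assume X: "Cauchy X"
  have "\<exists>N. \<forall>m\<ge>N. \<forall>n\<ge>N. dist (X m) (X n) < (1/2) ^ k" for k
    using X by (simp add: Cauchy_def)
  then obtain N where N: "\<And>k m n. m \<ge> N k \<Longrightarrow> n \<ge> N k \<Longrightarrow> dist (X m) (X n) < (1/2) ^ k" by metis
  \<comment> \<open>The sum dominates \<open>N k\<close>, and the summand \<open>k\<close> makes the indices strictly increasing.\<close>
  define r where "r = (\<lambda>k. k + (\<Sum>i\<le>k. N i))"
  have r: "strict_mono r" and rN: "N k \<le> r k" for k
  proof -
    show "strict_mono r" by (auto simp: strict_mono_Suc_iff r_def)
    have "N k \<le> (\<Sum>i\<le>k. N i)" by (rule member_le_sum) auto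
    then show "N k \<le> r k" by (simp add: r_def)
  qed
  have "\<forall>k. \<exists>f. square_integrable f \<and> X (r k) = L2_class f"
    by (metis L2_class_cases)
  then obtain u where u: "\<And>k. square_integrable (u k)" and Xu: "\<And>k. X (r k) = L2_class (u k)" by metis
  have [measurable]: "u k \<in> borel_measurable borel" for k
    using u by (auto simp: square_integrable_def)
  have dist_u: "(LINT x|lborel. (cmod (u m x - u n x))\<^sup>2) \<le> ((1/2) ^ k)\<^sup>2" if "m \<ge> k" "n \<ge> k" for m n k
  proof -
    have "r m \<ge> N k" "r n \<ge> N k"
      using rN[of k] strict_mono_less_eq[OF r] that order_trans by blast+
    then have "norm (L2_class (u m) - L2_class (u n)) \<le> (1/2) ^ k"
      using N[of k "r m" "r n"] by (simp add: Xu dist_norm)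
    then have "(norm (L2_class (u m) - L2_class (u n)))\<^sup>2 \<le> ((1/2) ^ k)\<^sup>2"
      by (intro power_mono) auto
    then show ?thesis by (simp add: norm_diff_L2_class_power2 u)
  qed
  let ?a = "\<lambda>k x. cmod (u (Suc k) x - u k x)"
  have "(\<integral>\<^sup>+x. (\<Sum>k. ennreal (2 ^ k * (?a k x)\<^sup>2)) \<partial>lborel) = (\<Sum>k. \<integral>\<^sup>+x. ennreal (2 ^ k * (?a k x)\<^sup>2) \<partial>lborel)"
    by (rule nn_integral_suminf) measurable
  also have "\<dots> \<le> (\<Sum>k. ennreal ((1/2) ^ k))"
  proof (rule suminf_le)
    fix k
    have "(\<integral>\<^sup>+x. ennreal (2 ^ k * (?a k x)\<^sup>2) \<partial>lborel) = ennreal (2 ^ k * (LINT x|lborel. (?a k x)\<^sup>2))"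
      using square_integrable_diff[OF u u, of "Suc k" k]
      by (subst nn_integral_eq_integral) (auto simp: square_integrable_def)
    also have "\<dots> \<le> ennreal (2 ^ k * ((1/2) ^ k)\<^sup>2)"
      using dist_u[of k "Suc k" k] by (intro ennreal_leI mult_left_mono) auto
    also have "2 ^ k * ((1/2) ^ k)\<^sup>2 = ((1/2) ^ k :: real)"
      by (simp add: power2_eq_square power_one_over field_simps)
    finally show "(\<integral>\<^sup>+x. ennreal (2 ^ k * (?a k x)\<^sup>2) \<partial>lborel) \<le> ennreal ((1/2) ^ k)" .
  qed auto
  also have "\<dots> < \<infinity>"
    by (subst suminf_ennreal_eq[OF _ geometric_sums]) auto
  finally have "AE x in lborel. (\<Sum>k. ennreal (2 ^ k * (?a k x)\<^sup>2)) \<noteq> \<infinity>"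
    by (intro nn_integral_noteq_infinite) auto
  then have conv: "AE x in lborel. convergent (\<lambda>k. u k x)"
  proof eventually_elim
    case (elim x)
    have s1: "summable (\<lambda>k. 2 ^ k * (?a k x)\<^sup>2)"
      using elim by (intro summable_suminf_not_top) auto
    have "summable (\<lambda>k. (1/2) ^ k + 2 ^ k * (?a k x)\<^sup>2)"
      by (intro summable_add s1 summable_geometric) simp
    then have "summable (\<lambda>k. norm (u (Suc k) x - u k x))"
    proof (rule summable_comparison_test'[where N=0])
      fix k :: nat
      have "\<bar>2 ^ k * ?a k x\<bar> \<le> 1 + (2 ^ k * ?a k x)\<^sup>2" by (rule abs_le_one_plus_square)
      then have "2 ^ k * ?a k x \<le> 2 ^ k * ((1/2) ^ k + 2 ^ k * (?a k x)\<^sup>2)"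
        by (simp add: distrib_left power_mult_distrib power2_eq_square power_one_over mult_ac)
      then show "norm (norm (u (Suc k) x - u k x)) \<le> (1/2) ^ k + 2 ^ k * (?a k x)\<^sup>2"
        by simp
    qed
    then have "summable (\<lambda>k. u (Suc k) x - u k x)" by (rule summable_norm_cancel)
    then obtain l where "(\<lambda>n. \<Sum>k<n. u (Suc k) x - u k x) \<longlonglongrightarrow> l"
      by (auto simp: summable_def sums_def)
    then have "(\<lambda>n. u n x - u 0 x) \<longlonglongrightarrow> l" by (simp only: sum_lessThan_telescope[of "\<lambda>k. u k x"])
    then have "(\<lambda>n. (u n x - u 0 x) + u 0 x) \<longlonglongrightarrow> l + u 0 x" by (intro tendsto_intros)
    then show ?case by (auto simp: convergent_def)
  qed
  define v where "v = (\<lambda>x. lim (\<lambda>k. u k x))"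
  have v_meas: "v \<in> borel_measurable lborel" unfolding v_def by measurable
  have lim: "AE x in lborel. (\<lambda>k. u k x) \<longlonglongrightarrow> v x"
    using conv by eventually_elim (simp add: v_def convergent_LIMSEQ_iff)
  have vu: "square_integrable (\<lambda>x. v x - u k x)" "(LINT x|lborel. (cmod (v x - u k x))\<^sup>2) \<le> ((1/2) ^ k)\<^sup>2" for k
  proof -
    have l: "AE x in lborel. (\<lambda>m. u (m + k) x - u k x) \<longlonglongrightarrow> v x - u k x"
      using lim by eventually_elim (intro tendsto_intros LIMSEQ_ignore_initial_segment)
    have m: "(\<lambda>x. v x - u k x) \<in> borel_measurable lborel" using v_meas by measurable
    show "square_integrable (\<lambda>x. v x - u k x)" "(LINT x|lborel. (cmod (v x - u k x))\<^sup>2) \<le> ((1/2) ^ k)\<^sup>2"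
      using square_integrable_fatou[OF square_integrable_diff[OF u u] dist_u[of k "_ + k" k] m l] by auto
  qed
  have v: "square_integrable v"
    using square_integrable_add[OF vu(1)[of 0] u[of 0]] by simp
  have "(\<lambda>k. X (r k)) \<longlonglongrightarrow> L2_class v"
  proof (rule LIM_zero_cancel, rule Lim_null_comparison)
    show "\<forall>\<^sub>F k in sequentially. norm (X (r k) - L2_class v) \<le> (1/2) ^ k"
    proof (intro always_eventually allI)
      fix k
      have "(norm (L2_class v - X (r k)))\<^sup>2 \<le> ((1/2) ^ k)\<^sup>2"
        using vu(2)[of k] by (simp add: Xu norm_diff_L2_class_power2 u v)
      then show "norm (X (r k) - L2_class v) \<le> (1/2) ^ k"
        by (subst norm_minus_commute) (rule power2_le_imp_le, simp_all)
    qed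
    show "(\<lambda>k. (1/2::real) ^ k) \<longlonglongrightarrow> 0" by (rule LIMSEQ_realpow_zero) auto
  qed
  then show "convergent X"
    using Cauchy_converges_subseq[OF X r] by (auto simp: convergent_def comp_def)
qed

section \<open>Isometry of the Riesz transforms on Lipschitz functions\<close>

context lipschitz_L1
begin

lemma trunc_riesz_diff:
  assumes b: "b \<in> Basis" and jk: "j \<le> k"
  shows "trunc_riesz b (window k) f x - trunc_riesz b (window j) f x = trunc_riesz b (window k - window j) f x"
proof -
  have i: "integrable lborel (\<lambda>t. (indicator (window m) t * time_weight t) *\<^sub>R conv (heat_grad b t) f x)" for m
  proof (rule integrable_dominated)
    let ?C = "grad_peak TYPE('a) (1 / real (Suc m)) * (LBINT y. cmod (f y))"
    have [measurable]: "window m \<in> sets borel" by (rule window_props)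
    show "integrable lborel (\<lambda>t. indicator (window m) t * time_weight t * ?C)"
      by (rule time_weight_integrable[OF window_props(1-3)]) simp
    have "(\<lambda>t. conv (heat_grad b t) f x) \<in> borel_measurable lborel"
      unfolding conv_def by measurable
    then show "(\<lambda>t. (indicator (window m) t * time_weight t) *\<^sub>R conv (heat_grad b t) f x) \<in> borel_measurable lborel"
      by measurable
    show "norm ((indicator (window m) t * time_weight t) *\<^sub>R conv (heat_grad b t) f x) \<le> indicator (window m) t * time_weight t * ?C" for t
    proof (cases "t \<in> window m")
      case True
      have "1 / real (Suc m) \<le> t" using True by (simp add: window_def)
      from mult_left_mono[OF conv_grad_bound[OF int b window_props(3) this, of x] time_weight_indicator_nonneg[OF window_props(2,3)]]
      show ?thesis by (simp only: norm_scaleR abs_of_nonneg[OF time_weight_indicator_nonneg[OF window_props(2,3)]])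
    qed simp
  qed
  have "(indicator (window k - window j) t :: real) = indicator (window k) t - indicator (window j) t" for t
    using window_mono[OF jk] by (auto simp: indicator_def)
  then show ?thesis
    unfolding trunc_riesz_def using i
    by (subst Bochner_Integration.integral_diff[symmetric]) (simp_all add: left_diff_distrib scaleR_diff_left)
qed

text \<open>
  An upper bound for the energy of the part of a Riesz transform whose times lie outside a window.
\<close>

definition tail_energy :: "nat \<Rightarrow> ennreal" where
  "tail_energy k = (\<integral>\<^sup>+r. indicator ((- window k) \<times> (- window k)) r * energy_density r \<partial>lborel2)"

lemma total_energy_finite: "(\<integral>\<^sup>+r. energy_density r \<partial>lborel2) < \<infinity>"
  by (simp add: total_energy)

lemma energy_density_zero: "\<not> (fst r > 0 \<and> snd r > 0) \<Longrightarrow> energy_density r = 0"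
  by (auto simp: energy_density_def)

lemma tail_energy_tendsto: "tail_energy \<longlonglongrightarrow> 0"
proof -
  have [measurable]: "window k \<in> sets borel" for k by (rule window_props)
  have "(\<lambda>k. \<integral>\<^sup>+r. indicator ((- window k) \<times> (- window k)) r * energy_density r \<partial>lborel2) \<longlonglongrightarrow> (\<integral>\<^sup>+r. 0 \<partial>(lborel2 :: (real \<times> real) measure))"
  proof (rule nn_integral_dominated_convergence[where w = energy_density])
    show "AE r in lborel2. indicator ((- window k) \<times> (- window k)) r * energy_density r \<le> energy_density r" for k
      by (intro AE_I2) (auto simp: indicator_def)
    show "AE r in lborel2. (\<lambda>k. indicator ((- window k) \<times> (- window k)) r * energy_density r) \<longlonglongrightarrow> 0"
    proof (intro AE_I2)
      fix r :: "real \<times> real"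
      show "(\<lambda>k. indicator ((- window k) \<times> (- window k)) r * energy_density r) \<longlonglongrightarrow> 0"
      proof (cases "fst r > 0 \<and> snd r > 0")
        case True
        then have "\<forall>\<^sub>F k in sequentially. indicator ((- window k) \<times> (- window k)) r * energy_density r = 0"
          using eventually_in_window[of "fst r"] by (auto elim!: eventually_mono simp: indicator_def mem_Times_iff)
        then show ?thesis by (rule tendsto_eventually)
      qed (simp add: energy_density_zero)
    qed
  qed (use total_energy_finite in auto)
  then show ?thesis by (simp add: tail_energy_def[abs_def])
qed

lemma window_energy_tendsto:
  "(\<lambda>k. \<Sum>b\<in>Basis. \<integral>x. (cmod (trunc_riesz b (window k) f x))\<^sup>2 \<partial>lborel) \<longlonglongrightarrow> mass2"
proof -
  have [measurable]: "window k \<in> sets borel" for k by (rule window_props)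
  have "(\<lambda>k. \<integral>\<^sup>+r. indicator (window k \<times> window k) r * energy_density r \<partial>lborel2) \<longlonglongrightarrow> (\<integral>\<^sup>+r. energy_density r \<partial>lborel2)"
  proof (rule nn_integral_dominated_convergence[where w = energy_density])
    show "AE r in lborel2. indicator (window k \<times> window k) r * energy_density r \<le> energy_density r" for k
      by (intro AE_I2) (auto simp: indicator_def)
    show "AE r in lborel2. (\<lambda>k. indicator (window k \<times> window k) r * energy_density r) \<longlonglongrightarrow> energy_density r"
    proof (intro AE_I2)
      fix r :: "real \<times> real"
      show "(\<lambda>k. indicator (window k \<times> window k) r * energy_density r) \<longlonglongrightarrow> energy_density r"
      proof (cases "fst r > 0 \<and> snd r > 0")
        case True
        then have "\<forall>\<^sub>F k in sequentially. fst r \<in> window k \<and> snd r \<in> window k"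
          using eventually_in_window eventually_conj by blast
        then have "\<forall>\<^sub>F k in sequentially. indicator (window k \<times> window k) r * energy_density r = energy_density r"
          by eventually_elim (simp add: indicator_def mem_Times_iff)
        then show ?thesis by (rule tendsto_eventually)
      qed (simp add: energy_density_zero)
    qed
  qed (use total_energy_finite in auto)
  then have "(\<lambda>k. ennreal (\<Sum>b\<in>Basis. \<integral>x. (cmod (trunc_riesz b (window k) f x))\<^sup>2 \<partial>lborel)) \<longlonglongrightarrow> ennreal mass2"
    by (simp only: trunc_riesz_energy_density[OF window_props(1-3)] total_energy)
  then show ?thesis
    by (subst (asm) tendsto_ennreal_iff) (auto intro!: always_eventually sum_nonneg simp: mass2_def)
qed

text \<open>
  The difference of two truncations is the truncation to the difference of their windows, and its energy
  is at most the tail energy. Fatou's lemma passes this bound to the pointwise limit.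
\<close>

lemma trunc_riesz_L2_close:
  assumes b: "b \<in> Basis"
  shows "square_integrable (riesz b f)"
    and "(norm (L2_class (riesz b f) - L2_class (trunc_riesz b (window j) f)))\<^sup>2 \<le> enn2real (tail_energy j)"
proof -
  note ti = trunc_riesz_energy(1)[OF int window_props(1-3) b]
  have tail_fin: "tail_energy j < \<infinity>" for j
    unfolding tail_energy_def
    by (rule le_less_trans[OF nn_integral_mono total_energy_finite]) (auto simp: indicator_def)
  have sub: "window k - window j \<in> sets borel" "window k - window j \<subseteq> {1 / real (Suc k)..real (Suc k)}" for j k
    using window_props(1,2) by auto
  have bnd: "(LINT x|lborel. (cmod (trunc_riesz b (window (k + j)) f x - trunc_riesz b (window j) f x))\<^sup>2) \<le> enn2real (tail_energy j)" for j k
  proof -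
    let ?S = "window (k + j) - window j"
    let ?e = "\<lambda>c. LINT x|lborel. (cmod (trunc_riesz c ?S f x))\<^sup>2"
    have "ennreal (?e b) \<le> ennreal (\<Sum>c\<in>Basis. ?e c)"
      using b by (intro ennreal_leI member_le_sum[of b Basis ?e]) auto
    also have "\<dots> = (\<integral>\<^sup>+r. indicator (?S \<times> ?S) r * energy_density r \<partial>lborel2)"
      by (rule trunc_riesz_energy_density[OF sub window_props(3)])
    also have "\<dots> \<le> tail_energy j"
      unfolding tail_energy_def by (intro nn_integral_mono) (auto simp: indicator_def)
    finally have "ennreal (?e b) \<le> tail_energy j" .
    then have "enn2real (ennreal (?e b)) \<le> enn2real (tail_energy j)"
      by (rule enn2real_mono) (use tail_fin in simp)
    then show ?thesis
      using trunc_riesz_diff[OF b, of j "k + j"] by simp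
  qed
  have lim: "AE x in lborel. (\<lambda>k. trunc_riesz b (window (k + j)) f x - trunc_riesz b (window j) f x) \<longlonglongrightarrow> riesz b f x - trunc_riesz b (window j) f x" for j
    by (intro AE_I2 tendsto_intros LIMSEQ_ignore_initial_segment trunc_riesz_tendsto b)
  have meas: "(\<lambda>x. riesz b f x - trunc_riesz b (window j) f x) \<in> borel_measurable lborel" for j
    using riesz_measurable[OF b] ti[of j] by (auto simp: square_integrable_def)
  note F = square_integrable_fatou[OF square_integrable_diff[OF ti ti] bnd meas lim]
  show R: "square_integrable (riesz b f)"
    using square_integrable_add[OF F(1)[of 0] ti[of 0]] by simp
  show "(norm (L2_class (riesz b f) - L2_class (trunc_riesz b (window j) f)))\<^sup>2 \<le> enn2real (tail_energy j)"
    using F(2)[of j] by (simp add: norm_diff_L2_class_power2 R ti)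
qed

theorem riesz_isometry:
  "(\<Sum>b\<in>Basis. (norm (L2_class (riesz b f)))\<^sup>2) = (norm (L2_class f))\<^sup>2"
proof (rule LIMSEQ_unique)
  have lim: "(\<lambda>k. L2_class (trunc_riesz b (window k) f)) \<longlonglongrightarrow> L2_class (riesz b f)" if b: "b \<in> Basis" for b
  proof (rule LIM_zero_cancel, rule Lim_null_comparison)
    show "\<forall>\<^sub>F k in sequentially. norm (L2_class (trunc_riesz b (window k) f) - L2_class (riesz b f)) \<le> sqrt (enn2real (tail_energy k))"
      using trunc_riesz_L2_close(2)[OF b] by (intro always_eventually allI real_le_rsqrt) (simp add: norm_minus_commute)
    have "(\<lambda>k. enn2real (tail_energy k)) \<longlonglongrightarrow> 0"
      by (rule tendsto_enn2real) (use tail_energy_tendsto in auto)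
    then have "(\<lambda>k. sqrt (enn2real (tail_energy k))) \<longlonglongrightarrow> sqrt 0"
      by (rule tendsto_real_sqrt)
    then show "(\<lambda>k. sqrt (enn2real (tail_energy k))) \<longlonglongrightarrow> 0" by simp
  qed
  show "(\<lambda>k. \<Sum>b\<in>Basis. (norm (L2_class (trunc_riesz b (window k) f)))\<^sup>2) \<longlonglongrightarrow> (\<Sum>b\<in>Basis. (norm (L2_class (riesz b f)))\<^sup>2)"
    by (intro tendsto_intros lim)
  have "(\<Sum>b\<in>Basis. (norm (L2_class (trunc_riesz b (window k) f)))\<^sup>2) = (\<Sum>b\<in>Basis. \<integral>x. (cmod (trunc_riesz b (window k) f x))\<^sup>2 \<partial>lborel)" for k
    by (intro sum.cong refl norm_L2_class_power2 trunc_riesz_energy(1)[OF int window_props(1-3)])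
  then show "(\<lambda>k. \<Sum>b\<in>Basis. (norm (L2_class (trunc_riesz b (window k) f)))\<^sup>2) \<longlonglongrightarrow> (norm (L2_class f))\<^sup>2"
    using window_energy_tendsto by (simp add: norm_L2_class_power2[OF sq_int] mass2_def)
qed

end

section \<open>Smooth bump functions\<close>

text \<open>
  For \<open>q = 1\<close> this is the standard smooth function that vanishes on the negative half-line; the
  polynomials \<open>q\<close> in \<open>1 / x\<close> make the family closed under differentiation.
\<close>

definition flat_exp :: "real poly \<Rightarrow> real \<Rightarrow> real" where
  "flat_exp q x = (if x > 0 then poly q (1 / x) * exp (- 1 / x) else 0)"

lemma poly_times_exp_tendsto_0: "((\<lambda>y. poly p y * exp (- y)) \<longlongrightarrow> (0::real)) at_top"
proof -
  have "((\<lambda>y. \<Sum>i\<le>degree p. coeff p i * (y ^ i / exp y)) \<longlongrightarrow> (\<Sum>i\<le>degree p. coeff p i * 0)) at_top"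
    by (intro tendsto_intros tendsto_power_div_exp_0)
  then show ?thesis
    by (simp add: poly_altdef sum_distrib_right exp_minus divide_inverse mult.assoc)
qed

lemma flat_exp_DERIV:
  "(flat_exp q has_real_derivative flat_exp (monom 1 2 * (q - pderiv q)) x) (at x)"
proof -
  consider "x > 0" | "x < 0" | "x = 0" by linarith
  then show ?thesis
  proof cases
    case 1
    have "((\<lambda>x. poly q (1 / x) * exp (- 1 / x)) has_real_derivative
        poly q (1 / x) * (exp (- 1 / x) * (1 / x\<^sup>2)) + poly (pderiv q) (1 / x) * (- 1 / x\<^sup>2) * exp (- 1 / x)) (at x)"
      using 1 by (auto intro!: derivative_eq_intros DERIV_chain2[OF poly_DERIV] simp: power2_eq_square field_simps)
    also have "poly q (1 / x) * (exp (- 1 / x) * (1 / x\<^sup>2)) + poly (pderiv q) (1 / x) * (- 1 / x\<^sup>2) * exp (- 1 / x)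
        = flat_exp (monom 1 2 * (q - pderiv q)) x"
      using 1 by (simp add: flat_exp_def poly_monom power_one_over algebra_simps)
    finally show ?thesis
      by (rule has_field_derivative_transform_within_open[where S="{0<..}"]) (use 1 in \<open>auto simp: flat_exp_def\<close>)
  next
    case 2
    have "((\<lambda>_. 0) has_real_derivative 0) (at x)" by simp
    then have "(flat_exp q has_real_derivative 0) (at x)"
      by (rule has_field_derivative_transform_within_open[where S="{..<0}"]) (use 2 in \<open>auto simp: flat_exp_def\<close>)
    with 2 show ?thesis by (simp add: flat_exp_def)
  next
    case 3
    have "((\<lambda>h. flat_exp q h / h) \<longlongrightarrow> 0) (at_right 0)"
    proof -
      have "((\<lambda>h. poly (monom 1 1 * q) (inverse h) * exp (- inverse h)) \<longlongrightarrow> 0) (at_right 0)"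
        by (rule filterlim_compose[OF poly_times_exp_tendsto_0 filterlim_inverse_at_top_right])
      moreover have "\<forall>\<^sub>F h in at_right 0. poly (monom 1 1 * q) (inverse h) * exp (- inverse h) = flat_exp q h / h"
        using eventually_at_right_less[of 0]
        by eventually_elim (simp add: flat_exp_def poly_monom divide_inverse mult_ac)
      ultimately show ?thesis by (rule Lim_transform_eventually)
    qed
    moreover have "((\<lambda>h. flat_exp q h / h) \<longlongrightarrow> 0) (at_left 0)"
      by (rule tendsto_eventually) (auto simp: eventually_at_filter flat_exp_def)
    ultimately have "((\<lambda>h. flat_exp q h / h) \<longlongrightarrow> 0) (at 0)"
      by (simp add: filterlim_split_at)
    then show ?thesis
      using 3 by (simp add: has_field_derivative_iff flat_exp_def)
  qed
qed

lemma partial_deriv_eq: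
  assumes "(f has_derivative D) (at x)"
  shows "partial_deriv k f x = D (axis k 1)"
  using frechet_derivative_at[OF assms] by (simp add: partial_deriv_def)

text \<open>
  An algebra of functions that is closed under partial derivatives, so that every one of its members is
  smooth. It is just large enough to contain bump functions supported on boxes.
\<close>

inductive smooth_alg :: "(real^'n \<Rightarrow> complex) \<Rightarrow> bool" where
  coord: "smooth_alg (\<lambda>x. of_real (flat_exp q (s * x $ k + t)))"
| const: "smooth_alg (\<lambda>x. c)"
| add: "smooth_alg f \<Longrightarrow> smooth_alg g \<Longrightarrow> smooth_alg (\<lambda>x. f x + g x)"
| mult: "smooth_alg f \<Longrightarrow> smooth_alg g \<Longrightarrow> smooth_alg (\<lambda>x. f x * g x)"

lemma smooth_alg_deriv:
  fixes f :: "real^'n \<Rightarrow> complex"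
  assumes "smooth_alg f"
  shows "f differentiable_on UNIV \<and> (\<forall>i. smooth_alg (partial_deriv i f))"
  using assms
proof induction
  case (coord q s k t)
  let ?q = "monom 1 2 * (q - pderiv q)"
  have D: "((\<lambda>x::real^'n. complex_of_real (flat_exp q (s * x $ k + t))) has_derivative
      (\<lambda>h. of_real (s * h $ k * flat_exp ?q (s * x $ k + t)))) (at x)" for x
  proof -
    have "(flat_exp q has_derivative (\<lambda>h. h * flat_exp ?q (s * x $ k + t))) (at (s * x $ k + t))"
      using flat_exp_DERIV[of q "s * x $ k + t"] by (simp add: has_field_derivative_def mult.commute[of _ "flat_exp _ _"] mult_commute_abs)
    from has_derivative_compose[where f="\<lambda>x::real^'n. s * x $ k + t" and f'="\<lambda>h. s * h $ k" and x=x and s=UNIV, OF _ this]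
    have "((\<lambda>x. flat_exp q (s * x $ k + t)) has_derivative (\<lambda>h. s * h $ k * flat_exp ?q (s * x $ k + t))) (at x)"
      using has_derivative_add[OF has_derivative_mult_right[OF bounded_linear_imp_has_derivative[OF bounded_linear_vec_nth[of k]], of s] has_derivative_const[of t]]
      by simp
    then show ?thesis by (rule has_derivative_of_real)
  qed
  have "partial_deriv i (\<lambda>x::real^'n. complex_of_real (flat_exp q (s * x $ k + t)))
      = (\<lambda>x. of_real (s * axis i 1 $ k) * of_real (flat_exp ?q (s * x $ k + t)))" for i
    by (rule ext, subst partial_deriv_eq[OF D]) simp
  then show ?case
    using D by (auto simp: differentiable_on_def differentiable_def intro!: smooth_alg.intros)
next
  case (const c)
  have "partial_deriv i (\<lambda>x::real^'n. c) = (\<lambda>x. 0)" for i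
    by (rule ext, subst partial_deriv_eq[OF has_derivative_const]) simp
  then show ?case by (auto intro: smooth_alg.intros)
next
  case (add f g)
  then have d: "f differentiable at x" "g differentiable at x" for x
    by (auto simp: differentiable_on_def)
  have "partial_deriv i (\<lambda>x. f x + g x) = (\<lambda>x. partial_deriv i f x + partial_deriv i g x)" for i
    by (rule ext, subst partial_deriv_eq[OF has_derivative_add[OF d[unfolded frechet_derivative_works]]])
      (simp add: partial_deriv_def)
  with add show ?case by (auto intro: smooth_alg.intros)
next
  case (mult f g)
  then have d: "f differentiable at x" "g differentiable at x" for x
    by (auto simp: differentiable_on_def)
  have "partial_deriv i (\<lambda>x. f x * g x) = (\<lambda>x. f x * partial_deriv i g x + partial_deriv i f x * g x)" for i
    by (rule ext, subst partial_deriv_eq[OF has_derivative_mult[OF d[unfolded frechet_derivative_works]]])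
      (simp add: partial_deriv_def)
  moreover have "smooth_alg (\<lambda>x. f x * partial_deriv i g x + partial_deriv i f x * g x)" for i
    using mult by (intro smooth_alg.add smooth_alg.mult) auto
  moreover have "(\<lambda>x. f x * g x) differentiable_on UNIV"
    using mult by (intro differentiable_on_mult) auto
  ultimately show ?case by simp
qed

lemma smooth_alg_foldr: "smooth_alg f \<Longrightarrow> smooth_alg (foldr partial_deriv ks f)"
  by (induction ks) (auto dest: smooth_alg_deriv)

lemma smooth_alg_prod: "finite A \<Longrightarrow> (\<And>k. k \<in> A \<Longrightarrow> smooth_alg (f k)) \<Longrightarrow> smooth_alg (\<lambda>x. \<Prod>k\<in>A. f k x)"
  by (induction A rule: finite_induct) (auto intro: smooth_alg.intros)

lemma foldr_partial_deriv_vanish: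
  fixes f :: "real^'n \<Rightarrow> complex"
  assumes "\<And>x. R < norm x \<Longrightarrow> f x = 0"
  shows "R < norm x \<Longrightarrow> foldr partial_deriv ks f x = 0"
proof (induction ks arbitrary: x)
  case (Cons k ks)
  have "((\<lambda>_. 0) has_derivative (\<lambda>_. 0)) (at x)" by simp
  then have "(foldr partial_deriv ks f has_derivative (\<lambda>_. 0)) (at x)"
  proof (rule has_derivative_transform_within_open)
    show "open {x::real^'n. R < norm x}" by (intro open_Collect_less continuous_intros)
  qed (use Cons in auto)
  from partial_deriv_eq[OF this] show ?case by simp
qed (use assms in simp)

lemma schwartz_of_smooth_alg:
  fixes f :: "real^'n \<Rightarrow> complex"
  assumes f: "smooth_alg f" and R: "\<And>x. R < norm x \<Longrightarrow> f x = 0"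
  shows "schwartz f"
  unfolding schwartz_def
proof (intro conjI allI)
  fix ks show "foldr partial_deriv ks f differentiable_on UNIV"
    using smooth_alg_deriv[OF smooth_alg_foldr[OF f]] by blast
next
  fix b :: "'n \<Rightarrow> nat" and ks
  let ?g = "\<lambda>x. (\<Prod>k\<in>UNIV. (x $ k) ^ b k) *\<^sub>R foldr partial_deriv ks f x"
  have "continuous_on UNIV (foldr partial_deriv ks f)"
    using smooth_alg_deriv[OF smooth_alg_foldr[OF f]] differentiable_imp_continuous_on by blast
  then have "continuous_on (cball 0 R) ?g"
    by (intro continuous_intros) (auto intro: continuous_on_subset)
  then have "bounded (?g ` cball 0 R)"
    by (intro compact_imp_bounded compact_continuous_image) auto
  moreover have "range ?g \<subseteq> insert 0 (?g ` cball 0 R)"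
  proof
    fix z assume "z \<in> range ?g"
    then obtain x where z: "z = ?g x" by auto
    show "z \<in> insert 0 (?g ` cball 0 R)"
      using foldr_partial_deriv_vanish[of R f x ks] R z by (cases "R < norm x") (auto simp: not_less)
  qed
  ultimately show "bounded (range ?g)"
    by (meson bounded_insert bounded_subset)
qed

section \<open>Schwartz functions form a dense subspace\<close>

lemma schwartz_differentiable: "schwartz f \<Longrightarrow> f differentiable_on UNIV"
  unfolding schwartz_def by (metis foldr.simps(1) id_apply)

lemma foldr_partial_deriv_add:
  assumes f: "schwartz f" and g: "schwartz g"
  shows "foldr partial_deriv ks (\<lambda>x. f x + g x) = (\<lambda>x. foldr partial_deriv ks f x + foldr partial_deriv ks g x)"
proof (induction ks)
  case (Cons k ks)
  have d: "foldr partial_deriv ks f differentiable at x" "foldr partial_deriv ks g differentiable at x" for x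
    using f g by (auto simp: schwartz_def differentiable_on_def)
  show ?case
    unfolding foldr.simps comp_def Cons
    by (rule ext, subst partial_deriv_eq[OF has_derivative_add[OF d[unfolded frechet_derivative_works]]])
      (simp add: partial_deriv_def)
qed simp

lemma foldr_partial_deriv_scaleR:
  assumes f: "schwartz f"
  shows "foldr partial_deriv ks (\<lambda>x. r *\<^sub>R f x) = (\<lambda>x. r *\<^sub>R foldr partial_deriv ks f x)"
proof (induction ks)
  case (Cons k ks)
  have d: "foldr partial_deriv ks f differentiable at x" for x
    using f by (auto simp: schwartz_def differentiable_on_def)
  show ?case
    unfolding foldr.simps comp_def Cons
    by (rule ext, subst partial_deriv_eq[OF has_derivative_scaleR_right[OF d[unfolded frechet_derivative_works]]])
      (simp add: partial_deriv_def)
qed simp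

lemma schwartz_add:
  fixes f g :: "real^'n \<Rightarrow> complex"
  assumes f: "schwartz f" and g: "schwartz g"
  shows "schwartz (\<lambda>x. f x + g x)"
  unfolding schwartz_def foldr_partial_deriv_add[OF f g]
proof (intro conjI allI)
  fix ks show "(\<lambda>x. foldr partial_deriv ks f x + foldr partial_deriv ks g x) differentiable_on UNIV"
    using f g by (auto simp: schwartz_def)
next
  fix b :: "'n \<Rightarrow> nat" and ks
  show "bounded (range (\<lambda>x. (\<Prod>k\<in>UNIV. (x $ k) ^ b k) *\<^sub>R (foldr partial_deriv ks f x + foldr partial_deriv ks g x)))"
    unfolding scaleR_add_right using f g by (intro bounded_plus_comp) (auto simp: schwartz_def)
qed

lemma schwartz_scaleR:
  fixes f :: "real^'n \<Rightarrow> complex"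
  assumes f: "schwartz f"
  shows "schwartz (\<lambda>x. r *\<^sub>R f x)"
  unfolding schwartz_def foldr_partial_deriv_scaleR[OF f]
proof (intro conjI allI)
  fix ks show "(\<lambda>x. r *\<^sub>R foldr partial_deriv ks f x) differentiable_on UNIV"
    using f by (auto simp: schwartz_def)
next
  fix b :: "'n \<Rightarrow> nat" and ks
  show "bounded (range (\<lambda>x. (\<Prod>k\<in>UNIV. (x $ k) ^ b k) *\<^sub>R (r *\<^sub>R foldr partial_deriv ks f x)))"
    unfolding scaleR_left_commute[of _ r] using f by (intro bounded_scaleR_comp) (auto simp: schwartz_def)
qed

text \<open>
  On the box the factors are \<open>exp (- 1 / ((m + 1) (x\<^sub>k - a\<^sub>k)))\<close> and \<open>exp (- 1 / ((m + 1) (b\<^sub>k - x\<^sub>k)))\<close>, which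
  increase to \<open>1\<close> with \<open>m\<close>. The functions approximate the indicator of the open box pointwise.
\<close>

definition box_bump :: "real^'n \<Rightarrow> real^'n \<Rightarrow> nat \<Rightarrow> real^'n \<Rightarrow> real" where
  "box_bump a b m x = (\<Prod>k\<in>UNIV. flat_exp 1 (real (Suc m) * (x $ k - a $ k)) * flat_exp 1 (real (Suc m) * (b $ k - x $ k)))"

lemma flat_exp_1: "0 \<le> flat_exp 1 x" "flat_exp 1 x \<le> 1"
  by (auto simp: flat_exp_def)

lemma box_bump_bounds:
  fixes a b :: "real^'n"
  shows "0 \<le> box_bump a b m x" "box_bump a b m x \<le> 1"
  unfolding box_bump_def
  by (auto intro!: prod_nonneg prod_le_1 mult_le_one mult_nonneg_nonneg flat_exp_1)

lemma box_bump_outside: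
  fixes a b :: "real^'n"
  shows "x \<notin> box a b \<Longrightarrow> box_bump a b m x = 0"
proof -
  assume "x \<notin> box a b"
  then obtain k where "\<not> (a $ k < x $ k \<and> x $ k < b $ k)" by (auto simp: mem_box_cart)
  then have "x $ k - a $ k \<le> 0 \<or> b $ k - x $ k \<le> 0" by linarith
  then have "real (Suc m) * (x $ k - a $ k) \<le> 0 \<or> real (Suc m) * (b $ k - x $ k) \<le> 0"
    by (meson mult_nonneg_nonpos of_nat_0_le_iff)
  then have "flat_exp 1 (real (Suc m) * (x $ k - a $ k)) * flat_exp 1 (real (Suc m) * (b $ k - x $ k)) = 0"
    by (auto simp: flat_exp_def)
  then show ?thesis unfolding box_bump_def by (intro prod_zero) auto
qed

lemma box_bump_tendsto:
  fixes a b :: "real^'n"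
  shows "(\<lambda>m. box_bump a b m x) \<longlonglongrightarrow> indicator (box a b) x"
proof (cases "x \<in> box a b")
  case True
  have *: "(\<lambda>m. flat_exp 1 (real (Suc m) * d)) \<longlonglongrightarrow> 1" if "d > 0" for d
  proof -
    have "(\<lambda>m. exp (- (1 / real (Suc m) / d))) \<longlonglongrightarrow> exp (- (0 / d))"
      by (intro tendsto_intros LIMSEQ_Suc[OF lim_1_over_n]) (use that in auto)
    then show ?thesis using that by (simp add: flat_exp_def zero_less_mult_iff del: of_nat_Suc)
  qed
  have "(\<lambda>m. box_bump a b m x) \<longlonglongrightarrow> (\<Prod>k\<in>(UNIV::'n set). 1 * 1)"
    unfolding box_bump_def using True by (intro tendsto_intros *) (auto simp: mem_box_cart)
  with True show ?thesis by simp
qed (simp add: box_bump_outside)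

lemma schwartz_box_bump:
  fixes a b :: "real^'n"
  shows "schwartz (\<lambda>x. box_bump a b m x *\<^sub>R c)"
proof -
  have b: "bounded (box a b)" by (rule bounded_box)
  then obtain R where R: "\<And>x. x \<in> box a b \<Longrightarrow> norm x \<le> R" by (auto simp: bounded_iff)
  have "smooth_alg (\<lambda>x::real^'n. (\<Prod>k\<in>UNIV. of_real (flat_exp 1 (real (Suc m) * x $ k + (- real (Suc m) * a $ k)))
      * of_real (flat_exp 1 (- real (Suc m) * x $ k + real (Suc m) * b $ k))) * c)"
    by (intro smooth_alg.intros smooth_alg_prod) auto
  moreover have "(\<lambda>x. box_bump a b m x *\<^sub>R c) = (\<lambda>x. (\<Prod>k\<in>UNIV. of_real (flat_exp 1 (real (Suc m) * x $ k + (- real (Suc m) * a $ k)))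
      * of_real (flat_exp 1 (- real (Suc m) * x $ k + real (Suc m) * b $ k))) * c)"
    by (simp add: box_bump_def scaleR_conv_of_real right_diff_distrib del: of_nat_Suc)
  ultimately show ?thesis
    using R by (intro schwartz_of_smooth_alg[of _ R]) (force intro: box_bump_outside)+
qed

definition schwartz_hull :: "(real^'n) L2 set" where
  "schwartz_hull = closure (L2_class ` {f. schwartz f \<and> square_integrable f})"

lemma schwartz_hull_limit:
  "(\<And>k. u k \<in> schwartz_hull) \<Longrightarrow> u \<longlonglongrightarrow> l \<Longrightarrow> l \<in> schwartz_hull"
  unfolding schwartz_hull_def using closed_sequentially[OF closed_closure] by blast

lemma schwartz_hull_add:
  assumes "u \<in> schwartz_hull" "v \<in> schwartz_hull"
  shows "u + v \<in> schwartz_hull"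
proof -
  let ?S = "L2_class ` {f. schwartz f \<and> square_integrable f}"
  obtain x y where x: "\<And>n. x n \<in> ?S" "x \<longlonglongrightarrow> u" and y: "\<And>n. y n \<in> ?S" "y \<longlonglongrightarrow> v"
    using assms by (auto simp: schwartz_hull_def closure_sequential)
  have "x n + y n \<in> ?S" for n
    using x(1)[of n] y(1)[of n] by (auto simp: plus_L2_class intro!: imageI schwartz_add square_integrable_add)
  with tendsto_add[OF x(2) y(2)] show ?thesis
    by (auto simp: schwartz_hull_def closure_sequential intro!: exI[of _ "\<lambda>n. x n + y n"])
qed

lemma schwartz_hull_scaleR:
  assumes "u \<in> schwartz_hull"
  shows "r *\<^sub>R u \<in> schwartz_hull"
proof -
  let ?S = "L2_class ` {f. schwartz f \<and> square_integrable f}"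
  obtain x where x: "\<And>n. x n \<in> ?S" "x \<longlonglongrightarrow> u"
    using assms by (auto simp: schwartz_hull_def closure_sequential)
  have "r *\<^sub>R x n \<in> ?S" for n
    using x(1)[of n] by (auto simp: scaleR_L2_class intro!: imageI schwartz_scaleR square_integrable_scaleR)
  with tendsto_scaleR[OF tendsto_const x(2)] show ?thesis
    by (auto simp: schwartz_hull_def closure_sequential intro!: exI[of _ "\<lambda>n. r *\<^sub>R x n"])
qed

lemma schwartz_hull_sum:
  fixes f :: "'b \<Rightarrow> real^'n \<Rightarrow> complex"
  assumes A: "finite A" and "\<And>y. y \<in> A \<Longrightarrow> square_integrable (f y) \<and> L2_class (f y) \<in> schwartz_hull"
  shows "square_integrable (\<lambda>x. \<Sum>y\<in>A. f y x) \<and> L2_class (\<lambda>x. \<Sum>y\<in>A. f y x) \<in> schwartz_hull"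
  using assms
proof (induction A rule: finite_induct)
  case empty
  have s: "schwartz (\<lambda>x::real^'n. box_bump 0 0 0 x *\<^sub>R (0::complex))" by (rule schwartz_box_bump)
  have z: "L2_class (\<lambda>x::real^'n. 0) \<in> L2_class ` {f. schwartz f \<and> square_integrable f}"
    using s by (intro imageI) (simp add: square_integrable_zero)
  then show ?case
    using subsetD[OF closure_subset z] by (simp add: schwartz_hull_def square_integrable_zero)
next
  case (insert y A)
  then show ?case
    by (auto simp: plus_L2_class[symmetric] intro!: square_integrable_add schwartz_hull_add)
qed

lemma square_integrable_indicator:
  assumes "A \<in> sets borel" "emeasure lborel A < \<infinity>"
  shows "square_integrable (\<lambda>x::'a::euclidean_space. indicator A x *\<^sub>R c)"
proof -
  have "integrable lborel (\<lambda>x. indicator A x * (cmod c)\<^sup>2)"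
    using assms by (intro integrable_mult_left integrable_real_indicator) auto
  moreover have "(\<lambda>x. (cmod (indicator A x *\<^sub>R c))\<^sup>2) = (\<lambda>x. indicator A x * (cmod c)\<^sup>2)"
    by (auto simp: indicator_def)
  ultimately show ?thesis
    using assms(1) by (simp only: square_integrable_def) simp
qed

lemma schwartz_hull_box:
  fixes a b :: "real^'n"
  shows "L2_class (\<lambda>x. indicator (box a b) x *\<^sub>R c) \<in> schwartz_hull"
proof (rule schwartz_hull_limit)
  have fin: "emeasure lborel (box a b) < \<infinity>"
    by (rule emeasure_bounded_finite) (rule bounded_box)
  have si: "square_integrable (\<lambda>x. indicator (box a b) x *\<^sub>R c)" "square_integrable (\<lambda>x. indicator (box a b) x *\<^sub>R complex_of_real (cmod c))"
    using fin by (auto intro!: square_integrable_indicator)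
  have le: "cmod (box_bump a b m x *\<^sub>R c) \<le> cmod (indicator (box a b) x *\<^sub>R complex_of_real (cmod c))" for m x
    using box_bump_bounds[of a b m x] box_bump_outside[of x a b m]
    by (cases "x \<in> box a b") (auto simp: mult_left_le_one_le)
  have s: "square_integrable (\<lambda>x. box_bump a b m x *\<^sub>R c)" for m
    unfolding square_integrable_def
  proof
    have "continuous_on UNIV (\<lambda>x. box_bump a b m x *\<^sub>R c)"
      using schwartz_differentiable[OF schwartz_box_bump] by (rule differentiable_imp_continuous_on)
    then show "(\<lambda>x. box_bump a b m x *\<^sub>R c) \<in> borel_measurable lborel"
      using borel_measurable_continuous_onI by simp
    then show "integrable lborel (\<lambda>x. (cmod (box_bump a b m x *\<^sub>R c))\<^sup>2)"
      by (intro Bochner_Integration.integrable_bound[OF conjunct2[OF si(2)[unfolded square_integrable_def]]])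
        (use le in \<open>auto intro!: AE_I2 power_mono simp del: norm_scaleR\<close>)
  qed
  show "L2_class (\<lambda>x. box_bump a b m x *\<^sub>R c) \<in> schwartz_hull" for m
    unfolding schwartz_hull_def using s schwartz_box_bump by (intro subsetD[OF closure_subset] imageI) auto
  show "(\<lambda>m. L2_class (\<lambda>x. box_bump a b m x *\<^sub>R c)) \<longlonglongrightarrow> L2_class (\<lambda>x. indicator (box a b) x *\<^sub>R c)"
    by (rule L2_dominated_convergence[OF s si(1) conjunct2[OF si(2)[unfolded square_integrable_def]] le])
      (intro tendsto_intros box_bump_tendsto)
qed

text \<open>
  The boxes generate the Borel sets and are stable under intersections, so the system of sets whose
  trace on a fixed box has its indicator in the hull is everything, by Dynkin's theorem. The fixed box
  keeps all measures finite.
\<close>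

lemma schwartz_hull_indicator:
  fixes a b :: "real^'n"
  assumes A: "A \<in> sets borel"
  shows "L2_class (\<lambda>x. indicator (A \<inter> box a b) x *\<^sub>R c) \<in> schwartz_hull"
proof -
  let ?G = "range (\<lambda>(a, b). box a b :: (real^'n) set)"
  have "A \<in> sigma_sets UNIV ?G" using A by (simp add: borel_eq_box)
  moreover have "Int_stable ?G"
    by (auto simp: Int_stable_def box_Int_box)
  moreover have "?G \<subseteq> Pow UNIV" by simp
  moreover have sets: "B \<in> sets borel" if "B \<in> sigma_sets UNIV ?G" for B :: "(real^'n) set"
    using that by (simp add: borel_eq_box)
  have fin: "emeasure lborel (B \<inter> box a b) < \<infinity>" for B
    by (rule emeasure_bounded_finite) (simp add: bounded_Int)
  have si: "square_integrable (\<lambda>x. indicator (B \<inter> box a b) x *\<^sub>R c)" if "B \<in> sigma_sets UNIV ?G" for B c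
    using sets[OF that] fin by (intro square_integrable_indicator) auto
  show ?thesis
    using \<open>Int_stable ?G\<close> \<open>?G \<subseteq> Pow UNIV\<close> \<open>A \<in> sigma_sets UNIV ?G\<close>
  proof (induction A rule: sigma_sets_induct_disjoint)
    case (basic A)
    then show ?case by (auto simp: box_Int_box schwartz_hull_box)
  next
    case empty
    have "box a a = {}" by (simp add: box_eq_empty)
    then show ?case using schwartz_hull_box[of a a c] by simp
  next
    case (compl A)
    have U: "UNIV \<in> sigma_sets UNIV ?G" by (rule sigma_sets_top)
    have "L2_class (\<lambda>x. indicator ((UNIV - A) \<inter> box a b) x *\<^sub>R c)
        = L2_class (\<lambda>x. indicator (UNIV \<inter> box a b) x *\<^sub>R c) - L2_class (\<lambda>x. indicator (A \<inter> box a b) x *\<^sub>R c)"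
      using si[OF U] si[OF compl(1)] by (subst minus_L2_class) (auto intro!: arg_cong[of _ _ L2_class] simp: indicator_def fun_eq_iff)
    also have "\<dots> = L2_class (\<lambda>x. indicator (box a b) x *\<^sub>R c) + (- 1) *\<^sub>R L2_class (\<lambda>x. indicator (A \<inter> box a b) x *\<^sub>R c)"
      by simp
    also have "\<dots> \<in> schwartz_hull"
      by (intro schwartz_hull_add schwartz_hull_scaleR schwartz_hull_box compl)
    finally show ?case .
  next
    case (union A)
    have AU: "(\<Union>i. A i) \<in> sigma_sets UNIV ?G" and Ai: "A i \<in> sigma_sets UNIV ?G" for i
      using union(2) by (auto intro: sigma_sets.Union)
    show ?case
    proof (rule schwartz_hull_limit)
      let ?u = "\<lambda>m x. \<Sum>i<m. indicator (A i \<inter> box a b) x *\<^sub>R c"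
      have us: "square_integrable (?u m) \<and> L2_class (?u m) \<in> schwartz_hull" for m
        by (rule schwartz_hull_sum) (use si[OF Ai] union(3) in auto)
      then show "L2_class (?u m) \<in> schwartz_hull" for m by blast
      have eq: "?u m x = indicator ((\<Union>i<m. A i) \<inter> box a b) x *\<^sub>R c" for m x
      proof -
        have "disjoint_family_on A {..<m}" using union(1) by (auto simp: disjoint_family_on_def)
        then have "(\<Sum>i<m. indicator (A i) x) = (indicator (\<Union>i<m. A i) x :: real)"
          by (intro indicator_UN_disjoint[symmetric]) auto
        then show ?thesis
          by (simp add: indicator_inter_arith scaleR_sum_left[symmetric] sum_distrib_right[symmetric])
      qed
      have sib: "square_integrable (\<lambda>x. indicator (UNIV \<inter> box a b) x *\<^sub>R complex_of_real (cmod c))"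
        by (rule si[OF sigma_sets_top])
      show "(\<lambda>m. L2_class (?u m)) \<longlonglongrightarrow> L2_class (\<lambda>x. indicator ((\<Union>i. A i) \<inter> box a b) x *\<^sub>R c)"
      proof (rule L2_dominated_convergence[OF conjunct1[OF us] si[OF AU] conjunct2[OF sib[unfolded square_integrable_def]]])
        show "cmod (?u m x) \<le> cmod (indicator (UNIV \<inter> box a b) x *\<^sub>R complex_of_real (cmod c))" for m x
          unfolding eq by (auto simp: indicator_def)
        fix x
        show "(\<lambda>m. ?u m x) \<longlonglongrightarrow> indicator ((\<Union>i. A i) \<inter> box a b) x *\<^sub>R c"
        proof -
          have "(\<lambda>m. indicator (\<Union>i<m. A i) x :: real) \<longlonglongrightarrow> indicator (\<Union>i. A i) x"
            by (rule LIMSEQ_indicator_UN)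
          then have "(\<lambda>m. (indicator (\<Union>i<m. A i) x * indicator (box a b) x) *\<^sub>R c) \<longlonglongrightarrow> (indicator (\<Union>i. A i) x * indicator (box a b) x) *\<^sub>R c"
            by (intro tendsto_intros)
          then show ?thesis
            unfolding eq unfolding indicator_inter_arith .
        qed
      qed
    qed
  qed
qed

text \<open>
  A square-integrable function is the dominated limit of simple functions cut off to growing boxes.
\<close>

lemma schwartz_dense: "schwartz_hull = (UNIV :: (real^'n) L2 set)"
proof -
  have "u \<in> schwartz_hull" for u :: "(real^'n) L2"
  proof -
    obtain f where f: "square_integrable f" and u: "u = L2_class f" by (rule L2_class_cases)
    have fm: "f \<in> borel_measurable borel" using f by (simp add: square_integrable_def)
    from borel_measurable_implies_sequence_metric[OF this, of 0]
    obtain F where F: "\<And>i. simple_function borel (F i)" and lim: "\<And>x. (\<lambda>i. F i x) \<longlonglongrightarrow> f x"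
      and bd: "\<And>i x. cmod (F i x) \<le> 2 * cmod (f x)"
      by auto
    define B where "B = (\<lambda>i. box (- (real i *\<^sub>R One)) (real i *\<^sub>R One) :: (real^'n) set)"
    have B: "(\<Union>i. B i) = UNIV" "incseq B"
    proof -
      show "(\<Union>i. B i) = UNIV"
        unfolding B_def by (rule UN_box_eq_UNIV)
      show "incseq B"
      proof (intro incseq_SucI subsetI)
        fix i x assume "x \<in> B i"
        then have "\<forall>b\<in>Basis. - real i < x \<bullet> b \<and> x \<bullet> b < real i" by (simp add: B_def mem_box)
        then show "x \<in> B (Suc i)" by (force simp: B_def mem_box)
      qed
    qed
    define G where "G = (\<lambda>i x. indicator (B i) x *\<^sub>R F i x)"
    have G_eq: "G i x = (\<Sum>y\<in>range (F i). indicator (F i -` {y} \<inter> B i) x *\<^sub>R y)" for i x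
    proof -
      have "F i x = (\<Sum>y\<in>range (F i). indicator (F i -` {y}) x *\<^sub>R y)"
        by (rule simple_function_indicator_representation_banach[OF F, unfolded space_borel Int_UNIV_right, OF UNIV_I])
      then have "G i x = indicator (B i) x *\<^sub>R (\<Sum>y\<in>range (F i). indicator (F i -` {y}) x *\<^sub>R y)"
        unfolding G_def by (rule arg_cong)
      then show ?thesis
        by (simp add: scaleR_sum_right indicator_inter_arith mult.commute)
    qed
    have Gs: "square_integrable (G i) \<and> L2_class (G i) \<in> schwartz_hull" for i
      unfolding G_eq[abs_def]
    proof (rule schwartz_hull_sum)
      show "finite (range (F i))" using simple_functionD(1)[OF F[of i]] by simp
      fix y
      have m: "F i -` {y} \<in> sets borel" using simple_functionD(2)[OF F[of i], of "{y}"] by simp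
      have "emeasure lborel (F i -` {y} \<inter> B i) < \<infinity>"
        unfolding B_def by (rule emeasure_bounded_finite) (simp add: bounded_Int)
      moreover have "F i -` {y} \<inter> B i \<in> sets borel" using m by (simp add: B_def)
      ultimately show "square_integrable (\<lambda>x. indicator (F i -` {y} \<inter> B i) x *\<^sub>R y) \<and>
          L2_class (\<lambda>x. indicator (F i -` {y} \<inter> B i) x *\<^sub>R y) \<in> schwartz_hull"
        using m unfolding B_def by (intro conjI square_integrable_indicator schwartz_hull_indicator) auto
    qed
    show ?thesis
      unfolding u
    proof (rule schwartz_hull_limit[OF conjunct2[OF Gs]])
      show "(\<lambda>i. L2_class (G i)) \<longlonglongrightarrow> L2_class f"
      proof (rule L2_dominated_convergence[OF conjunct1[OF Gs] f])
        show "integrable lborel (\<lambda>x. (2 * cmod (f x))\<^sup>2)"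
          using f by (simp add: square_integrable_def power_mult_distrib)
        show "cmod (G i x) \<le> 2 * cmod (f x)" for i x
          using bd[of i x] by (auto simp: G_def indicator_def)
        fix x
        have "(\<lambda>i. indicator (B i) x :: real) \<longlonglongrightarrow> indicator (\<Union>i. B i) x"
          by (rule LIMSEQ_indicator_incseq[OF B(2)])
        then have "(\<lambda>i. indicator (B i) x *\<^sub>R F i x) \<longlonglongrightarrow> 1 *\<^sub>R f x"
          using B(1) by (intro tendsto_intros lim) simp
        then show "(\<lambda>i. G i x) \<longlonglongrightarrow> f x" by (simp add: G_def)
      qed
    qed
  qed
  then show ?thesis by auto
qed

section \<open>Linearity of the Riesz transforms\<close>

lemma (in lipschitz_L1) riesz_integrand_integrable:
  assumes b: "b \<in> Basis"
  shows "integrable lborel (\<lambda>w. ((w \<bullet> b) * riesz_profile w) *\<^sub>R recentred f x w)"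
  by (rule integrable_dominated[OF riesz_dominator_integrable])
    (measurable, rule riesz_dominator_bound[OF b riesz_profile_nonneg order_refl])

lemma riesz_add:
  assumes f: "lipschitz_L1 f L M" and g: "lipschitz_L1 g L' M'" and b: "b \<in> Basis"
  shows "riesz b (\<lambda>x. f x + g x) x = riesz b f x + riesz b g x"
proof -
  have "riesz b (\<lambda>x. f x + g x) x
      = (LBINT w. ((w \<bullet> b) * riesz_profile w) *\<^sub>R recentred f x w
          + ((w \<bullet> b) * riesz_profile w) *\<^sub>R recentred g x w)"
    unfolding riesz_def
    by (intro Bochner_Integration.integral_cong refl) (simp add: algebra_simps)
  also have "\<dots> = riesz b f x + riesz b g x"
    unfolding riesz_def
    by (rule Bochner_Integration.integral_add lipschitz_L1.riesz_integrand_integrable[OF f b] lipschitz_L1.riesz_integrand_integrable[OF g b])+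
  finally show ?thesis .
qed

lemma riesz_scaleR: "riesz b (\<lambda>x. r *\<^sub>R f x) x = r *\<^sub>R riesz b f x"
proof -
  have "riesz b (\<lambda>x. r *\<^sub>R f x) x = (LBINT w. r *\<^sub>R (((w \<bullet> b) * riesz_profile w) *\<^sub>R recentred f x w))"
    unfolding riesz_def
    by (intro Bochner_Integration.integral_cong refl) (simp add: scaleR_diff_right mult_ac)
  then show ?thesis by (simp only: integral_scaleR_right riesz_def)
qed

section \<open>Chirps and Schwartz functions\<close>

lemma chirp_eq: "chirp \<alpha> x = exp (\<i> * of_real ((\<Sum>k\<in>UNIV. (x $ k)\<^sup>2 * cot (\<alpha> $ k)) / 2))"
  by (simp add: chirp_def)

lemma cmod_chirp [simp]: "cmod (chirp \<alpha> x) = 1"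
  unfolding chirp_eq by (rule norm_exp_i_times)

lemma chirp_minus: "chirp (- \<alpha>) x = cnj (chirp \<alpha> x)"
proof -
  have "\<i> * of_real ((\<Sum>k\<in>UNIV. (x $ k)\<^sup>2 * cot ((- \<alpha>) $ k)) / 2)
      = cnj (\<i> * of_real ((\<Sum>k\<in>UNIV. (x $ k)\<^sup>2 * cot (\<alpha> $ k)) / 2))"
    by (simp add: sum_negf)
  then show ?thesis
    unfolding chirp_eq exp_cnj by (simp only: exp_cnj)
qed

lemma chirp_has_derivative:
  fixes \<alpha> :: "real^'n"
  shows "(chirp \<alpha> has_derivative (\<lambda>h. \<i> * of_real (\<Sum>k\<in>UNIV. x $ k * h $ k * cot (\<alpha> $ k)) * chirp \<alpha> x)) (at x)"
proof -
  have nth: "((\<lambda>x::real^'n. x $ k) has_derivative (\<lambda>h. h $ k)) (at x)" for k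
    by (rule bounded_linear_imp_has_derivative[OF bounded_linear_vec_nth])
  have "((\<lambda>x. (\<Sum>k\<in>UNIV. (x $ k)\<^sup>2 * cot (\<alpha> $ k)) / 2) has_derivative (\<lambda>h. \<Sum>k\<in>UNIV. x $ k * h $ k * cot (\<alpha> $ k))) (at x)"
    by (auto intro!: derivative_eq_intros nth simp: sum_divide_distrib power2_eq_square fun_eq_iff intro!: sum.cong)
  from has_derivative_mult_right[OF has_derivative_of_real[OF this], of \<i>]
  have "((\<lambda>x. \<i> * of_real ((\<Sum>k\<in>UNIV. (x $ k)\<^sup>2 * cot (\<alpha> $ k)) / 2)) has_derivative
      (\<lambda>h. \<i> * complex_of_real (\<Sum>k\<in>UNIV. x $ k * h $ k * cot (\<alpha> $ k)))) (at x)" .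
  from has_derivative_compose[OF this DERIV_exp[unfolded has_field_derivative_def]] show ?thesis
    unfolding chirp_eq[abs_def] by (simp add: mult.commute)
qed

lemma chirp_continuous: "continuous_on UNIV (chirp \<alpha>)"
  unfolding chirp_def by (intro continuous_intros)

lemma chirp_measurable [measurable]: "chirp \<alpha> \<in> borel_measurable borel"
  by (rule borel_measurable_continuous_onI[OF chirp_continuous])

lemma schwartz_monomial_bound:
  fixes f :: "real^'n \<Rightarrow> complex" and b :: "'n \<Rightarrow> nat"
  assumes "schwartz f"
  obtains C where "\<And>x. \<bar>\<Prod>k\<in>UNIV. (x $ k) ^ b k\<bar> * cmod (foldr partial_deriv ks f x) \<le> C"
proof -
  have "bounded (range (\<lambda>x. (\<Prod>k\<in>UNIV. (x $ k) ^ b k) *\<^sub>R foldr partial_deriv ks f x))"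
    using assms by (auto simp: schwartz_def)
  then obtain C where "\<And>x. cmod ((\<Prod>k\<in>UNIV. (x $ k) ^ b k) *\<^sub>R foldr partial_deriv ks f x) \<le> C"
    by (auto simp: bounded_iff)
  then have "\<bar>\<Prod>k\<in>UNIV. (x $ k) ^ b k\<bar> * cmod (foldr partial_deriv ks f x) \<le> C" for x
    by (simp only: norm_scaleR)
  then show ?thesis by (rule that)
qed

lemma schwartz_bounded:
  fixes f :: "real^'n \<Rightarrow> complex"
  assumes "schwartz f"
  obtains C where "\<And>x. cmod (foldr partial_deriv ks f x) \<le> C"
proof -
  obtain C where "\<And>x. \<bar>\<Prod>k\<in>UNIV. (x $ k) ^ (0::nat)\<bar> * cmod (foldr partial_deriv ks f x) \<le> C"
    using schwartz_monomial_bound[OF assms, of "\<lambda>_. 0" ks] by blast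
  then have "cmod (foldr partial_deriv ks f x) \<le> C" for x by simp
  then show ?thesis by (rule that)
qed

lemma integrable_prod_coordinates:
  fixes g :: "real \<Rightarrow> real"
  assumes g: "integrable lborel g" "\<And>t. 0 \<le> g t"
  shows "integrable lborel (\<lambda>x::real^'n. \<Prod>k\<in>UNIV. g (x $ k))"
proof (rule integrableI_bounded)
  have [measurable]: "g \<in> borel_measurable borel" using g by auto
  have B: "(\<Prod>k\<in>UNIV. g (x $ k)) = (\<Prod>b\<in>Basis. g (x \<bullet> b))" for x :: "real^'n"
  proof -
    have 1: "(Basis :: (real^'n) set) = (\<lambda>k::'n. axis k 1) ` UNIV" by (auto simp: Basis_vec_def)
    have "inj (\<lambda>k::'n. axis k (1::real))" by (auto simp: inj_on_def axis_eq_axis)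
    then show ?thesis
      unfolding 1 by (simp add: prod.reindex inner_axis)
  qed
  show "(\<lambda>x::real^'n. \<Prod>k\<in>UNIV. g (x $ k)) \<in> borel_measurable lborel"
    unfolding B by measurable
  have "(\<integral>\<^sup>+(x::real^'n). ennreal (norm (\<Prod>k\<in>UNIV. g (x $ k))) \<partial>lborel) = (\<integral>\<^sup>+(x::real^'n). (\<Prod>b\<in>Basis. ennreal (g (x \<bullet> b))) \<partial>lborel)"
    unfolding B using g(2) by (simp add: prod_ennreal prod_nonneg abs_prod)
  also have "\<dots> = (\<Prod>b\<in>(Basis::(real^'n) set). (\<integral>\<^sup>+t. ennreal (g t) \<partial>lborel))"
    by (rule nn_integral_lborel_prod) auto
  also have "\<dots> < \<infinity>"
    using g by (subst nn_integral_eq_integral) (auto simp: ennreal_power[symmetric] power_less_top_ennreal)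
  finally show "(\<integral>\<^sup>+(x::real^'n). ennreal (norm (\<Prod>k\<in>UNIV. g (x $ k))) \<partial>lborel) < \<infinity>" .
qed

lemma schwartz_measurable:
  fixes f :: "real^'n \<Rightarrow> complex"
  assumes "schwartz f"
  shows "f \<in> borel_measurable borel"
  using schwartz_differentiable[OF assms] differentiable_imp_continuous_on borel_measurable_continuous_onI by blast

text \<open>
  Expanding \<open>\<Prod>\<^sub>k (1 + x\<^sub>k\<^sup>2)\<close> into monomials shows that its product with \<open>f\<close> is bounded, and
  \<open>\<Prod>\<^sub>k 1 / (1 + x\<^sub>k\<^sup>2)\<close> is integrable.
\<close>

lemma schwartz_integrable:
  fixes f :: "real^'n \<Rightarrow> complex"
  assumes f: "schwartz f"
  shows "integrable lborel f"
proof -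
  define h where "h = (\<lambda>x::real^'n. \<Prod>k\<in>UNIV. inverse (1 + (x $ k)\<^sup>2))"
  have "integrable lborel (\<lambda>t::real. inverse (1 + t\<^sup>2))"
    using integrable_inverse_1_plus_square by (simp add: set_integrable_def)
  then have h: "integrable lborel h"
    unfolding h_def by (rule integrable_prod_coordinates) (simp add: add_nonneg_nonneg)
  have "\<forall>X. \<exists>C. \<forall>x. \<bar>\<Prod>k\<in>UNIV. (x $ k) ^ (if k \<in> X then 2 else 0)\<bar> * cmod (f x) \<le> C" for X :: "'n set"
    by (metis schwartz_monomial_bound[OF f, where ks="[]", simplified])
  then obtain C where C: "\<And>X x. \<bar>\<Prod>k\<in>UNIV. (x $ k) ^ (if k \<in> X then 2 else 0)\<bar> * cmod (f x) \<le> C X"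
    by metis
  have bound: "cmod (f x) \<le> (\<Sum>X\<in>UNIV. C X) * h x" for x
  proof -
    have pos: "0 < (\<Prod>k\<in>UNIV. 1 + (x $ k)\<^sup>2)" by (intro prod_pos) (auto intro: add_pos_nonneg)
    have "(\<Prod>k\<in>UNIV. (x $ k)\<^sup>2 + 1) = (\<Sum>X\<in>Pow UNIV. (\<Prod>k\<in>X. (x $ k)\<^sup>2) * (\<Prod>k\<in>UNIV - X. 1))"
      by (rule prod_add) simp
    also have "\<dots> = (\<Sum>X\<in>UNIV. \<Prod>k\<in>UNIV. (x $ k) ^ (if k \<in> X then 2 else 0))"
    proof (rule sum.cong)
      fix X :: "'n set"
      have "(\<Prod>k\<in>UNIV. (x $ k) ^ (if k \<in> X then 2 else 0)) = (\<Prod>k\<in>UNIV. if k \<in> X then (x $ k)\<^sup>2 else 1)"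
        by (intro prod.cong) auto
      also have "\<dots> = (\<Prod>k\<in>X. (x $ k)\<^sup>2)" by (simp add: prod.If_cases)
      finally show "(\<Prod>k\<in>X. (x $ k)\<^sup>2) * (\<Prod>k\<in>UNIV - X. 1) = (\<Prod>k\<in>UNIV. (x $ k) ^ (if k \<in> X then 2 else 0))" by simp
    qed simp
    finally have "(\<Prod>k\<in>UNIV. 1 + (x $ k)\<^sup>2) * cmod (f x) = (\<Sum>X\<in>UNIV. (\<Prod>k\<in>UNIV. (x $ k) ^ (if k \<in> X then 2 else 0)) * cmod (f x))"
      by (simp add: add.commute sum_distrib_right)
    also have "\<dots> \<le> (\<Sum>X\<in>UNIV. C X)"
      by (intro sum_mono order_trans[OF mult_right_mono[OF abs_ge_self] C]) simp
    finally have "cmod (f x) \<le> (\<Sum>X\<in>UNIV. C X) / (\<Prod>k\<in>UNIV. 1 + (x $ k)\<^sup>2)"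
      using pos by (simp add: pos_le_divide_eq mult.commute)
    then show ?thesis
      using prod_inversef[of "\<lambda>k. 1 + (x $ k)\<^sup>2" UNIV] by (simp add: h_def divide_inverse o_def)
  qed
  show ?thesis
  proof (rule Bochner_Integration.integrable_bound)
    show "integrable lborel (\<lambda>x. (\<Sum>X\<in>UNIV. C X) * h x)" using h by simp
    show "f \<in> borel_measurable lborel" using schwartz_measurable[OF f] by simp
    show "AE x in lborel. norm (f x) \<le> norm ((\<Sum>X\<in>UNIV. C X) * h x)"
      unfolding real_norm_def by (intro AE_I2 order_trans[OF bound abs_ge_self])
  qed
qed

text \<open>
  The gradient of the chirp grows linearly, which the decay of \<open>f\<close> absorbs.
\<close>

lemma schwartz_chirp_lipschitz_L1:
  fixes f :: "real^'n \<Rightarrow> complex"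
  assumes f: "schwartz f"
  obtains L M where "lipschitz_L1 (\<lambda>x. f x * chirp \<alpha> x) L M"
proof -
  obtain M where M: "\<And>x. cmod (f x) \<le> M"
    using schwartz_bounded[OF f, of "[]"] by auto
  have "\<exists>C. \<forall>x. cmod (partial_deriv k f x) \<le> C" for k
    using schwartz_bounded[OF f, of "[k]"] by auto
  then obtain D where D: "\<And>k x. cmod (partial_deriv k f x) \<le> D k" by metis
  have "\<exists>C. \<forall>x. \<bar>x $ k\<bar> * cmod (f x) \<le> C" for k
  proof -
    have e: "(\<Prod>i\<in>UNIV. (x $ i) ^ (if i = k then 1 else 0)) = x $ k" for x :: "real^'n"
    proof -
      have "(\<Prod>i\<in>UNIV. (x $ i) ^ (if i = k then 1 else 0)) = (\<Prod>i\<in>UNIV. if i = k then x $ i else 1)"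
        by (intro prod.cong) auto
      then show ?thesis by simp
    qed
    from schwartz_monomial_bound[OF f, of "\<lambda>i. if i = k then 1 else 0" "[]"] show ?thesis
      unfolding e by (metis foldr.simps(1) id_apply)
  qed
  then obtain E where E: "\<And>k x. \<bar>x $ k\<bar> * cmod (f x) \<le> E k" by metis
  define L where "L = (\<Sum>k\<in>UNIV. E k * \<bar>cot (\<alpha> $ k)\<bar>) + (\<Sum>k\<in>UNIV. D k)"
  have E0: "0 \<le> E k" and D0: "0 \<le> D k" for k
    using E[of 0 k] order_trans[OF norm_ge_zero D[of k 0]] by simp_all
  have L0: "0 \<le> L" unfolding L_def by (intro add_nonneg_nonneg sum_nonneg mult_nonneg_nonneg E0 D0) auto
  have d: "(f has_derivative frechet_derivative f (at x)) (at x)" for x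
    using schwartz_differentiable[OF f] by (auto simp: differentiable_on_def frechet_derivative_works)
  define G where "G = (\<lambda>x h. f x * (\<i> * of_real (\<Sum>k\<in>UNIV. x $ k * h $ k * cot (\<alpha> $ k)) * chirp \<alpha> x) + frechet_derivative f (at x) h * chirp \<alpha> x)"
  have G: "((\<lambda>x. f x * chirp \<alpha> x) has_derivative G x) (at x)" for x
    unfolding G_def by (rule has_derivative_mult[OF d chirp_has_derivative])
  have Gb: "onorm (G x) \<le> L" for x
  proof (rule onorm_bound[OF L0])
    fix h :: "real^'n"
    have "cmod (f x * (\<i> * of_real (\<Sum>k\<in>UNIV. x $ k * h $ k * cot (\<alpha> $ k)) * chirp \<alpha> x)) = cmod (f x) * \<bar>\<Sum>k\<in>UNIV. x $ k * h $ k * cot (\<alpha> $ k)\<bar>"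
      by (simp add: norm_mult del: of_real_sum)
    also have "\<dots> \<le> cmod (f x) * (\<Sum>k\<in>UNIV. \<bar>x $ k * h $ k * cot (\<alpha> $ k)\<bar>)"
      by (intro mult_left_mono sum_abs) simp
    also have "\<dots> = (\<Sum>k\<in>UNIV. (\<bar>x $ k\<bar> * cmod (f x)) * (\<bar>cot (\<alpha> $ k)\<bar> * \<bar>h $ k\<bar>))"
      by (simp add: sum_distrib_left abs_mult mult_ac)
    also have "\<dots> \<le> (\<Sum>k\<in>UNIV. E k * (\<bar>cot (\<alpha> $ k)\<bar> * norm h))"
      by (intro sum_mono mult_mono E mult_left_mono component_le_norm_cart E0) auto
    finally have 1: "cmod (f x * (\<i> * of_real (\<Sum>k\<in>UNIV. x $ k * h $ k * cot (\<alpha> $ k)) * chirp \<alpha> x)) \<le> (\<Sum>k\<in>UNIV. E k * \<bar>cot (\<alpha> $ k)\<bar>) * norm h"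
      by (simp add: sum_distrib_right mult.assoc)
    have lin: "linear (frechet_derivative f (at x))"
      using d has_derivative_linear by blast
    have "frechet_derivative f (at x) h = frechet_derivative f (at x) (\<Sum>k\<in>UNIV. h $ k *\<^sub>R axis k 1)"
      using basis_expansion[of h] by (simp add: scalar_mult_eq_scaleR)
    also have "\<dots> = (\<Sum>k\<in>UNIV. h $ k *\<^sub>R partial_deriv k f x)"
      by (simp add: linear_sum[OF lin] linear_scale[OF lin] partial_deriv_def)
    also have "cmod \<dots> \<le> (\<Sum>k\<in>UNIV. cmod (h $ k *\<^sub>R partial_deriv k f x))"
      by (rule norm_sum)
    also have "\<dots> \<le> (\<Sum>k\<in>UNIV. norm h * D k)"
      unfolding norm_scaleR by (intro sum_mono mult_mono component_le_norm_cart D) auto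
    finally have 2: "cmod (frechet_derivative f (at x) h * chirp \<alpha> x) \<le> (\<Sum>k\<in>UNIV. D k) * norm h"
      by (simp add: norm_mult sum_distrib_left mult.commute)
    show "cmod (G x h) \<le> L * norm h"
      unfolding G_def L_def distrib_right by (rule order_trans[OF norm_triangle_ineq add_mono[OF 1 2]])
  qed
  have [measurable]: "f \<in> borel_measurable borel" by (rule schwartz_measurable[OF f])
  have "lipschitz_L1 (\<lambda>x. f x * chirp \<alpha> x) L M"
  proof
    show "integrable lborel (\<lambda>x. f x * chirp \<alpha> x)"
      by (rule Bochner_Integration.integrable_bound[OF schwartz_integrable[OF f]]) (auto simp: norm_mult)
    show "cmod (f x * chirp \<alpha> x) \<le> M" for x using M[of x] by (simp add: norm_mult)
    show "cmod (f x * chirp \<alpha> x - f y * chirp \<alpha> y) \<le> L * norm (x - y)" for x y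
      by (rule differentiable_bound[OF convex_UNIV G Gb]) auto
  qed
  then show ?thesis by (rule that)
qed

lemma axis_Basis: "axis j 1 \<in> (Basis :: (real^'n) set)"
  by simp

lemma frac_riesz_pv_eq:
  fixes f :: "real^'n \<Rightarrow> complex"
  assumes f: "schwartz f"
  shows "frac_riesz_pv \<alpha> j f x = chirp (- \<alpha>) x * riesz (axis j 1) (\<lambda>y. f y * chirp \<alpha> y) x"
proof -
  obtain L M where "lipschitz_L1 (\<lambda>x. f x * chirp \<alpha> x) L M" by (rule schwartz_chirp_lipschitz_L1[OF f])
  then interpret lipschitz_L1 "\<lambda>x. f x * chirp \<alpha> x" L M .
  let ?c = "riesz_normalization CARD('n)"
  let ?R = "riesz (axis j 1) (\<lambda>y. f y * chirp \<alpha> y) x"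
  have c: "?c > 0" by (rule riesz_normalization_pos)
  have c_eq: "riesz_const TYPE('n) = ?c"
    by (simp add: riesz_const_def riesz_normalization_def)
  let ?I = "\<lambda>\<epsilon>. LINT y:{y. \<epsilon> \<le> norm (x - y)}|lborel. of_real ((x $ j - y $ j) / norm (x - y) ^ (CARD('n) + 1)) * f y * chirp \<alpha> y"
  have "?I \<epsilon> = (LBINT y. (indicator {y. \<epsilon> \<le> norm (x - y)} y * (((x - y) \<bullet> axis j 1) / norm (x - y) ^ (DIM(real^'n) + 1))) *\<^sub>R (f y * chirp \<alpha> y))" for \<epsilon>
    unfolding set_lebesgue_integral_def
    by (intro Bochner_Integration.integral_cong refl) (simp add: inner_axis scaleR_conv_of_real mult.assoc)
  then have "((\<lambda>\<epsilon>. ?c *\<^sub>R ?I \<epsilon>) \<longlongrightarrow> ?R) (at_right 0)"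
    using riesz_principal_value[OF axis_Basis[of j], of x] by (simp only: DIM_cart DIM_real mult_1_right)
  then have "((\<lambda>\<epsilon>. inverse ?c *\<^sub>R (?c *\<^sub>R ?I \<epsilon>)) \<longlongrightarrow> inverse ?c *\<^sub>R ?R) (at_right 0)"
    by (intro tendsto_intros)
  then have "(?I \<longlongrightarrow> inverse ?c *\<^sub>R ?R) (at_right 0)"
    using c by simp
  then have "Lim (at_right 0) ?I = inverse ?c *\<^sub>R ?R"
    by (intro tendsto_Lim) auto
  then show ?thesis
    unfolding frac_riesz_pv_def c_eq using c by (simp add: scaleR_conv_of_real)
qed

section \<open>Extension by density\<close>

instance L2 :: (euclidean_space) banach ..

lemma dense_extension:
  fixes r :: "'a::real_normed_vector \<Rightarrow> 'b::banach"
  assumes dense: "closure S = UNIV"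
    and S_add: "\<And>x y. x \<in> S \<Longrightarrow> y \<in> S \<Longrightarrow> x + y \<in> S" and S_scale: "\<And>c x. x \<in> S \<Longrightarrow> c *\<^sub>R x \<in> S"
    and add: "\<And>x y. x \<in> S \<Longrightarrow> y \<in> S \<Longrightarrow> r (x + y) = r x + r y"
    and scale: "\<And>c x. x \<in> S \<Longrightarrow> r (c *\<^sub>R x) = c *\<^sub>R r x"
    and bound: "\<And>x. x \<in> S \<Longrightarrow> norm (r x) \<le> norm x"
  obtains T :: "'a \<Rightarrow>\<^sub>L 'b" where "\<And>x. x \<in> S \<Longrightarrow> blinfun_apply T x = r x"
proof -
  have diff: "norm (r x - r y) \<le> norm (x - y)" if "x \<in> S" "y \<in> S" for x y
    using add[OF that(1) S_scale[OF that(2), of "-1"]] scale[OF that(2), of "-1"]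
      bound[OF S_add[OF that(1) S_scale[OF that(2), of "-1"]]] by simp
  have "uniformly_continuous_on S r"
    unfolding uniformly_continuous_on_def dist_norm using diff by (meson le_less_trans)
  then obtain g where g: "uniformly_continuous_on (closure S) g" and rg: "\<And>x. x \<in> S \<Longrightarrow> r x = g x"
    by (rule uniformly_continuous_on_extension_on_closure) blast
  have gc: "(\<lambda>n. g (u n)) \<longlonglongrightarrow> g l" if "u \<longlonglongrightarrow> l" for u l
    using uniformly_continuous_imp_continuous[OF g] that unfolding dense
    by (simp add: continuous_on_eq_continuous_at isCont_tendsto_compose)
  have seq: "\<exists>u. (\<forall>n. u n \<in> S) \<and> u \<longlonglongrightarrow> x" for x
    using dense closure_sequential by blast
  have "bounded_linear g"
  proof (rule bounded_linear_intro[where K=1])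
    fix x y
    obtain u v where u: "\<And>n. u n \<in> S" "u \<longlonglongrightarrow> x" and v: "\<And>n. v n \<in> S" "v \<longlonglongrightarrow> y"
      using seq[of x] seq[of y] by blast
    have "g (u n + v n) = g (u n) + g (v n)" for n
      using add[OF u(1) v(1), of n n] rg S_add u(1) v(1) by metis
    then show "g (x + y) = g x + g y"
      using LIMSEQ_unique[OF gc[OF tendsto_add[OF u(2) v(2)]]] tendsto_add[OF gc[OF u(2)] gc[OF v(2)]] by simp
    fix c :: real
    have "g (c *\<^sub>R u n) = c *\<^sub>R g (u n)" for n
      using scale[OF u(1), of c n] rg S_scale u(1) by metis
    then show "g (c *\<^sub>R x) = c *\<^sub>R g x"
      using LIMSEQ_unique[OF gc[OF tendsto_scaleR[OF tendsto_const u(2)]]] tendsto_scaleR[OF tendsto_const gc[OF u(2)]] by simp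
    have "norm (g (u n)) \<le> norm (u n)" for n
      using bound[OF u(1)] rg u(1) by metis
    then show "norm (g x) \<le> norm x * 1"
      using LIMSEQ_le[OF tendsto_norm[OF gc[OF u(2)]] tendsto_norm[OF u(2)]] by auto
  qed
  then have "blinfun_apply (Blinfun g) x = r x" if "x \<in> S" for x
    using rg[OF that] by (simp add: bounded_linear_Blinfun_apply)
  then show ?thesis by (rule that)
qed

definition schwartz_L2 :: "(real^'n) L2 set" where
  "schwartz_L2 = L2_class ` {f. schwartz f}"

lemma schwartz_square_integrable:
  fixes f :: "real^'n \<Rightarrow> complex"
  assumes f: "schwartz f"
  shows "square_integrable f"
proof -
  \<comment> \<open>Only the modulus of \<open>f\<close> matters, so any chirp will do.\<close>
  obtain L M where "lipschitz_L1 (\<lambda>x. f x * chirp 0 x) L M" by (rule schwartz_chirp_lipschitz_L1[OF f])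
  then interpret lipschitz_L1 "\<lambda>x. f x * chirp 0 x" L M .
  show ?thesis
    using sq_int schwartz_measurable[OF f] by (simp add: square_integrable_def norm_mult)
qed

lemma schwartz_L2_dense: "closure schwartz_L2 = (UNIV :: (real^'n) L2 set)"
proof -
  have "{f :: real^'n \<Rightarrow> complex. schwartz f \<and> square_integrable f} = {f. schwartz f}"
    using schwartz_square_integrable by auto
  then show ?thesis
    using schwartz_dense unfolding schwartz_hull_def schwartz_L2_def by metis
qed

lemma square_integrable_unimodular:
  assumes f: "square_integrable f" and c: "c \<in> borel_measurable borel" "\<And>x. cmod (c x) = 1"
  shows "square_integrable (\<lambda>x. c x * f x)"
  using assms by (auto simp: square_integrable_def norm_mult intro: borel_measurable_times)

lemma frac_riesz_pv_square_integrable: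
  fixes f :: "real^'n \<Rightarrow> complex"
  assumes f: "schwartz f"
  shows "square_integrable (frac_riesz_pv \<alpha> j f)"
proof -
  obtain L M where "lipschitz_L1 (\<lambda>x. f x * chirp \<alpha> x) L M" by (rule schwartz_chirp_lipschitz_L1[OF f])
  then interpret lipschitz_L1 "\<lambda>x. f x * chirp \<alpha> x" L M .
  show ?thesis
    unfolding frac_riesz_pv_eq[OF f, abs_def]
    by (rule square_integrable_unimodular[OF trunc_riesz_L2_close(1)[OF axis_Basis] chirp_measurable cmod_chirp])
qed

lemma sum_Basis_axis: "(\<Sum>b\<in>(Basis :: (real^'n) set). F b) = (\<Sum>j\<in>(UNIV :: 'n set). F (axis j 1))"
proof -
  have 1: "(Basis :: (real^'n) set) = (\<lambda>k::'n. axis k 1) ` UNIV" by (auto simp: Basis_vec_def)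
  have "inj (\<lambda>k::'n. axis k (1::real))" by (auto simp: inj_on_def axis_eq_axis)
  then show ?thesis unfolding 1 by (simp add: sum.reindex)
qed

lemma frac_riesz_pv_isometry:
  fixes f :: "real^'n \<Rightarrow> complex"
  assumes f: "schwartz f"
  shows "(\<Sum>j\<in>UNIV. (norm (L2_class (frac_riesz_pv \<alpha> j f)))\<^sup>2) = (norm (L2_class f))\<^sup>2"
proof -
  obtain L M where "lipschitz_L1 (\<lambda>x. f x * chirp \<alpha> x) L M" by (rule schwartz_chirp_lipschitz_L1[OF f])
  then interpret lipschitz_L1 "\<lambda>x. f x * chirp \<alpha> x" L M .
  have "(norm (L2_class (frac_riesz_pv \<alpha> j f)))\<^sup>2 = (norm (L2_class (riesz (axis j 1) (\<lambda>x. f x * chirp \<alpha> x))))\<^sup>2" for j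
    unfolding norm_L2_class_power2[OF frac_riesz_pv_square_integrable[OF f]] norm_L2_class_power2[OF trunc_riesz_L2_close(1)[OF axis_Basis]]
    by (simp add: frac_riesz_pv_eq[OF f] norm_mult)
  then have "(\<Sum>j\<in>UNIV. (norm (L2_class (frac_riesz_pv \<alpha> j f)))\<^sup>2) = (norm (L2_class (\<lambda>x. f x * chirp \<alpha> x)))\<^sup>2"
    using riesz_isometry by (simp add: sum_Basis_axis)
  also have "\<dots> = (norm (L2_class f))\<^sup>2"
    unfolding norm_L2_class_power2[OF sq_int] norm_L2_class_power2[OF schwartz_square_integrable[OF f]]
    by (simp add: norm_mult)
  finally show ?thesis .
qed

lemma frac_riesz_pv_antisym:
  fixes f g :: "real^'n \<Rightarrow> complex"
  assumes f: "schwartz f" and g: "schwartz g"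
  shows "L2_class (frac_riesz_pv \<alpha> j f) \<bullet> L2_class g = - (L2_class f \<bullet> L2_class (frac_riesz_pv \<alpha> j g))"
proof -
  obtain L M where lf: "lipschitz_L1 (\<lambda>x. f x * chirp \<alpha> x) L M" by (rule schwartz_chirp_lipschitz_L1[OF f])
  obtain L' M' where lg: "lipschitz_L1 (\<lambda>x. g x * chirp \<alpha> x) L' M'" by (rule schwartz_chirp_lipschitz_L1[OF g])
  have move: "(cnj c * z) \<bullet> w = z \<bullet> (w * c)" "w \<bullet> (cnj c * z) = (w * c) \<bullet> z" for c z w :: complex
    by (simp_all add: inner_complex_def algebra_simps)
  show ?thesis
    using lipschitz_L1.riesz_antisym[OF lf axis_Basis lg, of j]
    by (simp add: inner_L2_class frac_riesz_pv_square_integrable schwartz_square_integrable f g frac_riesz_pv_eq chirp_minus move)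
qed

lemma frac_riesz_pv_add:
  fixes f g :: "real^'n \<Rightarrow> complex"
  assumes f: "schwartz f" and g: "schwartz g"
  shows "frac_riesz_pv \<alpha> j (\<lambda>x. f x + g x) = (\<lambda>x. frac_riesz_pv \<alpha> j f x + frac_riesz_pv \<alpha> j g x)"
proof
  fix x
  obtain L M where lf: "lipschitz_L1 (\<lambda>x. f x * chirp \<alpha> x) L M" by (rule schwartz_chirp_lipschitz_L1[OF f])
  obtain L' M' where lg: "lipschitz_L1 (\<lambda>x. g x * chirp \<alpha> x) L' M'" by (rule schwartz_chirp_lipschitz_L1[OF g])
  show "frac_riesz_pv \<alpha> j (\<lambda>x. f x + g x) x = frac_riesz_pv \<alpha> j f x + frac_riesz_pv \<alpha> j g x"
    using riesz_add[OF lf lg axis_Basis, of j x]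
    by (simp add: frac_riesz_pv_eq f g schwartz_add distrib_right distrib_left)
qed

lemma frac_riesz_pv_scaleR:
  fixes f :: "real^'n \<Rightarrow> complex"
  assumes f: "schwartz f"
  shows "frac_riesz_pv \<alpha> j (\<lambda>x. r *\<^sub>R f x) = (\<lambda>x. r *\<^sub>R frac_riesz_pv \<alpha> j f x)"
  using riesz_scaleR[of "axis j 1" r "\<lambda>x. f x * chirp \<alpha> x"]
  by (simp add: frac_riesz_pv_eq f schwartz_scaleR fun_eq_iff)

lemma frac_riesz_pv_norm_le:
  fixes f :: "real^'n \<Rightarrow> complex"
  assumes f: "schwartz f"
  shows "norm (L2_class (frac_riesz_pv \<alpha> j f)) \<le> norm (L2_class f)"
proof -
  have "(norm (L2_class (frac_riesz_pv \<alpha> j f)))\<^sup>2 \<le> (norm (L2_class f))\<^sup>2"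
    unfolding frac_riesz_pv_isometry[OF f, of \<alpha>, symmetric] by (rule member_le_sum) auto
  then show ?thesis by (rule power2_le_imp_le) simp
qed

text \<open>
  The transform of a class in \<open>L\<^sup>2\<close> does not depend on the Schwartz function that represents the class,
  because the transform is linear and does not increase norms; for the same reason it extends
  continuously from the dense subspace.
\<close>

lemma frac_riesz_exists:
  fixes \<alpha> :: "real^'n"
  obtains T :: "(real^'n) L2 \<Rightarrow>\<^sub>L (real^'n) L2"
  where "\<And>f. schwartz f \<Longrightarrow> blinfun_apply T (L2_class f) = L2_class (frac_riesz_pv \<alpha> j f)"
proof -
  define r where "r = (\<lambda>u. L2_class (frac_riesz_pv \<alpha> j (SOME f. schwartz f \<and> L2_class f = u)))"
  note si = schwartz_square_integrable and psi = frac_riesz_pv_square_integrable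
  have r: "r (L2_class f) = L2_class (frac_riesz_pv \<alpha> j f)" if f: "schwartz f" for f
  proof -
    define g where "g = (SOME g. schwartz g \<and> L2_class g = L2_class f)"
    have g: "schwartz g" "L2_class g = L2_class f"
      using someI[of "\<lambda>g. schwartz g \<and> L2_class g = L2_class f" f] f by (simp_all add: g_def)
    define h where "h = (\<lambda>x. g x + (-1) *\<^sub>R f x)"
    have h: "schwartz h" unfolding h_def by (intro schwartz_add schwartz_scaleR f g)
    have "L2_class h = L2_class g + (-1) *\<^sub>R L2_class f"
      using si[OF f] si[OF g(1)] by (simp add: h_def minus_L2_class)
    then have "norm (L2_class h) = 0" by (simp add: g(2))
    then have "L2_class (frac_riesz_pv \<alpha> j h) = 0"
      using frac_riesz_pv_norm_le[OF h, of \<alpha> j] by simp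
    moreover have "L2_class (frac_riesz_pv \<alpha> j h) = L2_class (frac_riesz_pv \<alpha> j g) + (-1) *\<^sub>R L2_class (frac_riesz_pv \<alpha> j f)"
      unfolding h_def frac_riesz_pv_add[OF g(1) schwartz_scaleR[OF f]] frac_riesz_pv_scaleR[OF f]
      using psi[OF f] psi[OF g(1)] by (simp add: minus_L2_class)
    ultimately show ?thesis by (simp add: r_def g_def[symmetric])
  qed
  obtain T where T: "\<And>u. u \<in> schwartz_L2 \<Longrightarrow> blinfun_apply T u = r u"
  proof (rule dense_extension[OF schwartz_L2_dense])
    fix u v :: "(real^'n) L2" and c :: real
    assume u: "u \<in> schwartz_L2"
    then obtain f where f: "schwartz f" "u = L2_class f" by (auto simp: schwartz_L2_def)
    have cu: "c *\<^sub>R u = L2_class (\<lambda>x. c *\<^sub>R f x)" unfolding f(2) by (rule scaleR_L2_class[OF si[OF f(1)]])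
    show "c *\<^sub>R u \<in> schwartz_L2" unfolding cu schwartz_L2_def using f schwartz_scaleR by blast
    show "r (c *\<^sub>R u) = c *\<^sub>R r u"
      unfolding cu unfolding f(2) r[OF schwartz_scaleR[OF f(1)]] r[OF f(1)] frac_riesz_pv_scaleR[OF f(1)]
      by (rule scaleR_L2_class[OF psi[OF f(1)], symmetric])
    show "norm (r u) \<le> norm u" using f by (simp add: r frac_riesz_pv_norm_le)
    assume "v \<in> schwartz_L2"
    then obtain g where g: "schwartz g" "v = L2_class g" by (auto simp: schwartz_L2_def)
    have uv: "u + v = L2_class (\<lambda>x. f x + g x)" unfolding f(2) g(2) by (rule plus_L2_class[OF si[OF f(1)] si[OF g(1)]])
    show "u + v \<in> schwartz_L2" unfolding uv schwartz_L2_def using f g schwartz_add by blast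
    show "r (u + v) = r u + r v"
      unfolding uv unfolding f(2) g(2) r[OF schwartz_add[OF f(1) g(1)]] r[OF f(1)] r[OF g(1)] frac_riesz_pv_add[OF f(1) g(1)]
      by (rule plus_L2_class[OF psi[OF f(1)] psi[OF g(1)], symmetric])
  qed blast
  show ?thesis
    by (rule that[of T]) (simp add: T schwartz_L2_def r)
qed

lemma frac_riesz_schwartz:
  fixes f :: "real^'n \<Rightarrow> complex"
  assumes f: "schwartz f"
  shows "blinfun_apply (frac_riesz \<alpha> j) (L2_class f) = L2_class (frac_riesz_pv \<alpha> j f)"
proof -
  let ?P = "\<lambda>T. \<forall>f. schwartz f \<longrightarrow> square_integrable (frac_riesz_pv \<alpha> j f) \<and> blinfun_apply T (L2_class f) = L2_class (frac_riesz_pv \<alpha> j f)"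
  obtain T where T: "\<And>f. schwartz f \<Longrightarrow> blinfun_apply T (L2_class f) = L2_class (frac_riesz_pv \<alpha> j f)"
    by (rule frac_riesz_exists[of \<alpha> j]) blast
  have "\<exists>!T. ?P T"
  proof (rule ex1I[of _ T])
    show "?P T" using T frac_riesz_pv_square_integrable by blast
    fix T' assume T': "?P T'"
    have eq: "blinfun_apply T' u = blinfun_apply T u" if "u \<in> schwartz_L2" for u
      using that T T' by (auto simp: schwartz_L2_def)
    show "T' = T"
    proof (rule blinfun_eqI)
      fix u :: "(real^'n) L2"
      obtain x where x: "\<And>n. x n \<in> schwartz_L2" "x \<longlonglongrightarrow> u"
        using schwartz_L2_dense closure_sequential by blast
      have "(\<lambda>n. blinfun_apply T' (x n)) \<longlonglongrightarrow> blinfun_apply T' u" "(\<lambda>n. blinfun_apply T (x n)) \<longlonglongrightarrow> blinfun_apply T u"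
        by (intro tendsto_intros x)+
      then show "blinfun_apply T' u = blinfun_apply T u"
        using x(1) by (simp add: eq LIMSEQ_unique)
    qed
  qed
  from theI'[OF this] f show ?thesis
    unfolding frac_riesz_def by blast
qed

section \<open>The sum of the squares\<close>

lemma frac_riesz_isometry: "(\<Sum>j\<in>UNIV. (norm (blinfun_apply (frac_riesz \<alpha> j) u))\<^sup>2) = (norm u)\<^sup>2"
proof -
  obtain x where x: "\<And>n. x n \<in> schwartz_L2" "x \<longlonglongrightarrow> u"
    using schwartz_L2_dense closure_sequential by blast
  have "(\<Sum>j\<in>UNIV. (norm (blinfun_apply (frac_riesz \<alpha> j) (x n)))\<^sup>2) = (norm (x n))\<^sup>2" for n
    using x(1)[of n] by (auto simp: schwartz_L2_def frac_riesz_schwartz frac_riesz_pv_isometry)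
  moreover have "(\<lambda>n. \<Sum>j\<in>UNIV. (norm (blinfun_apply (frac_riesz \<alpha> j) (x n)))\<^sup>2) \<longlonglongrightarrow> (\<Sum>j\<in>UNIV. (norm (blinfun_apply (frac_riesz \<alpha> j) u))\<^sup>2)"
    by (intro tendsto_intros x)
  moreover have "(\<lambda>n. (norm (x n))\<^sup>2) \<longlonglongrightarrow> (norm u)\<^sup>2" by (intro tendsto_intros x)
  ultimately show ?thesis using LIMSEQ_unique by simp
qed

lemma frac_riesz_antisym: "blinfun_apply (frac_riesz \<alpha> j) u \<bullet> v = - (u \<bullet> blinfun_apply (frac_riesz \<alpha> j) v)"
proof -
  let ?T = "blinfun_apply (frac_riesz \<alpha> j)"
  obtain x where x: "\<And>n. x n \<in> schwartz_L2" "x \<longlonglongrightarrow> u"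
    using schwartz_L2_dense closure_sequential by blast
  obtain y where y: "\<And>n. y n \<in> schwartz_L2" "y \<longlonglongrightarrow> v"
    using schwartz_L2_dense closure_sequential by blast
  have "?T (x n) \<bullet> y n = - (x n \<bullet> ?T (y n))" for n
    using x(1)[of n] y(1)[of n] by (auto simp: schwartz_L2_def frac_riesz_schwartz frac_riesz_pv_antisym)
  moreover have "(\<lambda>n. ?T (x n) \<bullet> y n) \<longlonglongrightarrow> ?T u \<bullet> v" by (intro tendsto_intros x y)
  moreover have "(\<lambda>n. - (x n \<bullet> ?T (y n))) \<longlonglongrightarrow> - (u \<bullet> ?T v)" by (intro tendsto_intros x y)
  ultimately show ?thesis using LIMSEQ_unique by simp
qed

theorem theorem2p4:
  fixes \<alpha> :: "real^'n"
  assumes "\<And>k (m :: int). \<alpha> $ k \<noteq> of_int m * pi"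
  shows "(\<Sum>j\<in>UNIV. frac_riesz \<alpha> j o\<^sub>L frac_riesz \<alpha> j) = - id_blinfun"
proof (rule blinfun_eqI)
  fix u :: "(real^'n) L2"
  let ?T = "\<lambda>j. blinfun_apply (frac_riesz \<alpha> j)"
  \<comment> \<open>Polarization of the isometry.\<close>
  have polar: "(\<Sum>j\<in>UNIV. ?T j u \<bullet> ?T j v) = u \<bullet> v" for v
  proof -
    have "(\<Sum>j\<in>UNIV. (norm (?T j (u + v)))\<^sup>2) = (\<Sum>j\<in>UNIV. (norm (?T j u))\<^sup>2) + 2 * (\<Sum>j\<in>UNIV. ?T j u \<bullet> ?T j v) + (\<Sum>j\<in>UNIV. (norm (?T j v))\<^sup>2)"
      by (simp add: blinfun.add_right power2_norm_eq_inner inner_add_left inner_add_right inner_commute sum.distrib sum_distrib_left)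
    moreover have "(norm (u + v))\<^sup>2 = (norm u)\<^sup>2 + 2 * (u \<bullet> v) + (norm v)\<^sup>2"
      by (simp add: power2_norm_eq_inner inner_add_left inner_add_right inner_commute)
    ultimately show ?thesis by (simp add: frac_riesz_isometry)
  qed
  have "((\<Sum>j\<in>UNIV. ?T j (?T j u)) + u) \<bullet> v = 0" for v
    using polar[of v] by (simp add: inner_add_left inner_sum_left frac_riesz_antisym[of _ _ "?T _ u"] sum_negf)
  then have "(\<Sum>j\<in>UNIV. ?T j (?T j u)) + u = 0"
    using inner_eq_zero_iff by blast
  then show "blinfun_apply (\<Sum>j\<in>UNIV. frac_riesz \<alpha> j o\<^sub>L frac_riesz \<alpha> j) u = blinfun_apply (- id_blinfun) u"
    by (simp add: blinfun.sum_left blinfun.minus_left eq_neg_iff_add_eq_0)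
qed

end
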